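(* Let $G$ be a $2$-edge-connected graph which has a decomposition into a tree $T$ and a cycle $C$, where $C$ has $k \le 3$ components. Then $G$ has a CDC $\mathcal S$ with $C \in \mathcal S$. More precisely: (1) if $k \le 2$, then $G$ has a $5$-CDC $\mathcal S_2$ with $C \in \mathcal S_2$; (2) if $k = 3$, then $G$ has a $5$-CDC $\mathcal S_3$ with $C \in \mathcal S_3$ provided $G$ is not contractible to the Petersen graph; otherwise $G$ has a $6$-CDC $\mathcal S_3'$ with $C \in \mathcal S_3'$.
   Context: Graphs are finite and may have parallel edges. A cycle is a graph (here a subgraph of $G$) in which every vertex has even degree. A decomposition of $G$ is a set of edge-disjoint subgraphs whose edge sets cover $E(G)$. A cycle double cover (CDC) of $G$ is a set of cycles of $G$ such that every edge lies in the edge sets of exactly two of them; a $k$-CDC is a CDC consisting of $k$ cycles. "Contractible to the Petersen graph" means the Petersen graph can be obtained from $G$ by contracting edges. *)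

theory Defs
  imports Main "HOL-Library.Multiset"
begin

section \<open>Multigraphs\<close>

text \<open>
  Edges are abstract objects, so that parallel edges are distinct; \<open>ends G e\<close> is the
  set of end vertices of \<open>e\<close> (a singleton if \<open>e\<close> is a loop).  The record type itself
  admits loops, since these arise from contractions; \<open>multigraph\<close> excludes them.
\<close>

record ('v, 'e) mgraph =
  verts :: "'v set"
  edges :: "'e set"
  ends :: "'e \<Rightarrow> 'v set"

definition multigraph :: "('v, 'e) mgraph \<Rightarrow> bool" where
  "multigraph G \<longleftrightarrow> finite (verts G) \<and> finite (edges G) \<and>
     (\<forall>e\<in>edges G. ends G e \<subseteq> verts G \<and> card (ends G e) = 2)"

text \<open>
  A subgraph inherits the whole incidence function, so it is determined by its vertex set
  and its edge set.
\<close>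

definition subgraph :: "('v, 'e) mgraph \<Rightarrow> ('v, 'e) mgraph \<Rightarrow> bool" where
  "subgraph H G \<longleftrightarrow> verts H \<subseteq> verts G \<and> edges H \<subseteq> edges G \<and> ends H = ends G \<and>
     (\<forall>e\<in>edges H. ends H e \<subseteq> verts H)"

text \<open>Only used for loopless graphs; a loop would have to be counted twice.\<close>

definition degree :: "('v, 'e) mgraph \<Rightarrow> 'v \<Rightarrow> nat" where
  "degree G v = card {e \<in> edges G. v \<in> ends G e}"

section \<open>Connectivity\<close>

definition adj :: "('v, 'e) mgraph \<Rightarrow> ('v \<times> 'v) set" where
  "adj G = {(u, v). \<exists>e\<in>edges G. ends G e = {u, v}}"

definition joined :: "('v, 'e) mgraph \<Rightarrow> ('v \<times> 'v) set" where
  "joined G = {(u, v). u \<in> verts G \<and> v \<in> verts G \<and> (u, v) \<in> (adj G)\<^sup>*}"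

definition connected :: "('v, 'e) mgraph \<Rightarrow> bool" where
  "connected G \<longleftrightarrow> verts G \<noteq> {} \<and> (\<forall>u\<in>verts G. \<forall>v\<in>verts G. (u, v) \<in> joined G)"

text \<open>Components are represented by their vertex sets; isolated vertices are components.\<close>

definition components :: "('v, 'e) mgraph \<Rightarrow> 'v set set" where
  "components G = verts G // joined G"

definition delete_edges :: "('v, 'e) mgraph \<Rightarrow> 'e set \<Rightarrow> ('v, 'e) mgraph" where
  "delete_edges G F = G\<lparr>edges := edges G - F\<rparr>"

definition edge_connected :: "nat \<Rightarrow> ('v, 'e) mgraph \<Rightarrow> bool" where
  "edge_connected k G \<longleftrightarrow> card (verts G) \<ge> 2 \<and>
     (\<forall>F. F \<subseteq> edges G \<and> card F < k \<longrightarrow> connected (delete_edges G F))"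

section \<open>Trees, cycles and decompositions\<close>

text \<open>
  A circuit is what is often called a cycle: a connected 2-regular graph (two parallel edges
  form a circuit).  A cycle, in contrast, is any graph all of whose degrees are even; it may
  be disconnected, and may have isolated vertices or no edges at all.
\<close>

definition circuit :: "('v, 'e) mgraph \<Rightarrow> bool" where
  "circuit H \<longleftrightarrow> connected H \<and> (\<forall>v\<in>verts H. degree H v = 2)"

definition tree :: "('v, 'e) mgraph \<Rightarrow> bool" where
  "tree T \<longleftrightarrow> connected T \<and> \<not> (\<exists>H. subgraph H T \<and> circuit H)"

definition cycle :: "('v, 'e) mgraph \<Rightarrow> bool" where
  "cycle C \<longleftrightarrow> (\<forall>v\<in>verts C. even (degree C v))"

definition decomposition :: "('v, 'e) mgraph \<Rightarrow> ('v, 'e) mgraph set \<Rightarrow> bool" where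
  "decomposition G D \<longleftrightarrow> (\<forall>H\<in>D. subgraph H G) \<and>
     (\<forall>H\<in>D. \<forall>K\<in>D. H \<noteq> K \<longrightarrow> edges H \<inter> edges K = {}) \<and>
     (\<Union>H\<in>D. edges H) = edges G"

section \<open>Cycle double covers\<close>

text \<open>
  A cycle double cover is a multiset, as usual in this area: the same cycle may be used
  twice, and cycles without edges are allowed.  This is needed already when \<open>G\<close> is a
  circuit, whose edges lie in no edge-containing cycle other than \<open>G\<close> itself.
\<close>

definition cdc :: "('v, 'e) mgraph \<Rightarrow> ('v, 'e) mgraph multiset \<Rightarrow> bool" where
  "cdc G S \<longleftrightarrow> (\<forall>C\<in>#S. subgraph C G \<and> cycle C) \<and>
     (\<forall>e\<in>edges G. size {#C \<in># S. e \<in> edges C#} = 2)"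

definition k_cdc :: "nat \<Rightarrow> ('v, 'e) mgraph \<Rightarrow> ('v, 'e) mgraph multiset \<Rightarrow> bool" where
  "k_cdc k G S \<longleftrightarrow> cdc G S \<and> size S = k"

section \<open>Contraction to the Petersen graph\<close>

text \<open>
  Contracting the edges in \<open>X\<close> identifies the vertices of each component of the spanning
  subgraph with edge set \<open>X\<close> and removes the edges in \<open>X\<close>.  All other edges are kept, also
  those that become loops or parallel to other edges.
\<close>

definition contract :: "('v, 'e) mgraph \<Rightarrow> 'e set \<Rightarrow> ('v set, 'e) mgraph" where
  "contract G X = (let H = G\<lparr>edges := X\<rparr> in
     \<lparr>verts = components H, edges = edges G - X,
      ends = (\<lambda>e. (\<lambda>v. joined H `` {v}) ` ends G e)\<rparr>)"

definition isomorphic :: "('v, 'e) mgraph \<Rightarrow> ('w, 'f) mgraph \<Rightarrow> bool" where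
  "isomorphic G H \<longleftrightarrow> (\<exists>f g. bij_betw f (verts G) (verts H) \<and> bij_betw g (edges G) (edges H) \<and>
     (\<forall>e\<in>edges G. ends H (g e) = f ` ends G e))"

text \<open>The Petersen graph as the Kneser graph on the 2-subsets of a 5-element set.\<close>

definition petersen :: "(nat set, nat set set) mgraph" where
  "petersen = (let V = {A. A \<subseteq> {..<5} \<and> card A = 2} in
     \<lparr>verts = V, edges = {{A, B} | A B. A \<in> V \<and> B \<in> V \<and> A \<inter> B = {}}, ends = (\<lambda>e. e)\<rparr>)"

definition contractible_to_petersen :: "('v, 'e) mgraph \<Rightarrow> bool" where
  "contractible_to_petersen G \<longleftrightarrow> (\<exists>X \<subseteq> edges G. isomorphic (contract G X) petersen)"

end

theory Submission
  imports Defs "HOL-Library.Z2" "HOL-Library.Product_Plus"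
begin

text \<open>
  Collapse every component of \<open>C\<close> to a vertex. In the resulting graph \<open>H\<close>, whose edges are those of
  \<open>T\<close>, the at most three collapsed vertices meet every circuit.  Contracting circuits of length at
  most four (a nowhere-zero flow with values in the Klein four-group extends over them) and edges at
  vertices of degree two preserves this; a remaining nonempty graph has girth five, and since any
  two leaves of the forest outside the special vertices share at most one special neighbour, it is
  the Petersen graph.

  If \<open>H\<close> has a nowhere-zero Klein flow, label the edges of \<open>C\<close> by the four group elements along Euler
  tours so that the boundary matches that of the flow, and label a \<open>T\<close>-edge of value \<open>a\<close> by
  \<open>{0, a}\<close> or its complement; as \<open>T\<close> is connected, the choices can be made such that each of the
  four label classes is even.  Together with \<open>C\<close> these classes form a 5-CDC.  If \<open>H\<close> contracts to the
  Petersen graph, the same argument works locally in the preimage of each vertex, where at most two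
  special vertices are left, and the local labellings are glued along a 5-CDC of the Petersen graph.
\<close>

section \<open>Boundaries of edge labellings and connectivity\<close>

text \<open>Four classes can be repaired together because, once \<open>C\<close> is labelled to
  match the boundary of the flow, the parity error at a vertex is the same for all four group
  elements. Complementing the label of a \<open>T\<close>-edge changes every class at both of its
  ends, so one edge set of \<open>T\<close> with prescribed parities is enough. The Petersen graph
  has no nowhere-zero Klein flow; hence the two sizes: four classes and \<open>C\<close>, or the
  five classes of a 5-CDC of the Petersen graph and \<open>C\<close>. Gluing succeeds because an
  even labelling of a three-edge cut by pairs always reads \<open>{i, j}\<close>,
  \<open>{j, k}\<close>, \<open>{i, k}\<close>, so any two of them agree up to renaming labels. The
  bound three is used twice: the leaves of the forest inject into the pairs of special vertices, so
  there are at most three; and the contraction keeps the special vertices apart, so a preimage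
  contains at most one. Circuits and bridges are expressed by even edge sets over the two-element
  field, since these survive every identification of vertices.\<close>

class elem2 = ab_group_add +
  assumes add_self [simp]: "x + x = 0"
begin

lemma add_self_left [simp]: "x + (x + y) = y"
  by (simp add: add.assoc [symmetric])

lemma add_eq_zero_iff: "x + y = 0 \<longleftrightarrow> x = y"
  by (metis add_self add_left_cancel)

end

instance bit :: elem2
proof
  fix x :: bit
  show "x + x = 0" by (cases x) auto
qed

instance prod :: (elem2, elem2) elem2
proof
  fix x :: "'a \<times> 'b"
  show "x + x = 0" by (cases x) (simp only: add_Pair add_self zero_prod_def)
qed

text \<open>The boundary of an edge labelling; in groups of exponent two the orientation of the edges given
  by \<open>s\<close> and \<open>t\<close> is immaterial, and loops contribute nothing.\<close>

definition bd :: "'e set \<Rightarrow> ('e \<Rightarrow> 'v) \<Rightarrow> ('e \<Rightarrow> 'v) \<Rightarrow> ('e \<Rightarrow> 'a::comm_monoid_add) \<Rightarrow> 'v \<Rightarrow> 'a" where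
  "bd E s t x v = (\<Sum>e\<in>E. (if s e = v then x e else 0) + (if t e = v then x e else 0))"

lemma bd_cong: "(\<And>e. e \<in> E \<Longrightarrow> x e = y e) \<Longrightarrow> bd E s t x v = bd E s t y v"
  unfolding bd_def by (rule sum.cong) auto

lemma bd_add: "bd E s t (\<lambda>e. x e + y e) v = bd E s t x v + bd E s t y v"
  unfolding bd_def sum.distrib [symmetric] by (rule sum.cong) (auto simp: algebra_simps)

lemma bd_zero [simp]: "bd E s t (\<lambda>_. 0) v = 0"
  by (simp add: bd_def)

lemma bd_sum_fun: "finite I \<Longrightarrow> bd E s t (\<lambda>e. \<Sum>i\<in>I. x i e) v = (\<Sum>i\<in>I. bd E s t (x i) v)"
  by (induction I rule: finite_induct) (simp_all add: bd_add)

lemma bd_diff: "finite E \<Longrightarrow> Z \<subseteq> E \<Longrightarrow> bd E s t x v = bd (E - Z) s t x v + bd Z s t x v"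
  unfolding bd_def by (simp add: sum.subset_diff)

lemma bd_Un: "finite A \<Longrightarrow> finite B \<Longrightarrow> A \<inter> B = {} \<Longrightarrow> bd (A \<union> B) s t x v = bd A s t x v + bd B s t x v"
  unfolding bd_def by (simp add: sum.union_disjoint)

lemma bd_insert: "finite A \<Longrightarrow> e \<notin> A \<Longrightarrow> bd (insert e A) s t x v =
    (if s e = v then x e else 0) + (if t e = v then x e else 0) + bd A s t x v"
  unfolding bd_def by (simp add: algebra_simps)

lemma bd_empty [simp]: "bd {} s t x v = 0"
  by (simp add: bd_def)

lemma bd_restrict:
  assumes "finite E" "Z \<subseteq> E" "\<And>e. e \<in> E - Z \<Longrightarrow> x e = 0"
  shows "bd E s t x v = bd Z s t x v"
proof -
  have "bd (E - Z) s t x v = bd (E - Z) s t (\<lambda>_. 0) v"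
    by (rule bd_cong) (use assms in auto)
  then show ?thesis using bd_diff [OF assms(1,2), of s t x v] by simp
qed

lemma bd_untouched: "v \<notin> s ` E \<Longrightarrow> v \<notin> t ` E \<Longrightarrow> bd E s t x v = 0"
  unfolding bd_def by (rule sum.neutral) auto

lemma bd_hom:
  assumes "\<And>a b. f (a + b) = f a + f b" "f 0 = 0"
  shows "f (bd E s t x v) = bd E s t (\<lambda>e. f (x e)) v"
proof -
  have "f (sum h E) = (\<Sum>e\<in>E. f (h e))" for h
    by (induction E rule: infinite_finite_induct) (auto simp: assms)
  then show ?thesis unfolding bd_def by (auto simp: assms intro!: sum.cong)
qed

lemma sum_bd:
  assumes "finite S"
  shows "(\<Sum>v\<in>S. bd E s t x v) =
    (\<Sum>e\<in>E. (if s e \<in> S then x e else 0) + (if t e \<in> S then x e else 0))"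
proof -
  have "(\<Sum>v\<in>S. bd E s t x v) =
      (\<Sum>e\<in>E. \<Sum>v\<in>S. (if s e = v then x e else 0) + (if t e = v then x e else 0))"
    unfolding bd_def by (rule sum.swap)
  also have "\<dots> = (\<Sum>e\<in>E. (if s e \<in> S then x e else 0) + (if t e \<in> S then x e else 0))"
    using assms by (simp add: sum.distrib)
  finally show ?thesis .
qed

text \<open>An edge with both ends in \<open>S\<close> is counted twice and cancels, so only the cut
  remains. The parity arguments apply this to components and preimages.\<close>

lemma sum_bd_cut:
  fixes x :: "'e \<Rightarrow> 'a::elem2"
  assumes "finite S" "finite E"
  shows "(\<Sum>v\<in>S. bd E s t x v) = (\<Sum>e\<in>{e\<in>E. (s e \<in> S) \<noteq> (t e \<in> S)}. x e)"
  unfolding sum_bd [OF assms(1)]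
  by (rule sum.mono_neutral_cong_right) (use assms in auto)

lemma sum_bd_all:
  fixes x :: "'e \<Rightarrow> 'a::elem2"
  assumes "finite S" "finite E" "s ` E \<subseteq> S" "t ` E \<subseteq> S"
  shows "(\<Sum>v\<in>S. bd E s t x v) = 0"
  unfolding sum_bd [OF assms(1)] by (rule sum.neutral) (use assms in auto)

text \<open>Identifying vertices adds up their boundaries. Flows therefore push forward along any
  vertex map; conversely, a flow after the identification only gives boundary sum zero on each
  fibre.\<close>

lemma bd_map:
  assumes "finite V" "s ` E \<subseteq> V" "t ` E \<subseteq> V"
  shows "bd E (f \<circ> s) (f \<circ> t) x w = (\<Sum>v\<in>{v\<in>V. f v = w}. bd E s t x v)"
  using assms by (subst sum_bd) (auto simp: bd_def image_subset_iff intro!: sum.cong)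

lemma bd_map_zero:
  assumes "finite E" "\<And>v. bd E s t x v = 0"
  shows "bd E (f \<circ> s) (f \<circ> t) x w = 0"
  using bd_map [of "s ` E \<union> t ` E" s E t f x w] assms by simp

lemma bd_map_loops:
  fixes x :: "'e \<Rightarrow> 'a::elem2"
  assumes "finite E" "Z \<subseteq> E" "\<And>e. e \<in> Z \<Longrightarrow> f (s e) = f (t e)"
  shows "bd (E - Z) (f \<circ> s) (f \<circ> t) x w = bd E (f \<circ> s) (f \<circ> t) x w"
proof -
  have "bd Z (f \<circ> s) (f \<circ> t) x w = 0"
    unfolding bd_def by (rule sum.neutral) (use assms in auto)
  then show ?thesis using bd_diff [OF assms(1,2), of "f \<circ> s" "f \<circ> t" x w] by simp
qed

section \<open>Connectivity through an edge set\<close>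

definition conn :: "'e set \<Rightarrow> ('e \<Rightarrow> 'v) \<Rightarrow> ('e \<Rightarrow> 'v) \<Rightarrow> ('v \<times> 'v) set" where
  "conn E s t = (\<Union>e\<in>E. {(s e, t e), (t e, s e)})\<^sup>*"

lemma conn_refl [simp]: "(a, a) \<in> conn E s t"
  by (simp add: conn_def)

lemma conn_edge: "e \<in> E \<Longrightarrow> (s e, t e) \<in> conn E s t" "e \<in> E \<Longrightarrow> (t e, s e) \<in> conn E s t"
  unfolding conn_def by (rule r_into_rtrancl, auto)+

lemma conn_trans: "(a, b) \<in> conn E s t \<Longrightarrow> (b, c) \<in> conn E s t \<Longrightarrow> (a, c) \<in> conn E s t"
  unfolding conn_def by (rule rtrancl_trans)

lemma conn_sym: "(a, b) \<in> conn E s t \<Longrightarrow> (b, a) \<in> conn E s t"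
proof -
  have "sym (conn E s t)"
    unfolding conn_def by (rule sym_rtrancl) (auto simp: sym_def)
  then show "(a, b) \<in> conn E s t \<Longrightarrow> (b, a) \<in> conn E s t" by (rule symD)
qed

lemma conn_induct [consumes 1, case_names refl step]:
  assumes "(a, b) \<in> conn E s t" "P a"
    "\<And>e u v. e \<in> E \<Longrightarrow> {u, v} = {s e, t e} \<Longrightarrow> (a, u) \<in> conn E s t \<Longrightarrow> P u \<Longrightarrow> P v"
  shows "P b"
  using assms(1) unfolding conn_def
proof (induction rule: rtrancl_induct)
  case base
  show ?case by fact
next
  case (step y z)
  then obtain e where "e \<in> E" "{y, z} = {s e, t e}" by auto
  with step show ?case using assms(3) unfolding conn_def by blast
qed

lemma conn_mono: "E \<subseteq> E' \<Longrightarrow> conn E s t \<subseteq> conn E' s t"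
  unfolding conn_def by (intro rtrancl_mono) auto

lemma conn_map_le:
  assumes "(a, b) \<in> conn E s t" "\<And>e. e \<in> E \<Longrightarrow> (f (s e), f (t e)) \<in> conn E' s' t'"
  shows "(f a, f b) \<in> conn E' s' t'"
  using assms(1)
proof (induction rule: conn_induct)
  case (step e u v)
  have "u = s e \<and> v = t e \<or> u = t e \<and> v = s e"
    using step.hyps(2) by (simp add: doubleton_eq_iff)
  then have "(f u, f v) \<in> conn E' s' t'"
    using assms(2) [OF step.hyps(1)] by (auto intro: conn_sym)
  then show ?case by (rule conn_trans [OF step.IH])
qed simp

lemma conn_map: "(a, b) \<in> conn E s t \<Longrightarrow> (f a, f b) \<in> conn E (f \<circ> s) (f \<circ> t)"
  by (rule conn_map_le [of a b E s t f]) (use conn_edge(1) [of _ E "f \<circ> s" "f \<circ> t"] in auto)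

lemma conn_closed:
  assumes "(a, b) \<in> conn E s t" "a \<in> U" "\<And>e. e \<in> E \<Longrightarrow> s e \<in> U \<longleftrightarrow> t e \<in> U"
  shows "b \<in> U"
  using assms(1)
proof (induction rule: conn_induct)
  case (step e u v)
  have "u = s e \<and> v = t e \<or> u = t e \<and> v = s e"
    using step.hyps(2) by (simp add: doubleton_eq_iff)
  then show ?case using step.IH assms(3) [OF step.hyps(1)] by auto
qed fact

lemma conn_step_iff:
  assumes "e \<in> E"
  shows "(a, s e) \<in> conn E s t \<longleftrightarrow> (a, t e) \<in> conn E s t"
proof
  assume "(a, s e) \<in> conn E s t"
  then show "(a, t e) \<in> conn E s t" by (rule conn_trans [OF _ conn_edge(1) [of e E s t, OF assms]])
next
  assume "(a, t e) \<in> conn E s t"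
  then show "(a, s e) \<in> conn E s t"
    by (rule conn_trans [OF _ conn_sym [OF conn_edge(1) [of e E s t, OF assms]]])
qed

lemma conn_finite: "finite E \<Longrightarrow> finite {v. (a, v) \<in> conn E s t}"
proof -
  assume "finite E"
  have "v \<in> insert a (s ` E \<union> t ` E)" if "(a, v) \<in> conn E s t" for v
    using that by (rule conn_closed) auto
  then have "{v. (a, v) \<in> conn E s t} \<subseteq> insert a (s ` E \<union> t ` E)" by blast
  then show ?thesis using \<open>finite E\<close> finite_subset by blast
qed

text \<open>Add up the edges of a walk over the two-element field: inner visits cancel and repeated
  edges do no harm, so no simple path has to be extracted.\<close>

lemma conn_chain:
  assumes "(a, b) \<in> conn E s t" "finite E"
  shows "\<exists>c. (\<forall>e. c e \<noteq> 0 \<longrightarrow> e \<in> E) \<and>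
    (\<forall>v. bd E s t c v = (of_bool (v = a) + of_bool (v = b) :: bit))"
  using assms(1)
proof (induction rule: conn_induct)
  case refl
  show ?case by (rule exI [of _ "\<lambda>_. 0"]) simp
next
  case (step e u v)
  then obtain c where c: "\<And>e. c e \<noteq> 0 \<Longrightarrow> e \<in> E"
    "\<And>v. bd E s t c v = (of_bool (v = a) + of_bool (v = u) :: bit)" by blast
  let ?d = "\<lambda>e'. of_bool (e' = e) :: bit"
  have "bd E s t ?d w = bd {e} s t ?d w" for w
    by (rule bd_restrict) (use step assms in auto)
  then have d: "bd E s t ?d w = of_bool (w = u) + of_bool (w = v)" for w
    using step by (auto simp: bd_insert doubleton_eq_iff)
  show ?case
  proof (rule exI [of _ "\<lambda>e. c e + ?d e"], intro conjI allI impI)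
    fix e' assume "c e' + ?d e' \<noteq> 0"
    then show "e' \<in> E" using c(1) [of e'] step.hyps(1) by (cases "e' = e") auto
  next
    fix w
    show "bd E s t (\<lambda>e. c e + ?d e) w = of_bool (w = a) + of_bool (w = v)"
      unfolding bd_add c d add.assoc add_self_left ..
  qed
qed

section \<open>Nowhere-zero flows with values in the Klein four-group\<close>

definition klein_flow :: "'e set \<Rightarrow> ('e \<Rightarrow> 'v) \<Rightarrow> ('e \<Rightarrow> 'v) \<Rightarrow> bool" where
  "klein_flow E s t \<longleftrightarrow> (\<exists>x::'e \<Rightarrow> bit \<times> bit. (\<forall>e\<in>E. x e \<noteq> 0) \<and> (\<forall>v. bd E s t x v = 0))"

text \<open>Every circuit meets \<open>W\<close>, expressed in the cycle space over the two-element field; likewise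
  \<open>bridgeless\<close> below says that every edge lies in an even edge set.\<close>

definition forest :: "'e set \<Rightarrow> ('e \<Rightarrow> 'v) \<Rightarrow> ('e \<Rightarrow> 'v) \<Rightarrow> 'v set \<Rightarrow> bool" where
  "forest E s t W \<longleftrightarrow> (\<forall>x::'e \<Rightarrow> bit. (\<forall>e\<in>E. x e \<noteq> 0 \<longrightarrow> s e \<notin> W \<and> t e \<notin> W) \<and>
     (\<forall>v. bd E s t x v = 0) \<longrightarrow> (\<forall>e\<in>E. x e = 0))"

lemma forestD:
  assumes "forest E s t W" "\<And>e. e \<in> E \<Longrightarrow> x e \<noteq> 0 \<Longrightarrow> s e \<notin> W \<and> t e \<notin> W"
    "\<And>v. bd E s t x v = (0::bit)" "e \<in> E"
  shows "x e = 0"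
  using assms unfolding forest_def by blast

definition bridgeless :: "'e set \<Rightarrow> ('e \<Rightarrow> 'v) \<Rightarrow> ('e \<Rightarrow> 'v) \<Rightarrow> bool" where
  "bridgeless E s t \<longleftrightarrow> (\<forall>e\<in>E. \<exists>x::'e \<Rightarrow> bit. x e = 1 \<and> (\<forall>v. bd E s t x v = 0))"

section \<open>Collapsing a vertex set to a single vertex\<close>

definition collapse :: "'v set \<Rightarrow> 'v \<Rightarrow> 'v \<Rightarrow> 'v" where
  "collapse S w v = (if v \<in> S then w else v)"

definition link :: "('e \<Rightarrow> 'v) \<Rightarrow> ('e \<Rightarrow> 'v) \<Rightarrow> 'e \<Rightarrow> 'v \<Rightarrow> 'v \<Rightarrow> bool" where
  "link s t e u v \<longleftrightarrow> {s e, t e} = {u, v}"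

lemma link_iff: "link s t e u v \<longleftrightarrow> s e = u \<and> t e = v \<or> s e = v \<and> t e = u"
  by (auto simp: link_def doubleton_eq_iff)

lemma link_sym: "link s t e u v \<Longrightarrow> link s t e v u"
  by (auto simp: link_iff)

lemma bd_insert_link:
  assumes "finite A" "e \<notin> A" "link s t e a b"
  shows "bd (insert e A) s t x v =
    (if a = v then x e else 0) + (if b = v then x e else 0) + bd A s t x v"
  using assms by (auto simp: bd_insert link_iff add.commute)

lemma conn_link: "e \<in> E \<Longrightarrow> link s t e a b \<Longrightarrow> (a, b) \<in> conn E s t"
  using conn_edge(1) [of e E s t] conn_sym [of "s e" "t e" E s t] by (auto simp: link_iff)

lemma bd_collapse:
  "w \<in> S \<Longrightarrow> v \<notin> S \<Longrightarrow> bd E (collapse S w \<circ> s) (collapse S w \<circ> t) x v = bd E s t x v"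
  unfolding bd_def by (rule sum.cong) (auto simp: collapse_def)

lemma bd_collapse_sum:
  assumes "finite S" "w \<in> S"
  shows "bd E (collapse S w \<circ> s) (collapse S w \<circ> t) x w = (\<Sum>v\<in>S. bd E s t x v)"
  unfolding sum_bd [OF assms(1)] unfolding bd_def
  by (rule sum.cong) (use assms in \<open>auto simp: collapse_def\<close>)

lemma bridgeless_contract:
  assumes "bridgeless E s t" "finite E" "Z \<subseteq> E" "\<And>e. e \<in> Z \<Longrightarrow> f (s e) = f (t e)"
  shows "bridgeless (E - Z) (f \<circ> s) (f \<circ> t)"
  unfolding bridgeless_def
proof
  fix e assume "e \<in> E - Z"
  then obtain x :: "'a \<Rightarrow> bit" where "x e = 1" "\<And>v. bd E s t x v = 0"
    using assms(1) unfolding bridgeless_def by blast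
  then show "\<exists>x::'a \<Rightarrow> bit. x e = 1 \<and> (\<forall>v. bd (E - Z) (f \<circ> s) (f \<circ> t) x v = 0)"
    using bd_map_loops [OF assms(2,3), of f s t x] bd_map_zero [OF assms(2), of s t x f] assms(4)
    by metis
qed

text \<open>Every circuit created by the collapse passes through \<open>w\<close>, which is special
  afterwards. An even set that avoids \<open>W'\<close> lives outside \<open>S\<close> and
  \<open>W\<close>, where nothing has changed, so it is even before the collapse as well.\<close>

lemma forest_collapse:
  assumes "forest E s t W" "finite E" "Z \<subseteq> E" "w \<in> S" "w \<in> W'" "collapse S w ` W \<subseteq> W'"
  shows "forest (E - Z) (collapse S w \<circ> s) (collapse S w \<circ> t) W'"
  unfolding forest_def
proof (intro allI impI, elim conjE)
  let ?f = "collapse S w"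
  fix x :: "'a \<Rightarrow> bit"
  assume supp: "\<forall>e\<in>E - Z. x e \<noteq> 0 \<longrightarrow> (?f \<circ> s) e \<notin> W' \<and> (?f \<circ> t) e \<notin> W'"
    and flow: "\<forall>v. bd (E - Z) (?f \<circ> s) (?f \<circ> t) x v = 0"
  define y where "y e = (if e \<in> E - Z then x e else 0)" for e
  have supp': "s e \<notin> S \<union> W \<and> t e \<notin> S \<union> W" if "e \<in> E" "y e \<noteq> 0" for e
  proof -
    have "?f (s e) \<notin> W'" "?f (t e) \<notin> W'"
      using that supp by (auto simp: y_def split: if_splits)
    moreover have "?f u \<in> W'" if "u \<in> S \<union> W" for u
      using that assms(5,6) by (cases "u \<in> S") (auto simp: collapse_def)
    ultimately show ?thesis by blast
  qed
  have "bd E s t y v = 0" for v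
  proof (cases "v \<in> S")
    case True
    then have "y e = 0" if "e \<in> E" "s e = v \<or> t e = v" for e
      using supp' [OF that(1)] that(2) by blast
    then show ?thesis unfolding bd_def by (intro sum.neutral) auto
  next
    case False
    have "bd E s t y v = bd (E - Z) s t y v"
      by (rule bd_restrict) (use assms in \<open>auto simp: y_def\<close>)
    also have "\<dots> = bd (E - Z) s t x v"
      by (rule bd_cong) (auto simp: y_def)
    finally show ?thesis using flow bd_collapse [OF assms(4) False] by metis
  qed
  then have "\<forall>e\<in>E. y e = 0"
    using assms(1) supp' unfolding forest_def by blast
  then show "\<forall>e\<in>E - Z. x e = 0" by (auto simp: y_def)
qed

section \<open>Extending Klein flows over contracted circuits of length at most four\<close>

lemma klein_flow_extend:
  fixes x y :: "'e \<Rightarrow> bit \<times> bit"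
  assumes "finite E" "Z \<subseteq> E" "\<And>e. e \<in> E - Z \<Longrightarrow> x e \<noteq> 0" "\<And>e. e \<in> Z \<Longrightarrow> y e \<noteq> 0"
    "\<And>v. bd (E - Z) s t x v = bd Z s t y v"
  shows "klein_flow E s t"
  unfolding klein_flow_def
proof (intro exI conjI ballI allI)
  let ?z = "\<lambda>e. if e \<in> Z then y e else x e"
  show "?z e \<noteq> 0" if "e \<in> E" for e using assms that by auto
  fix v
  have "bd E s t ?z v = bd (E - Z) s t ?z v + bd Z s t ?z v"
    by (rule bd_diff) (use assms in auto)
  also have "bd (E - Z) s t ?z v = bd (E - Z) s t x v" by (rule bd_cong) auto
  also have "bd Z s t ?z v = bd Z s t y v" by (rule bd_cong) auto
  finally show "bd E s t ?z v = 0" by (simp add: assms)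
qed

lemma klein_flow_collapse_obtain:
  assumes "klein_flow E (collapse S w \<circ> s) (collapse S w \<circ> t)" "finite S" "w \<in> S"
  obtains x :: "'e \<Rightarrow> bit \<times> bit" where "\<And>e. e \<in> E \<Longrightarrow> x e \<noteq> 0"
    "\<And>v. v \<notin> S \<Longrightarrow> bd E s t x v = 0" "(\<Sum>v\<in>S. bd E s t x v) = 0"
  using assms bd_collapse [of w S] bd_collapse_sum [of S w] unfolding klein_flow_def by metis

text \<open>On a circuit with prescribed boundary, the value of one edge determines the others, and
  each edge excludes one of the four group elements for it. Up to three edges leave a free element;
  a circuit of length four may not.\<close>

lemma klein_avoid: "\<exists>y::bit \<times> bit. y \<noteq> 0 \<and> y \<noteq> a \<and> y \<noteq> b"
proof -
  obtain a1 a2 b1 b2 where "a = (a1, a2)" "b = (b1, b2)" by fastforce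
  then show ?thesis
    by (cases a1; cases a2; cases b1; cases b2) (auto simp: zero_prod_def)
qed

lemma klein_flow_digon:
  assumes fin: "finite E" and E: "e1 \<in> E" "e2 \<in> E" and "e1 \<noteq> e2" "a \<noteq> b"
    and l: "link s t e1 a b" "link s t e2 a b" and w: "w \<in> {a, b}"
    and nz: "klein_flow (E - {e1, e2}) (collapse {a, b} w \<circ> s) (collapse {a, b} w \<circ> t)"
  shows "klein_flow E s t"
proof -
  obtain x :: "'a \<Rightarrow> bit \<times> bit" where x: "\<And>e. e \<in> E - {e1, e2} \<Longrightarrow> x e \<noteq> 0"
    "\<And>v. v \<notin> {a, b} \<Longrightarrow> bd (E - {e1, e2}) s t x v = 0"
    "(\<Sum>v\<in>{a, b}. bd (E - {e1, e2}) s t x v) = 0"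
    using klein_flow_collapse_obtain [OF nz _ w] by blast
  define d where "d = bd (E - {e1, e2}) s t x"
  have db: "d b = d a" using x(3) \<open>a \<noteq> b\<close> by (auto simp: d_def [symmetric] add_eq_zero_iff)
  obtain p where p: "p \<noteq> 0" "p \<noteq> d a" using klein_avoid by metis
  let ?y = "\<lambda>e. if e = e1 then p else p + d a"
  have "bd {e1, e2} s t ?y v = d v" for v
    using assms x(2) [of v, folded d_def] db
    by (auto simp: bd_insert_link [OF _ _ l(1)] bd_insert_link [OF _ _ l(2)])
  then show ?thesis
    using E p x(1) by (intro klein_flow_extend [OF fin, of "{e1, e2}" x ?y])
      (auto simp: d_def add_eq_zero_iff)
qed

lemma klein_flow_triangle:
  assumes fin: "finite E" and E: "e1 \<in> E" "e2 \<in> E" "e3 \<in> E" and dist: "distinct [a, b, c]"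
    and l: "link s t e1 a b" "link s t e2 b c" "link s t e3 c a" and w: "w \<in> {a, b, c}"
    and nz: "klein_flow (E - {e1, e2, e3}) (collapse {a, b, c} w \<circ> s) (collapse {a, b, c} w \<circ> t)"
  shows "klein_flow E s t"
proof -
  let ?Z = "{e1, e2, e3}"
  obtain x :: "'a \<Rightarrow> bit \<times> bit" where x: "\<And>e. e \<in> E - ?Z \<Longrightarrow> x e \<noteq> 0"
    "\<And>v. v \<notin> {a, b, c} \<Longrightarrow> bd (E - ?Z) s t x v = 0"
    "(\<Sum>v\<in>{a, b, c}. bd (E - ?Z) s t x v) = 0"
    using klein_flow_collapse_obtain [OF nz _ w] by blast
  define d where "d = bd (E - ?Z) s t x"
  have "d a + d b + d c = 0" using x(3) dist by (auto simp: d_def [symmetric] add.assoc)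
  then have dc: "d c = d a + d b" by (simp add: add_eq_zero_iff)
  have e: "e1 \<noteq> e2" "e1 \<noteq> e3" "e2 \<noteq> e3" using l dist by (auto simp: link_iff)
  obtain p where p: "p \<noteq> 0" "p \<noteq> d a" "p \<noteq> d b" using klein_avoid by metis
  let ?y = "\<lambda>e. if e = e1 then p else if e = e2 then p + d b else p + d a"
  have "bd ?Z s t ?y v = d v" for v
    using e dist x(2) [of v, folded d_def] dc
    by (auto simp: bd_insert_link [OF _ _ l(1)] bd_insert_link [OF _ _ l(2)]
        bd_insert_link [OF _ _ l(3)] ac_simps)
  then show ?thesis
    using E p x(1) by (intro klein_flow_extend [OF fin, of ?Z x ?y]) (auto simp: d_def add_eq_zero_iff)
qed

lemma sum_in_pair:
  fixes r :: "'a::elem2"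
  shows "(\<And>e. e \<in> A \<Longrightarrow> x e = 0 \<or> x e = r) \<Longrightarrow> sum x A = 0 \<or> sum x A = r"
proof (induction A rule: infinite_finite_induct)
  case (insert e A)
  then have "x e = 0 \<or> x e = r" "sum x A = 0 \<or> sum x A = r" by auto
  then show ?case using insert.hyps by auto
qed auto

lemma klein_third:
  fixes p q :: "bit \<times> bit"
  assumes "p \<noteq> 0" "q \<noteq> 0" "p \<noteq> q" "z \<noteq> 0" "z \<noteq> p" "z \<noteq> q"
  shows "z = p + q"
proof -
  obtain p1 p2 q1 q2 z1 z2 where "p = (p1, p2)" "q = (q1, q2)" "z = (z1, z2)"
    by (metis surj_pair)
  then show ?thesis using assms
    by (cases p1; cases p2; cases q1; cases q2; cases z1; cases z2) (auto simp: zero_prod_def)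
qed

text \<open>If the four boundary values leave no choice for the circuit, they are \<open>p, q, p, q\<close>
  with \<open>p \<noteq> q\<close>; exchanging \<open>p\<close> and \<open>q\<close> along a path of edges valued \<open>p\<close> or \<open>q\<close> from \<open>a\<close> to
  another vertex of the circuit then makes a choice possible.\<close>

lemma klein_flow_quad:
  assumes fin: "finite E" and E: "e1 \<in> E" "e2 \<in> E" "e3 \<in> E" "e4 \<in> E"
    and dist: "distinct [a, b, c, d]"
    and l: "link s t e1 a b" "link s t e2 b c" "link s t e3 c d" "link s t e4 d a"
    and w: "w \<in> {a, b, c, d}"
    and nz: "klein_flow (E - {e1, e2, e3, e4}) (collapse {a, b, c, d} w \<circ> s) (collapse {a, b, c, d} w \<circ> t)"
  shows "klein_flow E s t"
proof -
  let ?Z = "{e1, e2, e3, e4}" and ?S = "{a, b, c, d}"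
  have e: "distinct [e1, e2, e3, e4]" using l dist by (auto simp: link_iff)
  have ext: "klein_flow E s t"
    if x: "\<And>e. e \<in> E - ?Z \<Longrightarrow> x e \<noteq> 0" "\<And>v. v \<notin> ?S \<Longrightarrow> D v = 0"
      and D: "\<And>v. bd (E - ?Z) s t x v = D v" "D d = D a + D b + D c"
      and p: "p \<noteq> 0" "p \<noteq> D a" "p \<noteq> D b" "p \<noteq> D b + D c"
    for x :: "'a \<Rightarrow> bit \<times> bit" and D p
  proof -
    let ?y = "\<lambda>e. if e = e1 then p else if e = e2 then p + D b
      else if e = e3 then p + (D b + D c) else p + D a"
    have "bd ?Z s t ?y v = D v" for v
      using e dist x(2) [of v] D(2)
      by (auto simp: bd_insert_link [OF _ _ l(1)] bd_insert_link [OF _ _ l(2)]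
          bd_insert_link [OF _ _ l(3)] bd_insert_link [OF _ _ l(4)] ac_simps)
    then show ?thesis
      using E p x(1) D(1)
      by (intro klein_flow_extend [OF fin, of ?Z x ?y]) (auto simp: add_eq_zero_iff)
  qed
  obtain x :: "'a \<Rightarrow> bit \<times> bit" where x: "\<And>e. e \<in> E - ?Z \<Longrightarrow> x e \<noteq> 0"
    "\<And>v. v \<notin> ?S \<Longrightarrow> bd (E - ?Z) s t x v = 0"
    "(\<Sum>v\<in>?S. bd (E - ?Z) s t x v) = 0"
    using klein_flow_collapse_obtain [OF nz _ w] by blast
  define D where "D = bd (E - ?Z) s t x"
  have D0: "D v = 0" if "v \<notin> ?S" for v using x(2) [OF that] by (simp add: D_def)
  have "D a + D b + D c + D d = 0"
    using x(3) dist by (auto simp: D_def [symmetric] add.assoc)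
  then have Dd: "D d = D a + D b + D c" by (simp add: add_eq_zero_iff)
  show ?thesis
  proof (cases "\<exists>p. p \<noteq> 0 \<and> p \<noteq> D a \<and> p \<noteq> D b \<and> p \<noteq> D b + D c")
    case True
    then show ?thesis using ext [OF x(1) D0 _ Dd] by (auto simp: D_def)
  next
    case False
    define p q where "p = D a" and "q = D b"
    have bad: "z = 0 \<or> z = p \<or> z = q \<or> z = D b + D c" for z
      using False unfolding p_def q_def by blast
    have pq: "p \<noteq> 0" "q \<noteq> 0" "p \<noteq> q" "D c = p"
    proof -
      obtain z1 where "z1 \<noteq> 0" "z1 \<noteq> q" "z1 \<noteq> D b + D c" using klein_avoid by blast
      with bad [of z1] show "p \<noteq> 0" "p \<noteq> q" by auto
      obtain z2 where "z2 \<noteq> 0" "z2 \<noteq> p" "z2 \<noteq> D b + D c" using klein_avoid by blast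
      with bad [of z2] show "q \<noteq> 0" by auto
      obtain z3 where "z3 \<noteq> 0" "z3 \<noteq> p" "z3 \<noteq> q" using klein_avoid by blast
      with bad [of z3] have "D b + D c \<noteq> 0" "D b + D c \<noteq> p" "D b + D c \<noteq> q" by auto
      with \<open>p \<noteq> 0\<close> \<open>q \<noteq> 0\<close> \<open>p \<noteq> q\<close> have "D b + D c = p + q" by (intro klein_third)
      then show "D c = p" by (simp add: q_def add.commute)
    qed
    have Dd': "D d = q" using Dd pq(4) by (simp add: p_def q_def add.commute)
    define L where "L = {e \<in> E - ?Z. x e = p \<or> x e = q}"
    define U where "U = {v. (a, v) \<in> conn L s t}"
    have finL: "finite L" using fin by (simp add: L_def)
    have finU: "finite U" unfolding U_def by (rule conn_finite [OF finL])
    \<comment> \<open>A Kempe chain argument: if \<open>U\<close>, the component of \<open>a\<close>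
      in the edges valued \<open>p\<close> or \<open>q\<close>, contained no other vertex of the
      circuit, its total boundary would be \<open>p\<close>; but the edges leaving \<open>U\<close>
      all carry the third value \<open>p + q\<close>.\<close>
    have "\<exists>z\<in>{b, c, d}. z \<in> U"
    proof (rule ccontr)
      assume "\<not> (\<exists>z\<in>{b, c, d}. z \<in> U)"
      then have nU: "b \<notin> U" "c \<notin> U" "d \<notin> U" by auto
      have aU: "a \<in> U" by (simp add: U_def)
      have "(\<Sum>v\<in>U. D v) = (\<Sum>v\<in>{a}. D v)"
        by (rule sum.mono_neutral_right) (use finU aU nU D0 in auto)
      then have "(\<Sum>v\<in>U. D v) = p" by (simp add: p_def)
      moreover have "(\<Sum>v\<in>U. D v) = (\<Sum>e\<in>{e\<in>E - ?Z. (s e \<in> U) \<noteq> (t e \<in> U)}. x e)"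
        unfolding D_def by (rule sum_bd_cut) (use finU fin in auto)
      moreover have "x e = 0 \<or> x e = p + q" if "e \<in> {e\<in>E - ?Z. (s e \<in> U) \<noteq> (t e \<in> U)}" for e
      proof -
        have "e \<notin> L"
          using that conn_edge(1) [of e L s t] conn_sym [of "s e" "t e" L s t]
            conn_trans [of a _ L s t] by (auto simp: U_def)
        then show ?thesis using that pq x(1) [of e] klein_third [of p q "x e"] by (auto simp: L_def)
      qed
      ultimately have "p = 0 \<or> p = p + q"
        using sum_in_pair [of "{e\<in>E - ?Z. (s e \<in> U) \<noteq> (t e \<in> U)}" x "p + q"] by simp
      then show False using pq by auto
    qed
    then obtain z where z: "z \<in> {b, c, d}" "(a, z) \<in> conn L s t" by (auto simp: U_def)
    obtain g :: "'a \<Rightarrow> bit" where g: "\<And>e. g e \<noteq> 0 \<Longrightarrow> e \<in> L"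
      "\<And>v. bd L s t g v = of_bool (v = a) + of_bool (v = z)"
      using conn_chain [OF z(2) finL] by blast
    define r where "r = p + q"
    \<comment> \<open>Adding \<open>r = p + q\<close> exchanges \<open>p\<close> and
      \<open>q\<close>; the homomorphism \<open>h\<close> turns the chain \<open>g\<close> into this
      change of values.\<close>
    define h where "h u = (if u = 0 then 0 else r)" for u :: bit
    have h: "h (u + v) = h u + h v" "h 0 = 0" for u v
      unfolding h_def by (cases u; cases v; simp)+
    define x' where "x' e = x e + h (g e)" for e
    define D' where "D' v = D v + ((if v = a then r else 0) + (if v = z then r else 0))" for v
    have "bd (E - ?Z) s t (\<lambda>e. h (g e)) v = (if v = a then r else 0) + (if v = z then r else 0)" for v
    proof -
      have "g e = 0" if "e \<notin> L" for e using g(1) that by blast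
      then have "bd (E - ?Z) s t g v = bd L s t g v"
        by (intro bd_restrict) (use fin in \<open>auto simp: L_def\<close>)
      then have "h (bd (E - ?Z) s t g v) = h (of_bool (v = a)) + h (of_bool (v = z))"
        using g(2) [of v] h by simp
      also have "\<dots> = (if v = a then r else 0) + (if v = z then r else 0)" by (auto simp: h_def)
      finally show ?thesis using bd_hom [of h "E - ?Z" s t g v] h by simp
    qed
    then have bd': "bd (E - ?Z) s t x' v = D' v" for v
      unfolding x'_def bd_add D'_def by (simp add: D_def)
    have x'nz: "x' e \<noteq> 0" if "e \<in> E - ?Z" for e
    proof (cases "g e = 0")
      case False
      then have "x e = p \<or> x e = q" using g(1) [of e] by (auto simp: L_def)
      then show ?thesis using pq by (auto simp: x'_def h_def r_def add_eq_zero_iff)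
    qed (use x(1) that in \<open>auto simp: x'_def h_def\<close>)
    have D'0: "D' v = 0" if "v \<notin> ?S" for v
      using that z(1) D0 [OF that] by (auto simp: D'_def)
    have D'a: "D' a = q" using z(1) dist by (auto simp: D'_def p_def [symmetric] r_def)
    have done': "klein_flow E s t" if "D' d = D' a + D' b + D' c" "k \<noteq> 0" "k \<noteq> D' a" "k \<noteq> D' b"
      "k \<noteq> D' b + D' c" for k
      by (rule ext [of x' D' k]) (fact x'nz D'0 bd' that)+
    have D'_simp: "D' v = D v" if "v \<noteq> a" "v \<noteq> z" for v
      using that by (simp add: D'_def)
    have D'z: "D' z = D z + r" using z(1) dist by (auto simp: D'_def)
    have vals: "D b = q" "D c = p" "D d = q" "q + r = p" "p + r = q" "q + p \<noteq> p"
      using pq Dd' by (auto simp: q_def r_def ac_simps)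
    obtain k where k: "k \<noteq> 0" "k \<noteq> p" "k \<noteq> q" using klein_avoid by blast
    \<comment> \<open>The boundary becomes \<open>q, p, p, q\<close>, or \<open>q, q, q, q\<close>,
      or \<open>q, q, p, p\<close>. In each case two of the four excluded values coincide:
      \<open>k\<close> becomes free in the first two cases and \<open>p\<close> in the last.\<close>
    consider "z = b" | "z = c" | "z = d" using z(1) by auto
    then show ?thesis
    proof cases
      case 1
      have "D' b = p" "D' c = p" "D' d = q"
        using D'z D'_simp [of c] D'_simp [of d] dist unfolding 1 vals by auto
      then show ?thesis using D'a k by (intro done' [of k]) auto
    next
      case 2
      have "D' b = q" "D' c = q" "D' d = q"
        using D'z D'_simp [of b] D'_simp [of d] dist unfolding 2 vals by auto
      then show ?thesis using D'a k by (intro done' [of k]) auto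
    next
      case 3
      have "D' b = q" "D' c = p" "D' d = p"
        using D'z D'_simp [of b] D'_simp [of c] dist unfolding 3 vals by auto
      then show ?thesis using D'a pq(1,3) vals(6) by (intro done' [of p]) auto
    qed
  qed
qed

section \<open>Girth at least five and three special vertices\<close>

lemma pair_in_triple:
  assumes "P \<subseteq> {a, b, c}" "card P = 2"
  shows "P = {a, b} \<or> P = {a, c} \<or> P = {b, c}"
proof -
  obtain x y where "P = {x, y}" "x \<noteq> y" using assms(2) by (auto simp: card_2_iff)
  then show ?thesis using assms(1) by auto
qed

text \<open>The forest outside the special vertices \<open>w1, w2, w3\<close> is a spider with centre \<open>z\<close> and leaves
  \<open>l1, l2, l3\<close>.\<close>

definition petersen_arcs ::
  "'v \<Rightarrow> 'v \<Rightarrow> 'v \<Rightarrow> 'v \<Rightarrow> 'v \<Rightarrow> 'v \<Rightarrow> 'v \<Rightarrow> 'v \<Rightarrow> 'v \<Rightarrow> 'v \<Rightarrow> ('v \<times> 'v) set" where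
  "petersen_arcs z y1 y2 y3 l1 l2 l3 w1 w2 w3 = {(z, y1), (z, y2), (z, y3), (y1, l1), (y2, l2), (y3, l3),
     (y1, w1), (y2, w2), (y3, w3), (l1, w2), (l1, w3), (l2, w1), (l2, w3), (l3, w1), (l3, w2)}"

text \<open>Acyclicity outside \<open>W\<close> enters only through \<open>sparse\<close>, the edge
  bound for forests written as a sum of degrees. Together with irreflexivity,
  \<open>triangle\<close> and \<open>quad\<close> make the girth at least five.\<close>

locale feedback_girth5 =
  fixes A :: "'v \<Rightarrow> 'v \<Rightarrow> bool" and V W :: "'v set"
  assumes finV: "finite V" and finW: "finite W" and cardW: "card W \<le> 3"
    and sym: "A u v \<Longrightarrow> A v u" and irrefl: "\<not> A v v" and inV: "A u v \<Longrightarrow> u \<in> V"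
    and triangle: "A a b \<Longrightarrow> A b c \<Longrightarrow> \<not> A c a"
    and quad: "A a b \<Longrightarrow> A b c \<Longrightarrow> A c d \<Longrightarrow> A d a \<Longrightarrow> a = c \<or> b = d"
    and deg2: "v \<in> V \<Longrightarrow> 2 \<le> card {u. A v u}"
    and deg3: "v \<in> V - W \<Longrightarrow> 3 \<le> card {u. A v u}"
    and sparse: "F \<subseteq> V - W \<Longrightarrow> F \<noteq> {} \<Longrightarrow> (\<Sum>v\<in>F. card {u\<in>F. A v u}) + 2 \<le> 2 * card F"
begin

definition F where "F = V - W"
definition wn where "wn v = {w\<in>W. A v w}"
definition fn where "fn v = {u\<in>F. A v u}"
text \<open>The leaves of the forest, isolated vertices included; \<open>B\<close> consists of its
  branch vertices.\<close>

definition L where "L = {v\<in>F. card (fn v) \<le> 1}"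
definition B where "B = {v\<in>F. 3 \<le> card (fn v)}"

lemma fin [simp]: "finite F" "finite (wn v)" "finite (fn v)" "finite L" "finite B"
  using finV finW by (auto simp: F_def wn_def fn_def L_def B_def)

lemma deg_split: "v \<in> F \<Longrightarrow> 3 \<le> card (wn v) + card (fn v)"
proof -
  assume "v \<in> F"
  have "{u. A v u} = wn v \<union> fn v"
    using inV sym by (auto simp: wn_def fn_def F_def)
  moreover have "card (wn v \<union> fn v) = card (wn v) + card (fn v)"
    by (rule card_Un_disjoint) (auto simp: wn_def fn_def F_def finW finV)
  ultimately show ?thesis using deg3 [of v] \<open>v \<in> F\<close> by (simp add: F_def)
qed

text \<open>A union of components without leaves has all degrees at least two, hence too many edges
  for a forest.\<close>

lemma sparse_closed:
  assumes "U \<subseteq> F" "\<And>v. v \<in> U \<Longrightarrow> fn v \<subseteq> U" "U \<inter> L = {}"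
  shows "U = {}"
proof (rule ccontr)
  assume "U \<noteq> {}"
  then have "(\<Sum>v\<in>U. card {u\<in>U. A v u}) + 2 \<le> 2 * card U"
    using sparse assms(1) by (simp add: F_def)
  moreover have "(\<Sum>v\<in>U. card {u\<in>U. A v u}) \<ge> (\<Sum>v\<in>U. 2)"
  proof (rule sum_mono)
    fix v assume "v \<in> U"
    then have "{u\<in>U. A v u} = fn v" using assms(1,2) by (auto simp: fn_def)
    moreover have "card (fn v) \<ge> 2" using \<open>v \<in> U\<close> assms(1,3) by (auto simp: L_def)
    ultimately show "2 \<le> card {u\<in>U. A v u}" by simp
  qed
  ultimately show False by simp
qed

text \<open>By the forest bound, the sum of \<open>2 - deg\<close> over all vertices is at least 2.
  Vertices of degree two contribute nothing, leaves positively, branch vertices negatively.\<close>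

lemma leaves_branches:
  assumes "F \<noteq> {}"
  shows "2 + (\<Sum>v\<in>B. int (card (fn v)) - 2) \<le> (\<Sum>v\<in>L. 2 - int (card (fn v)))"
proof -
  have "(\<Sum>v\<in>F. card (fn v)) + 2 \<le> 2 * card F"
    using sparse [of F] assms by (simp add: F_def fn_def)
  then have "2 \<le> 2 * int (card F) - (\<Sum>v\<in>F. int (card (fn v)))"
    by (simp flip: of_nat_sum)
  also have "\<dots> = (\<Sum>v\<in>F. 2 - int (card (fn v)))" by (simp add: sum_subtractf)
  also have "\<dots> = (\<Sum>v\<in>L \<union> B. 2 - int (card (fn v)))"
    by (rule sum.mono_neutral_right) (auto simp: L_def B_def)
  also have "\<dots> = (\<Sum>v\<in>L. 2 - int (card (fn v))) + (\<Sum>v\<in>B. 2 - int (card (fn v)))"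
    by (rule sum.union_disjoint) (auto simp: L_def B_def)
  finally show ?thesis by (simp add: sum_subtractf)
qed

lemma wn_share: "u \<noteq> v \<Longrightarrow> a \<in> wn u \<Longrightarrow> b \<in> wn u \<Longrightarrow> a \<in> wn v \<Longrightarrow> b \<in> wn v \<Longrightarrow> a = b"
  using quad [of u a v b] sym by (auto simp: wn_def)

lemma wn_le: "card (wn v) \<le> card W"
  by (rule card_mono) (use finW in \<open>auto simp: wn_def\<close>)

lemma wn_leaf: "v \<in> L \<Longrightarrow> 2 \<le> card (wn v)"
  using deg_split [of v] by (simp add: L_def)

lemma wn_inj:
  assumes "u \<in> L" "v \<in> L" "wn u \<subseteq> wn v"
  shows "u = v"
proof (rule ccontr)
  assume "u \<noteq> v"
  obtain a b where "a \<in> wn u" "b \<in> wn u" "a \<noteq> b"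
    using wn_leaf [OF assms(1)] by (auto simp: numeral_2_eq_2 card_le_Suc_iff)
  then show False using wn_share [OF \<open>u \<noteq> v\<close>, of a b] assms(3) by auto
qed

text \<open>If all vertices are special, there are at most three of them, each with two neighbours;
  they would form a triangle.\<close>

lemma F_empty: "F = {} \<Longrightarrow> V = {}"
proof (rule ccontr)
  assume F: "F = {}" and "V \<noteq> {}"
  then have VW: "V \<subseteq> W" by (auto simp: F_def)
  have two: "\<exists>a b. A v a \<and> A v b \<and> a \<noteq> b" if "v \<in> V" for v
    using deg2 [OF that] by (auto simp: numeral_2_eq_2 card_le_Suc_iff)
  obtain v where "v \<in> V" using \<open>V \<noteq> {}\<close> by auto
  then obtain a b where ab: "A v a" "A v b" "a \<noteq> b" using two by blast
  obtain c where c: "A a c" "c \<noteq> v" using two [of a] inV [OF sym [OF ab(1)]] by blast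
  have "{v, a, b, c} \<subseteq> W" using VW ab c inV sym by blast
  then have "card {v, a, b, c} \<le> 3" using cardW card_mono [OF finW] by (metis le_trans)
  moreover have "v \<noteq> a" "v \<noteq> b" "a \<noteq> c" using ab c irrefl by auto
  ultimately have "c = b" using ab c by (auto simp: card_insert_if split: if_splits)
  then show False using triangle [of v a b] ab c sym by blast
qed

text \<open>Every leaf has two special neighbours. If \<open>l\<close> had all three, any other leaf
  would close a quadrilateral with \<open>l\<close>; so \<open>l\<close> would be the only possible
  leaf, and the count of leaves makes it isolated, hence all of \<open>F\<close>. A further
  neighbour of a special vertex is then special and closes a triangle with \<open>l\<close>.\<close>

lemma no_triple:
  assumes "l \<in> F"
  shows "card (wn l) \<le> 2"
proof (rule ccontr)
  assume "\<not> card (wn l) \<le> 2"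
  then have "card (wn l) = card W" and c3: "card W = 3" using wn_le [of l] cardW by auto
  then have wl: "wn l = W" by (intro card_subset_eq finW) (auto simp: wn_def)
  have L: "v = l" if vL: "v \<in> L" for v
  proof (rule ccontr)
    assume "v \<noteq> l"
    obtain a b where "a \<in> wn v" "b \<in> wn v" "a \<noteq> b"
      using wn_leaf [OF vL] by (auto simp: numeral_2_eq_2 card_le_Suc_iff)
    then show False using wn_share [OF \<open>v \<noteq> l\<close>, of a b] wl by (auto simp: wn_def)
  qed
  have "F \<noteq> {}" using assms by auto
  have "0 \<le> (\<Sum>v\<in>B. int (card (fn v)) - 2)" by (rule sum_nonneg) (auto simp: B_def)
  then have 2: "2 \<le> (\<Sum>v\<in>L. 2 - int (card (fn v)))"
    using leaves_branches [OF \<open>F \<noteq> {}\<close>] by linarith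
  moreover have "(\<Sum>v\<in>L. 2 - int (card (fn v))) \<le> (\<Sum>v\<in>{l}. 2 - int (card (fn v)))"
  proof (cases "L = {}")
    case False
    then have "L = {l}" using L by auto
    then show ?thesis by simp
  qed (use 2 in simp)
  ultimately have "2 \<le> (\<Sum>v\<in>{l}. 2 - int (card (fn v)))" by linarith
  then have "card (fn l) = 0" by simp
  then have fl: "fn l = {}" by simp
  have "F - {l} = {}"
  proof (rule sparse_closed)
    show "fn v \<subseteq> F - {l}" if "v \<in> F - {l}" for v
      using fl sym that by (auto simp: fn_def)
  qed (use L in auto)
  then have Fl: "F = {l}" using assms by auto
  obtain w where "w \<in> W" using c3 by fastforce
  then have lw: "A l w" using wl by (auto simp: wn_def)
  obtain a b where "A w a" "A w b" "a \<noteq> b"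
    using deg2 [OF inV [OF sym [OF lw]]] by (auto simp: numeral_2_eq_2 card_le_Suc_iff)
  then obtain c where c: "A w c" "c \<noteq> l" by metis
  then have "c \<in> W" using Fl inV [OF sym [OF c(1)]] by (auto simp: F_def)
  then have "A l c" using wl by (auto simp: wn_def)
  then show False using triangle [of l w c] lw c sym by blast
qed

lemma leaf_cards: "v \<in> L \<Longrightarrow> card (wn v) = 2 \<and> card (fn v) = 1"
  using no_triple [of v] deg_split [of v] wn_leaf [of v] by (auto simp: L_def)

lemma pairs_card: "card {P. P \<subseteq> W \<and> card P = 2} = card W choose 2"
  using n_subsets [OF finW, of 2] by simp

lemma wn_L: "inj_on wn L" "wn ` L \<subseteq> {P. P \<subseteq> W \<and> card P = 2}"
  using wn_inj leaf_cards by (auto simp: inj_on_def wn_def)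

text \<open>A leaf has exactly two special neighbours, and two leaves with the same pair would form
  a quadrilateral. With three special vertices this leaves room for three leaves.\<close>

lemma card_L_le: "card L \<le> card W choose 2"
proof -
  have "card L = card (wn ` L)" using wn_L(1) by (simp add: card_image)
  also have "\<dots> \<le> card {P. P \<subseteq> W \<and> card P = 2}"
    by (rule card_mono) (use wn_L(2) finW in auto)
  finally show ?thesis by (simp add: pairs_card)
qed

lemma count:
  assumes "F \<noteq> {}"
  shows "2 + (\<Sum>v\<in>B. int (card (fn v)) - 2) \<le> int (card L)"
  using leaves_branches [OF assms] leaf_cards by simp

text \<open>Fewer than three special vertices provide at most one pair, hence at most one leaf,
  while a nonempty forest needs two in \<open>count\<close>.\<close>

lemma cardW3:
  assumes "F \<noteq> {}"
  shows "card W = 3"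
proof (rule ccontr)
  assume "card W \<noteq> 3"
  then have "card W = 0 \<or> card W = 1 \<or> card W = 2" using cardW by linarith
  then have "card W choose 2 \<le> 1" by (auto simp: choose_two)
  then have "card L \<le> 1" using card_L_le by linarith
  moreover have "0 \<le> (\<Sum>v\<in>B. int (card (fn v)) - 2)" by (rule sum_nonneg) (auto simp: B_def)
  ultimately show False using count [OF assms] by linarith
qed

lemma card_L3: "F \<noteq> {} \<Longrightarrow> card L \<le> 3"
  using card_L_le cardW3 by (simp add: choose_two)

text \<open>Three leaves exceed the required two by only one, so the total excess degree of the
  branch vertices is at most one.\<close>

lemma B_bound:
  assumes "F \<noteq> {}" "u \<in> B"
  shows "B = {u}" "card (fn u) = 3" "card L = 3"
proof -
  have le: "(\<Sum>v\<in>B. int (card (fn v)) - 2) \<le> 1"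
    using count [OF assms(1)] card_L3 [OF assms(1)] by linarith
  have "(\<Sum>v\<in>B. 1) \<le> (\<Sum>v\<in>B. int (card (fn v)) - 2)"
    by (rule sum_mono) (auto simp: B_def)
  then have "card B \<le> 1" using le by simp
  then show B: "B = {u}" using assms(2) by (auto simp: card_le_Suc0_iff_eq)
  then show "card (fn u) = 3" using le assms(2) by (auto simp: B_def)
  then show "card L = 3"
    using count [OF assms(1)] card_L3 [OF assms(1)] unfolding B by simp
qed

text \<open>The neighbour \<open>y\<close> of the leaf avoids \<open>a\<close> and \<open>b\<close>
  because of triangles. If it avoided \<open>c\<close> too, it would be a branch vertex; of two
  further neighbours of \<open>y\<close> at most one sees \<open>c\<close>, so another would be a
  branch vertex as well, against uniqueness. Hence \<open>y\<close> sees \<open>c\<close>, and its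
  next neighbour sees no special vertex and must be the branch vertex.\<close>

lemma leg:
  assumes "l \<in> L" "W = {a, b, c}" "distinct [a, b, c]" "wn l = {a, b}"
  obtains y z where "fn l = {y}" "y \<in> F" "fn y = {l, z}" "wn y = {c}" "z \<in> B" "wn z = {}"
proof -
  have lF: "l \<in> F" and "F \<noteq> {}" using assms(1) by (auto simp: L_def)
  obtain y where fl: "fn l = {y}" using leaf_cards [OF assms(1)] by (auto simp: card_1_singleton_iff)
  then have y: "y \<in> F" "A l y" by (auto simp: fn_def)
  have la: "A l a" "A l b" using assms(4) by (auto simp: wn_def)
  have ya: "\<not> A y a" "\<not> A y b" using triangle [of l y] y la sym by blast+
  have wy: "wn y \<subseteq> {c}" using ya assms(2) unfolding wn_def by auto
  have abW: "a \<in> W" "b \<in> W" "c \<in> W" using assms(2) by auto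
  \<comment> \<open>Otherwise \<open>l\<close>, \<open>y\<close>, \<open>z\<close> and
    \<open>a\<close> or \<open>b\<close> form a quadrilateral.\<close>
  have far: "\<not> A z a" "\<not> A z b" if "z \<in> fn y" "z \<noteq> l" for z
  proof -
    have "A y z" using that by (simp add: fn_def)
    then show "\<not> A z a" "\<not> A z b"
      using quad [of l y z a] quad [of l y z b] y la that abW sym by (auto simp: F_def)
  qed
  have branch: "wn z = {}" "z \<in> B" if "z \<in> fn y" "z \<noteq> l" "\<not> A z c" for z
  proof -
    show "wn z = {}" using far [OF that(1,2)] that(3) assms(2) unfolding wn_def by auto
    then show "z \<in> B" using deg_split [of z] that by (auto simp: B_def fn_def)
  qed
  have ly: "l \<in> fn y" using lF y sym by (auto simp: fn_def)
  have yc: "A y c"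
  proof (rule ccontr)
    assume "\<not> A y c"
    then have "wn y = {}" using wy by (auto simp: wn_def)
    then have c3: "3 \<le> card (fn y)" using deg_split [OF y(1)] by simp
    then have "2 \<le> card (fn y - {l})" using ly by simp
    then obtain z z' where z: "z \<in> fn y - {l}" "z' \<in> fn y - {l}" "z \<noteq> z'"
      by (auto simp: numeral_2_eq_2 card_le_Suc_iff)
    have "\<not> A z c \<or> \<not> A z' c"
      using quad [of z c z' y] z y abW sym by (auto simp: fn_def F_def)
    then obtain z0 where "z0 \<in> fn y" "z0 \<noteq> l" "\<not> A z0 c" using z by blast
    then have "z0 \<in> B" by (rule branch)
    moreover have "y \<in> B" using c3 y by (simp add: B_def)
    moreover have "z0 \<noteq> y" using \<open>z0 \<in> fn y\<close> irrefl by (auto simp: fn_def)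
    ultimately show False using B_bound(1) [OF \<open>F \<noteq> {}\<close>] by blast
  qed
  then have wy': "wn y = {c}" using wy abW by (auto simp: wn_def)
  then have "2 \<le> card (fn y)" using deg_split [OF y(1)] by simp
  then have "1 \<le> card (fn y - {l})" using ly by simp
  then obtain z where z: "z \<in> fn y" "z \<noteq> l" by (auto simp: card_le_Suc_iff)
  have "\<not> A z c" using triangle [of y z c] z yc sym by (auto simp: fn_def)
  then have zB: "z \<in> B" "wn z = {}" using branch z by auto
  have "y \<noteq> z" using z irrefl by (auto simp: fn_def)
  then have "y \<notin> B" using B_bound(1) [OF \<open>F \<noteq> {}\<close> zB(1)] by auto
  then have "card (fn y) \<le> 2" using y by (auto simp: B_def)
  moreover have "card {l, z} = 2" using z by simp
  ultimately have "fn y = {l, z}" using z ly by (intro card_seteq [symmetric]) auto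
  then show ?thesis using that fl y(1) wy' zB by blast
qed

text \<open>The existence of a branch vertex forces three leaves, which realize all three pairs of
  special vertices. Their legs all end in the unique branch vertex, and this spider exhausts the
  forest.\<close>

lemma petersen_shape:
  assumes "V \<noteq> {}"
  obtains z y1 y2 y3 l1 l2 l3 w1 w2 w3
  where "distinct [z, y1, y2, y3, l1, l2, l3, w1, w2, w3]" "W = {w1, w2, w3}"
    "\<forall>u v. A u v \<longleftrightarrow> (u, v) \<in> petersen_arcs z y1 y2 y3 l1 l2 l3 w1 w2 w3 \<or>
      (v, u) \<in> petersen_arcs z y1 y2 y3 l1 l2 l3 w1 w2 w3"
proof -
  have F: "F \<noteq> {}" using assms F_empty by blast
  obtain w1 w2 w3 where W: "W = {w1, w2, w3}" and w: "w1 \<noteq> w2" "w2 \<noteq> w3" "w1 \<noteq> w3"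
    using iffD1 [OF card_3_iff cardW3 [OF F]] by (elim exE conjE)
  have dw: "distinct [w1, w2, w3]" using w by simp
  have "L \<noteq> {}"
  proof
    assume "L = {}"
    have "F = {}"
      by (rule sparse_closed) (use \<open>L = {}\<close> in \<open>auto simp: fn_def\<close>)
    then show False using F by simp
  qed
  then obtain l0 where l0: "l0 \<in> L" by auto
  obtain z where z: "z \<in> B"
  proof -
    have "wn l0 \<subseteq> W" "card (wn l0) = 2" using leaf_cards [OF l0] by (auto simp: wn_def)
    then consider "wn l0 = {w1, w2}" | "wn l0 = {w1, w3}" | "wn l0 = {w2, w3}"
      using pair_in_triple [of "wn l0" w1 w2 w3] W by blast
    then show thesis
    proof cases
      case 1
      show thesis by (rule leg [OF l0 W dw 1]) (rule that)
    next
      case 2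
      have "W = {w1, w3, w2}" using W by blast
      moreover have "distinct [w1, w3, w2]" using dw by auto
      ultimately show thesis by (rule leg [OF l0 _ _ 2]) (rule that)
    next
      case 3
      have "W = {w2, w3, w1}" using W by blast
      moreover have "distinct [w2, w3, w1]" using dw by auto
      ultimately show thesis by (rule leg [OF l0 _ _ 3]) (rule that)
    qed
  qed
  have Bz: "B = {z}" and fz: "card (fn z) = 3" and cL: "card L = 3"
    using B_bound [OF F z] by auto
  have "wn ` L = {P. P \<subseteq> W \<and> card P = 2}"
  proof (rule card_subset_eq)
    show "finite {P. P \<subseteq> W \<and> card P = 2}" using finW by auto
    show "wn ` L \<subseteq> {P. P \<subseteq> W \<and> card P = 2}" by (rule wn_L)
    show "card (wn ` L) = card {P. P \<subseteq> W \<and> card P = 2}"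
      using wn_L(1) cL cardW3 [OF F] by (simp add: card_image pairs_card choose_two)
  qed
  then have img: "P \<in> wn ` L" if "P \<subseteq> W" "card P = 2" for P using that by blast
  have "{w2, w3} \<in> wn ` L" by (rule img) (use W dw in simp_all)
  then obtain l1 where l1: "{w2, w3} = wn l1" "l1 \<in> L" by (rule imageE)
  have "{w1, w3} \<in> wn ` L" by (rule img) (use W dw in simp_all)
  then obtain l2 where l2: "{w1, w3} = wn l2" "l2 \<in> L" by (rule imageE)
  have "{w1, w2} \<in> wn ` L" by (rule img) (use W dw in simp_all)
  then obtain l3 where l3: "{w1, w2} = wn l3" "l3 \<in> L" by (rule imageE)
  note l = l1(2) l2(2) l3(2) and wl = l1(1) [symmetric] l2(1) [symmetric] l3(1) [symmetric]
  have leg': "\<exists>y. fn l = {y} \<and> y \<in> F \<and> fn y = {l, z} \<and> wn y = {c} \<and> wn z = {}"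
    if h: "l \<in> L" "W = {a, b, c}" "distinct [a, b, c]" "wn l = {a, b}" for l a b c
  proof -
    obtain y z' where y: "fn l = {y}" "y \<in> F" "fn y = {l, z'}" "wn y = {c}" "z' \<in> B" "wn z' = {}"
      by (rule leg [OF h])
    have "z' = z" using y(5) Bz by simp
    with y show ?thesis by (intro exI [of _ y] conjI) (simp_all only:)
  qed
  have W': "W = {w2, w3, w1}" "W = {w1, w3, w2}" using W by (simp_all add: insert_commute)
  have dw': "distinct [w2, w3, w1]" "distinct [w1, w3, w2]" using dw by auto
  obtain y1 where y1: "fn l1 = {y1}" "y1 \<in> F" "fn y1 = {l1, z}" "wn y1 = {w1}" "wn z = {}"
    using leg' [OF l(1) W'(1) dw'(1) wl(1)] by blast
  obtain y2 where y2: "fn l2 = {y2}" "y2 \<in> F" "fn y2 = {l2, z}" "wn y2 = {w2}"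
    using leg' [OF l(2) W'(2) dw'(2) wl(2)] by blast
  obtain y3 where y3: "fn l3 = {y3}" "y3 \<in> F" "fn y3 = {l3, z}" "wn y3 = {w3}"
    using leg' [OF l(3) W dw wl(3)] by blast
  have zF: "z \<in> F" using z by (simp add: B_def)
  have lF: "l1 \<in> F" "l2 \<in> F" "l3 \<in> F" using l by (auto simp: L_def)
  \<comment> \<open>The seven vertices are told apart by their sets of special neighbours: the empty
    set, the singletons and the pairs.\<close>
  have "distinct (map wn [z, y1, y2, y3, l1, l2, l3])"
    using dw by (auto simp: y1 y2 y3 wl doubleton_eq_iff)
  then have "distinct [z, y1, y2, y3, l1, l2, l3]" unfolding distinct_map by blast
  moreover have "v \<noteq> w1 \<and> v \<noteq> w2 \<and> v \<noteq> w3" if "v \<in> F" for v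
  proof -
    have "w1 \<in> W" "w2 \<in> W" "w3 \<in> W" using W by simp_all
    then show ?thesis using that unfolding F_def by blast
  qed
  ultimately have dist: "distinct [z, y1, y2, y3, l1, l2, l3, w1, w2, w3]"
    using dw zF lF y1(2) y2(2) y3(2) by simp
  have "z \<in> fn y1" "z \<in> fn y2" "z \<in> fn y3" using y1(3) y2(3) y3(3) by simp_all
  then have "A z y1" "A z y2" "A z y3" using sym unfolding fn_def by blast+
  then have "{y1, y2, y3} \<subseteq> fn z" using y1(2) y2(2) y3(2) by (auto simp: fn_def)
  moreover have "card {y1, y2, y3} = 3" using dist by simp
  ultimately have fz': "fn z = {y1, y2, y3}" using fz by (intro card_seteq [symmetric]) auto
  let ?K = "{z, y1, y2, y3, l1, l2, l3}"
  have closed: "fn v \<subseteq> ?K" if "v \<in> ?K" for v using that fz' y1 y2 y3 by auto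
  have "card {l1, l2, l3} = 3" using dist by simp
  then have L: "L = {l1, l2, l3}" using l cL by (intro card_seteq [symmetric]) auto
  \<comment> \<open>The rest is closed under forest neighbours and contains no leaf, since all three
    leaves lie in the spider.\<close>
  have "F - ?K = {}"
  proof (rule sparse_closed)
    show "fn v \<subseteq> F - ?K" if "v \<in> F - ?K" for v
    proof
      fix u assume u: "u \<in> fn v"
      then have "v \<in> fn u" using that sym by (auto simp: fn_def)
      then have "u \<notin> ?K" using closed [of u] that by auto
      then show "u \<in> F - ?K" using u by (auto simp: fn_def)
    qed
  qed (use L in auto)
  then have FK: "F = ?K" using zF lF y1(2) y2(2) y3(2) by auto
  have AF: "A u v \<longleftrightarrow> v \<in> fn u \<union> wn u" if "u \<in> F" for u v
    using inV sym by (auto simp: fn_def wn_def F_def)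
  \<comment> \<open>Any two special vertices have a common leaf, so an edge between them would close
    a triangle.\<close>
  have AW: "\<not> A u v" if "u \<in> W" "v \<in> W" for u v
  proof
    assume "A u v"
    then have "u \<noteq> v" using irrefl by auto
    then have "{u, v} = wn l1 \<or> {u, v} = wn l2 \<or> {u, v} = wn l3"
      using that W wl by auto
    then obtain k where "A k u" "A k v" by (auto simp: wn_def)
    then show False using triangle [of k u v] \<open>A u v\<close> sym by blast
  qed
  have "A u v \<longleftrightarrow> (u, v) \<in> petersen_arcs z y1 y2 y3 l1 l2 l3 w1 w2 w3 \<or>
      (v, u) \<in> petersen_arcs z y1 y2 y3 l1 l2 l3 w1 w2 w3"
    (is "_ \<longleftrightarrow> ?R u v") for u v
  proof -
    have F': "A u v \<longleftrightarrow> ?R u v" if "u \<in> F" for u v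
    proof -
      have "u = z \<or> u = y1 \<or> u = y2 \<or> u = y3 \<or> u = l1 \<or> u = l2 \<or> u = l3"
        using that FK by auto
      then show ?thesis
        using dist unfolding AF [OF that] petersen_arcs_def
        by (elim disjE) (auto simp: fz' y1 y2 y3 wl)
    qed
    show ?thesis
    proof (cases "u \<in> F")
      case False
      show ?thesis
      proof (cases "v \<in> F")
        case True
        have "A u v \<longleftrightarrow> A v u" using sym by blast
        also have "\<dots> \<longleftrightarrow> ?R v u" by (rule F' [OF True])
        also have "\<dots> \<longleftrightarrow> ?R u v" by (rule disj_commute)
        finally show ?thesis .
      next
        case vF: False
        have "\<not> A u v"
        proof
          assume "A u v"
          then have "u \<in> V" "v \<in> V" using inV sym by blast+
          then show False using AW [of u v] \<open>A u v\<close> False vF unfolding F_def by blast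
        qed
        moreover have "\<not> ?R u v" using False vF FK unfolding petersen_arcs_def by auto
        ultimately show ?thesis by (simp only:)
      qed
    qed (rule F')
  qed
  then show thesis by (intro that [OF dist W] allI)
qed

end

text \<open>Vertex \<open>0\<close> is the centre \<open>z\<close> of the spider; \<open>1, 2, 3\<close> are its neighbours, \<open>4, 5, 6\<close> the leaves
  and \<open>7, 8, 9\<close> the special vertices.\<close>

definition petersen_edges :: "(nat \<times> nat) set" where
  "petersen_edges = {(0, 1), (0, 2), (0, 3), (1, 4), (2, 5), (3, 6), (1, 7), (2, 8), (3, 9),
    (4, 8), (4, 9), (5, 7), (5, 9), (6, 7), (6, 8)}"

definition is_petersen :: "'e set \<Rightarrow> ('e \<Rightarrow> 'v) \<Rightarrow> ('e \<Rightarrow> 'v) \<Rightarrow> bool" where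
  "is_petersen E s t \<longleftrightarrow> (\<exists>(g::nat \<Rightarrow> 'v) h. inj_on g {..<10} \<and> bij_betw h petersen_edges E \<and>
     (\<forall>(i, j)\<in>petersen_edges. link s t (h (i, j)) (g i) (g j)))"

text \<open>\<open>E'\<close> are the surviving edges, and the fibres of \<open>f\<close> are
  exactly what the other edges connect. Requiring three images of \<open>W\<close> records that up
  to three special vertices end up in different preimages, on which the local covers depend.\<close>

definition petersen_contraction :: "'e set \<Rightarrow> ('e \<Rightarrow> 'v) \<Rightarrow> ('e \<Rightarrow> 'v) \<Rightarrow> 'v set \<Rightarrow> bool" where
  "petersen_contraction E s t W \<longleftrightarrow> (\<exists>(f::'v \<Rightarrow> 'v) E'. E' \<subseteq> E \<and> (\<forall>e\<in>E - E'. f (s e) = f (t e)) \<and>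
     (\<forall>a b. f a = f b \<longrightarrow> (a, b) \<in> conn (E - E') s t) \<and> card (f ` W) = 3 \<and>
     is_petersen E' (f \<circ> s) (f \<circ> t))"

section \<open>From edges with ends to an adjacency relation\<close>

definition simple :: "'e set \<Rightarrow> ('e \<Rightarrow> 'v) \<Rightarrow> ('e \<Rightarrow> 'v) \<Rightarrow> bool" where
  "simple E s t \<longleftrightarrow> (\<forall>e\<in>E. s e \<noteq> t e) \<and>
     (\<forall>e\<in>E. \<forall>e'\<in>E. {s e, t e} = {s e', t e'} \<longrightarrow> e = e')"

lemma card_neighbours:
  assumes "simple E s t"
  shows "card {u. \<exists>e\<in>E. link s t e v u} = card {e\<in>E. s e = v \<or> t e = v}"
proof (rule sym, rule bij_betw_same_card)
  let ?o = "\<lambda>e. if s e = v then t e else s e"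
  show "bij_betw ?o {e\<in>E. s e = v \<or> t e = v} {u. \<exists>e\<in>E. link s t e v u}"
    unfolding bij_betw_def
  proof
    show "inj_on ?o {e\<in>E. s e = v \<or> t e = v}"
    proof (rule inj_onI)
      fix e e' assume e: "e \<in> {e\<in>E. s e = v \<or> t e = v}" "e' \<in> {e\<in>E. s e = v \<or> t e = v}" "?o e = ?o e'"
      then have "{s e, t e} = {s e', t e'}" by (auto split: if_splits)
      then show "e = e'" using assms e by (auto simp: simple_def)
    qed
    show "?o ` {e\<in>E. s e = v \<or> t e = v} = {u. \<exists>e\<in>E. link s t e v u}"
      by (force simp: link_iff)
  qed
qed

text \<open>With at least \<open>card F\<close> edges inside \<open>F\<close> there are more edge
  sets than possible boundaries on \<open>F - {v0}\<close>. Two edge sets then have the same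
  boundary there, and their sum is a nonzero even set that avoids \<open>W\<close>.\<close>

lemma forest_edges:
  assumes fin: "finite E" "finite F" and forest: "forest E s t W" and "F \<inter> W = {}" "F \<noteq> {}"
  shows "card {e\<in>E. s e \<in> F \<and> t e \<in> F} + 1 \<le> card F"
proof (rule ccontr)
  let ?EF = "{e\<in>E. s e \<in> F \<and> t e \<in> F}"
  assume less: "\<not> card ?EF + 1 \<le> card F"
  obtain v0 where v0: "v0 \<in> F" using \<open>F \<noteq> {}\<close> by auto
  let ?ind = "\<lambda>D e. of_bool (e \<in> D) :: bit"
  let ?m = "\<lambda>D. {v\<in>F - {v0}. bd E s t (?ind D) v = 1}"
  have "\<not> inj_on ?m (Pow ?EF)"
  proof (rule pigeonhole)
    have "card (?m ` Pow ?EF) \<le> card (Pow (F - {v0}))"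
      by (rule card_mono) (use fin in auto)
    also have "\<dots> = 2 ^ (card F - 1)" using fin v0 by (simp add: card_Pow)
    also have "\<dots> < 2 ^ card ?EF"
    proof -
      have "card F > 0" using fin v0 by (auto simp: card_gt_0_iff)
      then show ?thesis using less by (intro power_strict_increasing) auto
    qed
    finally show "card (?m ` Pow ?EF) < card (Pow ?EF)" using fin by (simp add: card_Pow)
  qed
  then obtain D1 D2 where D: "D1 \<subseteq> ?EF" "D2 \<subseteq> ?EF" "D1 \<noteq> D2" "?m D1 = ?m D2"
    unfolding inj_on_def by blast
  let ?x = "\<lambda>e. ?ind D1 e + ?ind D2 e"
  have supp: "e \<in> ?EF" if "?x e \<noteq> 0" for e using that D(1,2) by (cases "e \<in> D1"; cases "e \<in> D2") auto
  have in_F: "bd E s t ?x v = 0" if "v \<in> F - {v0}" for v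
  proof -
    have "bd E s t (?ind D1) v = 1 \<longleftrightarrow> bd E s t (?ind D2) v = 1" using D(4) that by blast
    then have "bd E s t (?ind D1) v = bd E s t (?ind D2) v"
      by (cases "bd E s t (?ind D1) v"; cases "bd E s t (?ind D2) v") simp_all
    then show ?thesis unfolding bd_add by simp
  qed
  have out_F: "bd E s t ?x v = 0" if "v \<notin> F" for v
    unfolding bd_def
  proof (rule sum.neutral, rule ballI)
    fix e assume "e \<in> E"
    have "?x e = 0" if "s e = v \<or> t e = v" using supp [of e] that \<open>v \<notin> F\<close> by blast
    then show "(if s e = v then ?x e else 0) + (if t e = v then ?x e else 0) = 0" by simp
  qed
  \<comment> \<open>Evenness at the omitted vertex \<open>v0\<close> comes for free: the boundaries
    over \<open>F\<close> add up to the cut of \<open>F\<close>, on which \<open>?x\<close>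
    vanishes.\<close>
  have "bd E s t ?x v0 = (\<Sum>v\<in>F. bd E s t ?x v)"
  proof (rule sym)
    have "(\<Sum>v\<in>F. bd E s t ?x v) = (\<Sum>v\<in>{v0}. bd E s t ?x v)"
      by (rule sum.mono_neutral_right) (use fin v0 in_F in auto)
    then show "(\<Sum>v\<in>F. bd E s t ?x v) = bd E s t ?x v0" by simp
  qed
  also have "\<dots> = (\<Sum>e\<in>{e\<in>E. (s e \<in> F) \<noteq> (t e \<in> F)}. ?x e)" by (rule sum_bd_cut [OF fin(2,1)])
  also have "\<dots> = 0"
  proof (rule sum.neutral, rule ballI)
    fix e assume "e \<in> {e\<in>E. (s e \<in> F) \<noteq> (t e \<in> F)}"
    then show "?x e = 0" using supp [of e] by blast
  qed
  finally have bd0: "bd E s t ?x v = 0" for v using in_F [of v] out_F [of v] by blast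
  have supp': "s e \<notin> W \<and> t e \<notin> W" if "?x e \<noteq> 0" for e
    using supp [OF that] \<open>F \<inter> W = {}\<close> by blast
  have z: "?x e = 0" if "e \<in> E" for e
    by (rule forestD [OF forest, of ?x]) (use supp' bd0 that in blast)+
  have "e \<in> D1 \<longleftrightarrow> e \<in> D2" for e
    using z [of e] D(1,2) by (cases "e \<in> D1"; cases "e \<in> D2") auto
  then show False using D(3) by blast
qed

lemma forest_sparse:
  assumes fin: "finite E" "finite F" and forest: "forest E s t W" and F: "F \<inter> W = {}" "F \<noteq> {}"
    and simple: "simple E s t"
  shows "(\<Sum>v\<in>F. card {u\<in>F. \<exists>e\<in>E. link s t e v u}) + 2 \<le> 2 * card F"
proof -
  let ?EF = "{e\<in>E. s e \<in> F \<and> t e \<in> F}"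
  have "(\<Sum>v\<in>F. card {u\<in>F. \<exists>e\<in>E. link s t e v u}) = (\<Sum>v\<in>F. card {e\<in>?EF. s e = v \<or> t e = v})"
  proof (rule sum.cong)
    fix v assume "v \<in> F"
    then have "{u\<in>F. \<exists>e\<in>E. link s t e v u} = {u. \<exists>e\<in>?EF. link s t e v u}"
      by (auto simp: link_iff)
    moreover have "simple ?EF s t" using simple by (auto simp: simple_def)
    ultimately show "card {u\<in>F. \<exists>e\<in>E. link s t e v u} = card {e\<in>?EF. s e = v \<or> t e = v}"
      by (simp only: card_neighbours)
  qed simp
  also have "\<dots> = (\<Sum>v\<in>F. \<Sum>e\<in>?EF. if s e = v \<or> t e = v then 1 else 0)"
  proof (rule sum.cong)
    fix v
    have "finite ?EF" using fin by simp
    then show "card {e\<in>?EF. s e = v \<or> t e = v} = (\<Sum>e\<in>?EF. if s e = v \<or> t e = v then 1 else 0)"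
      unfolding card_eq_sum by (rule sum.inter_filter)
  qed simp
  also have "\<dots> = (\<Sum>e\<in>?EF. \<Sum>v\<in>F. if s e = v \<or> t e = v then 1 else 0)" by (rule sum.swap)
  also have "\<dots> = (\<Sum>e\<in>?EF. 2)"
  proof (rule sum.cong)
    fix e assume e: "e \<in> ?EF"
    have "(\<Sum>v\<in>F. if s e = v \<or> t e = v then 1 else 0 :: nat) = card {v\<in>F. s e = v \<or> t e = v}"
      unfolding card_eq_sum by (rule sum.inter_filter [OF fin(2), symmetric])
    also have "{v\<in>F. s e = v \<or> t e = v} = {s e, t e}" using e by auto
    also have "card {s e, t e} = 2" using e simple by (auto simp: simple_def)
    finally show "(\<Sum>v\<in>F. if s e = v \<or> t e = v then 1 else 0 :: nat) = 2" .
  qed simp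
  finally show ?thesis using forest_edges [OF fin forest F] by simp
qed

text \<open>An even set containing the only edge at \<open>v\<close> would have odd degree
  there.\<close>

lemma bridgeless_degree:
  assumes "finite E" "bridgeless E s t" "e \<in> E" "s e \<noteq> t e" "s e = v \<or> t e = v"
  shows "2 \<le> card {e\<in>E. s e = v \<or> t e = v}"
proof (rule ccontr)
  let ?D = "{e\<in>E. s e = v \<or> t e = v}"
  assume "\<not> 2 \<le> card ?D"
  then have "card ?D \<le> 1" by simp
  moreover have "e \<in> ?D" using assms by auto
  ultimately have D: "?D = {e}" using assms(1) by (auto simp: card_le_Suc0_iff_eq)
  obtain x :: "'a \<Rightarrow> bit" where x: "x e = 1" "bd E s t x v = 0"
    using assms(2,3) unfolding bridgeless_def by blast
  have "bd E s t x v = (\<Sum>e\<in>?D. (if s e = v then x e else 0) + (if t e = v then x e else 0))"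
    unfolding bd_def by (rule sum.mono_neutral_right) (use assms(1) in auto)
  also have "\<dots> = 1" unfolding D using assms(4,5) x(1) by auto
  finally show False using x(2) by simp
qed

text \<open>In a simple graph the edges can be traded for an adjacency relation without loss, so the
  classification above applies. Its vertex set consists of the ends of edges only, which discards
  isolated vertices.\<close>

lemma petersen_if_girth5:
  assumes fin: "finite E" and finW: "finite W" "card W \<le> 3" and forest: "forest E s t W"
    and bridgeless: "bridgeless E s t" and simple: "simple E s t"
    and no_tri: "\<And>e1 e2 e3 a b c. e1 \<in> E \<Longrightarrow> e2 \<in> E \<Longrightarrow> e3 \<in> E \<Longrightarrow> distinct [a, b, c] \<Longrightarrow>
      link s t e1 a b \<Longrightarrow> link s t e2 b c \<Longrightarrow> link s t e3 c a \<Longrightarrow> False"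
    and no_quad: "\<And>e1 e2 e3 e4 a b c d. e1 \<in> E \<Longrightarrow> e2 \<in> E \<Longrightarrow> e3 \<in> E \<Longrightarrow> e4 \<in> E \<Longrightarrow>
      distinct [a, b, c, d] \<Longrightarrow> link s t e1 a b \<Longrightarrow> link s t e2 b c \<Longrightarrow> link s t e3 c d \<Longrightarrow>
      link s t e4 d a \<Longrightarrow> False"
    and no_deg2: "\<And>v. v \<notin> W \<Longrightarrow> card {e\<in>E. s e = v \<or> t e = v} \<noteq> 2"
  shows "E = {} \<or> card W = 3 \<and> is_petersen E s t"
proof (cases "E = {}")
  case False
  define A where "A u v \<longleftrightarrow> (\<exists>e\<in>E. link s t e u v)" for u v
  define V where "V = s ` E \<union> t ` E"
  have sym: "A v u" if "A u v" for u v using that link_sym unfolding A_def by metis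
  have irr: "\<not> A v v" for v using simple by (auto simp: A_def link_iff simple_def)
  have card_A: "card {u. A v u} = card {e\<in>E. s e = v \<or> t e = v}" for v
    unfolding A_def by (rule card_neighbours [OF simple])
  have deg2: "2 \<le> card {u. A v u}" if v: "v \<in> V" for v
  proof -
    obtain e where "e \<in> E" "s e = v \<or> t e = v" using v unfolding V_def by blast
    then show ?thesis
      unfolding card_A using bridgeless_degree [OF fin bridgeless] simple by (auto simp: simple_def)
  qed
  interpret feedback_girth5 A V W
  proof
    show "finite V" using fin by (simp add: V_def)
    show "\<not> A c a" if "A a b" "A b c" for a b c
    proof
      assume "A c a"
      then have "distinct [a, b, c]" using that irr by auto
      then show False using no_tri that \<open>A c a\<close> unfolding A_def by blast
    qed
    show "a = c \<or> b = d" if "A a b" "A b c" "A c d" "A d a" for a b c d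
    proof (rule ccontr)
      assume "\<not> (a = c \<or> b = d)"
      then have "distinct [a, b, c, d]" using that irr by auto
      then show False using no_quad that unfolding A_def by blast
    qed
    show "3 \<le> card {u. A v u}" if "v \<in> V - W" for v
      using deg2 [of v] no_deg2 [of v] that unfolding card_A by auto
    show "(\<Sum>v\<in>F. card {u\<in>F. A v u}) + 2 \<le> 2 * card F" if "F \<subseteq> V - W" "F \<noteq> {}" for F
    proof -
      have "finite F" using that(1) fin finite_subset unfolding V_def by fastforce
      then show ?thesis
        using forest_sparse [OF fin _ forest _ _ simple] that unfolding A_def by blast
    qed
  qed (use finW sym irr deg2 in \<open>auto simp: A_def V_def link_iff\<close>)
  have "V \<noteq> {}" using False by (simp add: V_def)
  then obtain z y1 y2 y3 l1 l2 l3 w1 w2 w3 where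
    dist: "distinct [z, y1, y2, y3, l1, l2, l3, w1, w2, w3]" and W: "W = {w1, w2, w3}" and
    A: "\<forall>u v. A u v \<longleftrightarrow> (u, v) \<in> petersen_arcs z y1 y2 y3 l1 l2 l3 w1 w2 w3 \<or>
      (v, u) \<in> petersen_arcs z y1 y2 y3 l1 l2 l3 w1 w2 w3"
    by (rule petersen_shape)
  define g where "g i = [z, y1, y2, y3, l1, l2, l3, w1, w2, w3] ! i" for i
  have inj: "inj_on g {..<10}"
    using dist unfolding g_def by (intro inj_on_nth) auto
  have lt: "i < 10 \<and> j < 10 \<and> i < j" if "(i, j) \<in> petersen_edges" for i j
    using that by (auto simp: petersen_edges_def)
  have gs: "g 0 = z" "g 1 = y1" "g (Suc 0) = y1" "g 2 = y2" "g 3 = y3" "g 4 = l1" "g 5 = l2" "g 6 = l3"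
    "g 7 = w1" "g 8 = w2" "g 9 = w3" by (simp_all add: g_def)
  have A': "A u v \<longleftrightarrow> (\<exists>(i, j)\<in>petersen_edges. u = g i \<and> v = g j) \<or> (\<exists>(i, j)\<in>petersen_edges. v = g i \<and> u = g j)" for u v
    unfolding A [rule_format] petersen_edges_def petersen_arcs_def by (simp add: gs)
  define h where "h p = (SOME e. e \<in> E \<and> link s t e (g (fst p)) (g (snd p)))" for p
  have h: "h (i, j) \<in> E \<and> link s t (h (i, j)) (g i) (g j)" if "(i, j) \<in> petersen_edges" for i j
  proof -
    have "A (g i) (g j)" unfolding A' using that by blast
    then have ex: "\<exists>e. e \<in> E \<and> link s t e (g i) (g j)" unfolding A_def by blast
    show ?thesis unfolding h_def fst_conv snd_conv by (rule someI_ex [OF ex])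
  qed
  have "inj_on h petersen_edges"
  proof (rule inj_onI, clarify)
    fix i j i' j' assume p: "(i, j) \<in> petersen_edges" "(i', j') \<in> petersen_edges" "h (i, j) = h (i', j')"
    then have "{g i, g j} = {g i', g j'}" using h [OF p(1)] h [OF p(2)] by (auto simp: link_def)
    then have "g ` {i, j} = g ` {i', j'}" by simp
    then have "{i, j} = {i', j'}"
      using inj_on_image_eq_iff [OF inj, of "{i, j}" "{i', j'}"] lt [OF p(1)] lt [OF p(2)] by simp
    then show "i = i' \<and> j = j'" using lt [OF p(1)] lt [OF p(2)] by (auto simp: doubleton_eq_iff)
  qed
  moreover have "h ` petersen_edges = E"
  proof
    show "h ` petersen_edges \<subseteq> E" using h by auto
    show "E \<subseteq> h ` petersen_edges"
    proof
      fix e assume e: "e \<in> E"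
      then have "A (s e) (t e)" by (auto simp: A_def link_def)
      then obtain i j where ij: "(i, j) \<in> petersen_edges" "link s t e (g i) (g j)"
        unfolding A' link_iff by blast
      then have "e = h (i, j)"
        using h [OF ij(1)] simple e by (auto simp: simple_def link_def)
      then show "e \<in> h ` petersen_edges" using ij(1) by blast
    qed
  qed
  ultimately have "is_petersen E s t"
    unfolding is_petersen_def bij_betw_def using inj h by (intro exI [of _ g] exI [of _ h]) blast
  then show ?thesis using W dist by auto
qed simp

section \<open>Reduction to girth five\<close>

text \<open>Whenever the walk in the quotient passes through a fibre, a walk in \<open>Z\<close>
  joins the two lifted ends.\<close>

lemma conn_lift:
  assumes "(f a, f b) \<in> conn Y (f \<circ> s) (f \<circ> t)" "\<And>a b. f a = f b \<Longrightarrow> (a, b) \<in> conn Z s t"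
  shows "(a, b) \<in> conn (Y \<union> Z) s t"
proof -
  have Z: "(a, b) \<in> conn (Y \<union> Z) s t" if "f a = f b" for a b
    using assms(2) [OF that] conn_mono [of Z "Y \<union> Z" s t] by blast
  have "\<forall>b. f b = q \<longrightarrow> (a, b) \<in> conn (Y \<union> Z) s t" if "(f a, q) \<in> conn Y (f \<circ> s) (f \<circ> t)" for q
    using that
  proof (induction rule: conn_induct)
    case refl
    show ?case using Z by simp
  next
    case (step e u v)
    have e: "(s e, t e) \<in> conn (Y \<union> Z) s t" "(t e, s e) \<in> conn (Y \<union> Z) s t"
      using conn_edge(1) [of e "Y \<union> Z" s t] conn_sym [of "s e" "t e"] step.hyps(1) by auto
    have "u = f (s e) \<and> v = f (t e) \<or> u = f (t e) \<and> v = f (s e)"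
      using step.hyps(2) by (simp add: doubleton_eq_iff)
    then show ?case
    proof
      assume uv: "u = f (s e) \<and> v = f (t e)"
      then have "(a, s e) \<in> conn (Y \<union> Z) s t" using step.IH by blast
      then have te: "(a, t e) \<in> conn (Y \<union> Z) s t" by (rule conn_trans [OF _ e(1)])
      show ?thesis
      proof (intro allI impI)
        fix b assume "f b = v"
        then have "f (t e) = f b" using uv by simp
        then show "(a, b) \<in> conn (Y \<union> Z) s t" by (rule conn_trans [OF te Z])
      qed
    next
      assume uv: "u = f (t e) \<and> v = f (s e)"
      then have "(a, t e) \<in> conn (Y \<union> Z) s t" using step.IH by blast
      then have se: "(a, s e) \<in> conn (Y \<union> Z) s t" by (rule conn_trans [OF _ e(2)])
      show ?thesis
      proof (intro allI impI)
        fix b assume "f b = v"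
        then have "f (s e) = f b" using uv by simp
        then show "(a, b) \<in> conn (Y \<union> Z) s t" by (rule conn_trans [OF se Z])
      qed
    qed
  qed
  then show ?thesis using assms(1) by blast
qed

lemma petersen_contraction_lift:
  fixes f :: "'v \<Rightarrow> 'v"
  assumes pet: "petersen_contraction (E - Z) (f \<circ> s) (f \<circ> t) (f ` W)" and "Z \<subseteq> E"
    and loops: "\<And>e. e \<in> Z \<Longrightarrow> f (s e) = f (t e)"
    and conn: "\<And>a b. f a = f b \<Longrightarrow> (a, b) \<in> conn Z s t"
  shows "petersen_contraction E s t W"
proof -
  obtain f' :: "'v \<Rightarrow> 'v" and E' where f': "E' \<subseteq> E - Z" "\<forall>e\<in>E - Z - E'. f' ((f \<circ> s) e) = f' ((f \<circ> t) e)"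
    "\<forall>a b. f' a = f' b \<longrightarrow> (a, b) \<in> conn (E - Z - E') (f \<circ> s) (f \<circ> t)"
    "card (f' ` f ` W) = 3" "is_petersen E' (f' \<circ> (f \<circ> s)) (f' \<circ> (f \<circ> t))"
    using pet unfolding petersen_contraction_def by blast
  have c: "(a, b) \<in> conn (E - E') s t" if "(f' \<circ> f) a = (f' \<circ> f) b" for a b
  proof -
    have "(f a, f b) \<in> conn (E - Z - E') (f \<circ> s) (f \<circ> t)" using f'(3) that by simp
    then have "(a, b) \<in> conn ((E - Z - E') \<union> Z) s t" by (rule conn_lift) (rule conn)
    moreover have "(E - Z - E') \<union> Z = E - E'" using \<open>Z \<subseteq> E\<close> f'(1) by blast
    ultimately show ?thesis by simp
  qed
  have l: "(f' \<circ> f) (s e) = (f' \<circ> f) (t e)" if "e \<in> E - E'" for e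
    using f'(2) loops that by (cases "e \<in> Z") auto
  have sub: "E' \<subseteq> E" using f'(1) by blast
  show ?thesis
    unfolding petersen_contraction_def
  proof (rule exI [of _ "f' \<circ> f"], rule exI [of _ E'], intro conjI ballI allI impI)
    show "card ((f' \<circ> f) ` W) = 3" using f'(4) by (simp only: image_comp)
    show "is_petersen E' (f' \<circ> f \<circ> s) (f' \<circ> f \<circ> t)" using f'(5) by (simp only: comp_assoc)
  qed (fact sub c l)+
qed

text \<open>The indicator of \<open>Z\<close> is a nonzero even vector, which a forest outside
  \<open>W\<close> does not allow. In a contraction this guarantees that the new vertex is special
  already.\<close>

lemma circuit_meets:
  assumes "finite E" "forest E s t W" "Z \<subseteq> E" "Z \<noteq> {}" "\<And>v. bd Z s t (\<lambda>_. 1::bit) v = 0"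
  shows "\<exists>e\<in>Z. s e \<in> W \<or> t e \<in> W"
proof (rule ccontr)
  assume n: "\<not> (\<exists>e\<in>Z. s e \<in> W \<or> t e \<in> W)"
  define x where "x e = (of_bool (e \<in> Z) :: bit)" for e
  obtain e where e: "e \<in> Z" using assms(4) by auto
  have "x e = 0"
  proof (rule forestD [OF assms(2)])
    show "s e \<notin> W \<and> t e \<notin> W" if "x e \<noteq> 0" for e
      using that n by (auto simp: x_def)
    show "bd E s t x v = 0" for v
    proof -
      have "bd E s t x v = bd Z s t x v" by (rule bd_restrict) (use assms in \<open>auto simp: x_def\<close>)
      also have "\<dots> = bd Z s t (\<lambda>_. 1) v" by (rule bd_cong) (simp add: x_def)
      finally show ?thesis using assms(5) by simp
    qed
    show "e \<in> E" using e assms(3) by auto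
  qed
  then show False using e by (simp add: x_def)
qed

text \<open>The hypotheses are kept inside, so that the induction hypothesis can be handed to a
  reduction step before they are verified for the contracted graph.\<close>

definition petersen_alternative :: "'e set \<Rightarrow> ('e \<Rightarrow> 'v) \<Rightarrow> ('e \<Rightarrow> 'v) \<Rightarrow> 'v set \<Rightarrow> bool" where
  "petersen_alternative E s t W \<longleftrightarrow> (finite W \<and> card W \<le> 3 \<and> forest E s t W \<and> bridgeless E s t \<longrightarrow>
     klein_flow E s t \<or> petersen_contraction E s t W)"

lemma conn_star:
  assumes "\<And>v. v \<in> S \<Longrightarrow> (a, v) \<in> conn Z s t" "u \<in> S" "v \<in> S"
  shows "(u, v) \<in> conn Z s t"
  by (rule conn_trans [OF conn_sym [OF assms(1) [OF assms(2)]] assms(1) [OF assms(3)]])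

lemma collapse_conn:
  assumes "\<And>a b. a \<in> S \<Longrightarrow> b \<in> S \<Longrightarrow> (a, b) \<in> conn Z s t" "w \<in> S" "collapse S w a = collapse S w b"
  shows "(a, b) \<in> conn Z s t"
proof -
  have "a = b \<or> a \<in> S \<and> b \<in> S" using assms(2,3) by (auto simp: collapse_def split: if_splits)
  then show ?thesis using assms(1) by auto
qed

text \<open>The circuit meets \<open>W\<close>, hence collapsing it produces a special vertex
  without increasing the number of special vertices: the bound three survives. How a flow extends
  over \<open>Z\<close> depends on the length and is left to \<open>ext\<close>.\<close>

lemma circuit_step:
  assumes fin: "finite E" and Z: "Z \<subseteq> E" "Z \<noteq> {}" and S: "w \<in> S"
    and ends: "\<And>e. e \<in> Z \<Longrightarrow> s e \<in> S \<and> t e \<in> S"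
    and conn: "\<And>a b. a \<in> S \<Longrightarrow> b \<in> S \<Longrightarrow> (a, b) \<in> conn Z s t"
    and circ: "\<And>v. bd Z s t (\<lambda>_. 1::bit) v = 0"
    and ext: "klein_flow (E - Z) (collapse S w \<circ> s) (collapse S w \<circ> t) \<Longrightarrow> klein_flow E s t"
    and IH: "petersen_alternative (E - Z) (collapse S w \<circ> s) (collapse S w \<circ> t) (collapse S w ` W)"
  shows "petersen_alternative E s t W"
  unfolding petersen_alternative_def
proof (intro impI, elim conjE)
  let ?f = "collapse S w"
  assume W: "finite W" "card W \<le> 3" and forest: "forest E s t W" and br: "bridgeless E s t"
  have loops: "?f (s e) = ?f (t e)" if "e \<in> Z" for e using ends [OF that] by (simp add: collapse_def)
  obtain e where "e \<in> Z" "s e \<in> W \<or> t e \<in> W" using circuit_meets [OF fin forest Z circ] by blast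
  then obtain u where "u \<in> S" "u \<in> W" using ends by blast
  then have "w \<in> ?f ` W" by (auto simp: collapse_def intro!: image_eqI [of _ _ u])
  then have "forest (E - Z) (?f \<circ> s) (?f \<circ> t) (?f ` W)"
    using forest_collapse [OF forest fin Z(1) S] by blast
  moreover have "bridgeless (E - Z) (?f \<circ> s) (?f \<circ> t)"
    using bridgeless_contract [OF br fin Z(1)] loops by blast
  moreover have "finite (?f ` W)" "card (?f ` W) \<le> 3"
    using W card_image_le [of W ?f] by auto
  ultimately consider "klein_flow (E - Z) (?f \<circ> s) (?f \<circ> t)"
    | "petersen_contraction (E - Z) (?f \<circ> s) (?f \<circ> t) (?f ` W)"
    using IH unfolding petersen_alternative_def by blast
  then show "klein_flow E s t \<or> petersen_contraction E s t W"
  proof cases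
    case 2
    then have "petersen_contraction E s t W"
      by (rule petersen_contraction_lift [OF _ Z(1)]) (use loops collapse_conn [OF conn S] in auto)
    then show ?thesis ..
  qed (use ext in blast)
qed

text \<open>A flow takes equal values on the two edges at \<open>v\<close>, so a flow of the
  contracted graph extends by copying the value of \<open>e2\<close> to \<open>e1\<close>. As
  \<open>v\<close> is not special, merging it into \<open>u\<close> keeps \<open>W\<close>
  unchanged.\<close>

lemma degree_two_step:
  assumes fin: "finite E" and e: "e1 \<in> E" "e2 \<in> E" "e1 \<noteq> e2" and v: "v \<notin> W"
    and l: "link s t e1 v u" "link s t e2 v u'" and ne: "u \<noteq> v" "u' \<noteq> v"
    and deg: "\<And>e. e \<in> E \<Longrightarrow> s e = v \<or> t e = v \<Longrightarrow> e = e1 \<or> e = e2"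
    and IH: "petersen_alternative (E - {e1}) (collapse {v, u} u \<circ> s) (collapse {v, u} u \<circ> t) W"
  shows "petersen_alternative E s t W"
  unfolding petersen_alternative_def
proof (intro impI, elim conjE)
  let ?f = "collapse {v, u} u" and ?Z = "{e1}"
  assume W: "finite W" "card W \<le> 3" and forest: "forest E s t W" and br: "bridgeless E s t"
  have fW: "?f ` W = W" using v by (force simp: collapse_def image_iff)
  have loops: "?f (s e) = ?f (t e)" if "e \<in> ?Z" for e using l(1) that by (auto simp: collapse_def link_iff)
  have conn: "(a, b) \<in> conn ?Z s t" if "a \<in> {v, u}" "b \<in> {v, u}" for a b
    using that conn_link [OF _ l(1), of ?Z] conn_sym [of v u ?Z s t] by auto
  have split: "bd E s t x a = bd (E - ?Z) s t x a + bd ?Z s t x a" for a and x :: "'a \<Rightarrow> 'z::elem2"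
    by (rule bd_diff) (use fin e in auto)
  have one: "bd ?Z s t x a = (if v = a then x e1 else 0) + (if u = a then x e1 else 0)"
    for a and x :: "'a \<Rightarrow> 'z::elem2"
    using bd_insert_link [OF _ _ l(1), of "{}" x a] by simp
  have at_v: "bd (E - ?Z) s t x v = x e2" for x :: "'a \<Rightarrow> 'z::elem2"
  proof -
    have "bd (E - ?Z) s t x v = bd {e2} s t x v"
      unfolding bd_def by (rule sum.mono_neutral_right) (use fin e deg in auto)
    then show ?thesis using bd_insert_link [OF _ _ l(2), of "{}" x v] ne by simp
  qed
  have extend: "bd E s t (x(e1 := x e2)) a = 0"
    if "\<And>a. bd (E - ?Z) (?f \<circ> s) (?f \<circ> t) x a = 0" for a and x :: "'a \<Rightarrow> 'z::elem2"
  proof -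
    let ?y = "x(e1 := x e2)"
    have *: "bd (E - ?Z) s t ?y a = bd (E - ?Z) s t x a" for a by (rule bd_cong) auto
    have "bd (E - ?Z) s t x a = 0" if "a \<noteq> v" "a \<noteq> u"
      using bd_collapse [of u "{v, u}" a "E - ?Z" s t x] that \<open>\<And>a. bd (E - ?Z) (?f \<circ> s) (?f \<circ> t) x a = 0\<close>
      by simp
    moreover have "bd (E - ?Z) s t x u = x e2"
      using bd_collapse_sum [of "{v, u}" u "E - ?Z" s t x] that ne at_v [of x]
      by (simp add: add_eq_zero_iff)
    ultimately show ?thesis using at_v [of x] ne unfolding split one * by auto
  qed
  have "forest (E - ?Z) (?f \<circ> s) (?f \<circ> t) W"
    unfolding forest_def
  proof (intro allI impI, elim conjE)
    fix x :: "'a \<Rightarrow> bit"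
    assume supp: "\<forall>e\<in>E - ?Z. x e \<noteq> 0 \<longrightarrow> (?f \<circ> s) e \<notin> W \<and> (?f \<circ> t) e \<notin> W"
      and flow: "\<forall>a. bd (E - ?Z) (?f \<circ> s) (?f \<circ> t) x a = 0"
    show "\<forall>e\<in>E - ?Z. x e = 0"
    \<comment> \<open>For special \<open>u\<close> this is a collapse onto a special vertex.
      Otherwise an even set of the contracted graph is extended over \<open>e1\<close>, which also
      avoids \<open>W\<close>.\<close>
    proof (cases "u \<in> W")
      case True
      have "forest (E - ?Z) (?f \<circ> s) (?f \<circ> t) W"
        by (rule forest_collapse [OF forest fin]) (use e True fW in auto)
      then show ?thesis using supp flow unfolding forest_def by blast
    next
      case False
      let ?y = "x(e1 := x e2)"
      have f: "a \<notin> W" if "?f a \<notin> W" for a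
        using that v by (auto simp: collapse_def split: if_splits)
      have "?y e = 0" if "e \<in> E" for e
      proof (rule forestD [OF forest _ _ that])
        show "s e \<notin> W \<and> t e \<notin> W" if "e \<in> E" "?y e \<noteq> 0" for e
        proof (cases "e = e1")
          case True
          then show ?thesis using l(1) v False by (auto simp: link_iff)
        next
          case ne: False
          then show ?thesis using supp that f by auto
        qed
        show "bd E s t ?y a = 0" for a by (rule extend) (use flow in blast)
      qed
      then show ?thesis by (metis DiffE fun_upd_other insertI1)
    qed
  qed
  moreover have "bridgeless (E - ?Z) (?f \<circ> s) (?f \<circ> t)"
    by (rule bridgeless_contract [OF br fin]) (use e loops in auto)
  ultimately consider "klein_flow (E - ?Z) (?f \<circ> s) (?f \<circ> t)" | "petersen_contraction (E - ?Z) (?f \<circ> s) (?f \<circ> t) W"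
    using IH W unfolding petersen_alternative_def by blast
  then show "klein_flow E s t \<or> petersen_contraction E s t W"
  proof cases
    case 1
    then obtain x :: "'a \<Rightarrow> bit \<times> bit" where x: "\<And>e. e \<in> E - ?Z \<Longrightarrow> x e \<noteq> 0"
      "\<And>a. bd (E - ?Z) (?f \<circ> s) (?f \<circ> t) x a = 0" unfolding klein_flow_def by blast
    have "(x(e1 := x e2)) e \<noteq> 0" if "e \<in> E" for e using x(1) [of e] x(1) [of e2] e that by auto
    then have "klein_flow E s t" unfolding klein_flow_def using extend [OF x(2)] by blast
    then show ?thesis ..
  next
    case 2
    then have "petersen_contraction E s t W"
      using petersen_contraction_lift [of E ?Z ?f s t W] e loops fW collapse_conn [of "{v, u}" ?Z s t u] conn
      by auto
    then show ?thesis ..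
  qed
qed

theorem flow_or_petersen:
  assumes "finite E" "finite W" "card W \<le> 3" "forest E s t W" "bridgeless E s t"
  shows "klein_flow E s t \<or> petersen_contraction E s t W"
proof -
  have "petersen_alternative E s t W" using assms(1)
  proof (induction "card E" arbitrary: E s t W rule: less_induct)
    case (less E s t W)
    note fin = less.prems
    have IH: "petersen_alternative (E - Z) s' t' W'" if "Z \<subseteq> E" "Z \<noteq> {}" for Z W' and s' t' :: "'a \<Rightarrow> 'b"
    proof -
      have "card (E - Z) < card E" using that fin by (intro psubset_card_mono) auto
      moreover have "finite (E - Z)" using fin by simp
      ultimately show ?thesis by (rule less.hyps)
    qed
    consider (loop) e where "e \<in> E" "s e = t e"
      | (digon) e e' where "\<forall>e\<in>E. s e \<noteq> t e" "e \<in> E" "e' \<in> E" "e \<noteq> e'" "{s e, t e} = {s e', t e'}"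
      | (simple) "simple E s t"
      unfolding simple_def by blast
    then show ?case
    proof cases
      case loop
      show ?thesis
      proof (rule circuit_step [OF fin, of "{e}" "s e" "{s e}"])
        let ?f = "collapse {s e} (s e)"
        \<comment> \<open>Collapsing a single vertex does nothing: a loop is merely deleted, and any
          nonzero value may be put on it.\<close>
        have id: "?f \<circ> g = g" for g :: "'a \<Rightarrow> 'b" by (auto simp: collapse_def)
        show "klein_flow E s t" if nz: "klein_flow (E - {e}) (?f \<circ> s) (?f \<circ> t)"
        proof -
          obtain x :: "'a \<Rightarrow> bit \<times> bit" where "\<And>e'. e' \<in> E - {e} \<Longrightarrow> x e' \<noteq> 0"
            "\<And>v. bd (E - {e}) s t x v = 0" using nz unfolding id klein_flow_def by blast
          then show ?thesis
            using loop by (intro klein_flow_extend [OF fin, of "{e}" x "\<lambda>_. (1, 0)"])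
              (auto simp: bd_insert zero_prod_def)
        qed
      qed (use loop in \<open>auto simp: bd_insert intro!: IH\<close>)
    next
      case digon
      obtain a b where ab: "link s t e a b" by (auto simp: link_def)
      have ab': "link s t e' a b" using ab digon by (simp add: link_def)
      have ne: "a \<noteq> b" using ab digon by (auto simp: link_iff)
      show ?thesis
      proof (rule circuit_step [OF fin, of "{e, e'}" a "{a, b}"])
        show "klein_flow E s t" if "klein_flow (E - {e, e'}) (collapse {a, b} a \<circ> s) (collapse {a, b} a \<circ> t)"
          by (rule klein_flow_digon [OF fin digon(2-4) ne ab ab' _ that]) simp
        show "(u, v) \<in> conn {e, e'} s t" if "u \<in> {a, b}" "v \<in> {a, b}" for u v
          using that conn_link [OF _ ab, of "{e, e'}"] conn_sym [of a b "{e, e'}" s t] by auto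
        show "bd {e, e'} s t (\<lambda>_. 1::bit) v = 0" for v
          using digon(4) by (simp add: bd_insert_link [OF _ _ ab] bd_insert_link [OF _ _ ab'])
      qed (use digon ab ab' in \<open>auto simp: link_iff intro!: IH\<close>)
    next
      case simple
      consider (tri) e1 e2 e3 a b c where "e1 \<in> E" "e2 \<in> E" "e3 \<in> E" "distinct [a, b, c]"
          "link s t e1 a b" "link s t e2 b c" "link s t e3 c a"
        | (quad) e1 e2 e3 e4 a b c d where "e1 \<in> E" "e2 \<in> E" "e3 \<in> E" "e4 \<in> E" "distinct [a, b, c, d]"
          "link s t e1 a b" "link s t e2 b c" "link s t e3 c d" "link s t e4 d a"
        | (deg2) v where "v \<notin> W" "card {e\<in>E. s e = v \<or> t e = v} = 2"
        | (final) "\<nexists>e1 e2 e3 a b c. e1 \<in> E \<and> e2 \<in> E \<and> e3 \<in> E \<and> distinct [a, b, c] \<and>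
            link s t e1 a b \<and> link s t e2 b c \<and> link s t e3 c a"
          "\<nexists>e1 e2 e3 e4 a b c d. e1 \<in> E \<and> e2 \<in> E \<and> e3 \<in> E \<and> e4 \<in> E \<and>
            distinct [a, b, c, d] \<and> link s t e1 a b \<and> link s t e2 b c \<and> link s t e3 c d \<and>
            link s t e4 d a"
          "\<nexists>v. v \<notin> W \<and> card {e\<in>E. s e = v \<or> t e = v} = 2"
        by blast
      then show ?thesis
      proof cases
        case tri
        let ?Z = "{e1, e2, e3}"
        show ?thesis
        proof (rule circuit_step [OF fin, of ?Z a "{a, b, c}"])
          show "klein_flow E s t" if "klein_flow (E - ?Z) (collapse {a, b, c} a \<circ> s) (collapse {a, b, c} a \<circ> t)"
            by (rule klein_flow_triangle [OF fin tri _ that]) simp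
          have ab: "(a, b) \<in> conn ?Z s t" by (rule conn_link [OF _ tri(5)]) simp
          have bc: "(b, c) \<in> conn ?Z s t" by (rule conn_link [OF _ tri(6)]) simp
          have star: "(a, v) \<in> conn ?Z s t" if "v \<in> {a, b, c}" for v
            using that ab conn_trans [OF ab bc] by auto
          show "(u, v) \<in> conn ?Z s t" if "u \<in> {a, b, c}" "v \<in> {a, b, c}" for u v
            by (rule conn_star [OF star that])
          have "distinct [e1, e2, e3]" using tri(4-7) by (auto simp: link_iff)
          then show "bd ?Z s t (\<lambda>_. 1::bit) v = 0" for v
            by (simp add: bd_insert_link [OF _ _ tri(5)] bd_insert_link [OF _ _ tri(6)]
                bd_insert_link [OF _ _ tri(7)])
        qed (use tri in \<open>auto simp: link_iff intro!: IH\<close>)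
      next
        case quad
        let ?Z = "{e1, e2, e3, e4}"
        show ?thesis
        proof (rule circuit_step [OF fin, of ?Z a "{a, b, c, d}"])
          show "klein_flow E s t" if "klein_flow (E - ?Z) (collapse {a, b, c, d} a \<circ> s) (collapse {a, b, c, d} a \<circ> t)"
            by (rule klein_flow_quad [OF fin quad _ that]) simp
          have ab: "(a, b) \<in> conn ?Z s t" by (rule conn_link [OF _ quad(6)]) simp
          have bc: "(b, c) \<in> conn ?Z s t" by (rule conn_link [OF _ quad(7)]) simp
          have cd: "(c, d) \<in> conn ?Z s t" by (rule conn_link [OF _ quad(8)]) simp
          have star: "(a, v) \<in> conn ?Z s t" if "v \<in> {a, b, c, d}" for v
            using that ab conn_trans [OF ab bc] conn_trans [OF conn_trans [OF ab bc] cd] by auto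
          show "(u, v) \<in> conn ?Z s t" if "u \<in> {a, b, c, d}" "v \<in> {a, b, c, d}" for u v
            by (rule conn_star [OF star that])
          have "distinct [e1, e2, e3, e4]" using quad(5-9) by (auto simp: link_iff)
          then show "bd ?Z s t (\<lambda>_. 1::bit) v = 0" for v
            by (simp add: bd_insert_link [OF _ _ quad(6)] bd_insert_link [OF _ _ quad(7)]
                bd_insert_link [OF _ _ quad(8)] bd_insert_link [OF _ _ quad(9)])
        qed (use quad in \<open>auto simp: link_iff intro!: IH\<close>)
      next
        case deg2
        obtain e1 e2 where D: "{e\<in>E. s e = v \<or> t e = v} = {e1, e2}" "e1 \<noteq> e2"
          using deg2(2) unfolding card_2_iff by blast
        then have e: "e1 \<in> E" "e2 \<in> E" "s e1 = v \<or> t e1 = v" "s e2 = v \<or> t e2 = v" by blast+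
        obtain u where u: "link s t e1 v u" using e(3) by (auto simp: link_iff)
        obtain u' where u': "link s t e2 v u'" using e(4) by (auto simp: link_iff)
        have "u \<noteq> v" "u' \<noteq> v" using u u' e(1,2) simple by (auto simp: link_iff simple_def)
        then show ?thesis
          by (rule degree_two_step [OF fin e(1,2) D(2) deg2(1) u u']) (use D e(1) in \<open>auto intro!: IH\<close>)
      next
        case final
        show ?thesis
          unfolding petersen_alternative_def
        proof (intro impI, elim conjE)
          assume h: "finite W" "card W \<le> 3" "forest E s t W" "bridgeless E s t"
          have "E = {} \<or> card W = 3 \<and> is_petersen E s t"
            by (rule petersen_if_girth5 [OF fin h simple]) (use final in blast)+
          then show "klein_flow E s t \<or> petersen_contraction E s t W"
          proof
            assume "E = {}"
            then show ?thesis by (simp add: klein_flow_def)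
          next
            assume "card W = 3 \<and> is_petersen E s t"
            then have "petersen_contraction E s t W"
              unfolding petersen_contraction_def by (intro exI [of _ id] exI [of _ E]) auto
            then show ?thesis ..
          qed
        qed
      qed
    qed
  qed
  then show ?thesis using assms unfolding petersen_alternative_def by blast
qed

section \<open>Labelling the edges of an even graph along an Euler tour\<close>

fun trail :: "('e \<Rightarrow> 'v) \<Rightarrow> ('e \<Rightarrow> 'v) \<Rightarrow> 'v \<Rightarrow> 'e list \<Rightarrow> 'v \<Rightarrow> bool" where
  "trail s t u [] v \<longleftrightarrow> u = v"
| "trail s t u (e # es) v \<longleftrightarrow> (\<exists>w. link s t e u w \<and> trail s t w es v)"

lemma trail_append: "trail s t u (xs @ ys) v \<longleftrightarrow> (\<exists>w. trail s t u xs w \<and> trail s t w ys v)"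
  by (induction xs arbitrary: u) auto

lemma bd_trail:
  "trail s t u es v \<Longrightarrow> distinct es \<Longrightarrow>
    bd (set es) s t (\<lambda>_. 1::bit) w = of_bool (w = u) + of_bool (w = v)"
proof (induction es arbitrary: u)
  case Nil
  then show ?case by simp
next
  case (Cons e es)
  then obtain u' where u': "link s t e u u'" "trail s t u' es v" by auto
  have "bd (set es) s t (\<lambda>_. 1::bit) w = of_bool (w = u') + of_bool (w = v)"
    using Cons.IH [OF u'(2)] Cons.prems(2) by simp
  then show ?case
    using Cons.prems(2) by (auto simp: bd_insert_link [OF _ _ u'(1)])
qed

lemma euler_trail:
  assumes fin: "finite E" and "E \<noteq> {}" and even: "\<And>v. bd E s t (\<lambda>_. 1::bit) v = 0"
    and conn: "\<And>a b. a \<in> s ` E \<union> t ` E \<Longrightarrow> b \<in> s ` E \<union> t ` E \<Longrightarrow> (a, b) \<in> conn E s t"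
  obtains u es where "trail s t u es u" "distinct es" "set es = E"
proof -
  define P where "P n \<longleftrightarrow> (\<exists>u es v. trail s t u es v \<and> distinct es \<and> set es \<subseteq> E \<and> length es = n)" for n
  have bound: "n \<le> card E" if "P n" for n
    using that card_mono [OF fin] unfolding P_def by (metis distinct_card)
  obtain e0 where e0: "e0 \<in> E" using \<open>E \<noteq> {}\<close> by auto
  have "link s t e0 (s e0) (t e0)" by (simp add: link_iff)
  then have P1: "P 1"
    unfolding P_def using e0 by (intro exI [of _ "s e0"] exI [of _ "[e0]"] exI [of _ "t e0"]) auto
  define n where "n = (GREATEST n. P n)"
  have Pn: "P n" unfolding n_def by (rule GreatestI_nat [of P, OF P1 bound])
  have max: "\<not> P (Suc n)"
    using Greatest_le_nat [of P "Suc n" "card E"] bound unfolding n_def by auto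
  have "1 \<le> n" unfolding n_def by (rule Greatest_le_nat [of P, OF P1 bound])
  obtain u es v where tr: "trail s t u es v" "distinct es" "set es \<subseteq> E" "length es = n"
    using Pn unfolding P_def by blast
  have "es \<noteq> []" using tr(4) \<open>1 \<le> n\<close> by auto
  have "u = v"
  proof (rule ccontr)
    assume "u \<noteq> v"
    have "bd E s t (\<lambda>_. 1::bit) v = bd (E - set es) s t (\<lambda>_. 1) v + bd (set es) s t (\<lambda>_. 1) v"
      by (rule bd_diff [OF fin tr(3)])
    then have "bd (E - set es) s t (\<lambda>_. 1::bit) v \<noteq> 0"
      using even [of v] bd_trail [OF tr(1,2), of v] \<open>u \<noteq> v\<close> by simp
    then have "v \<in> s ` (E - set es) \<union> t ` (E - set es)" using bd_untouched [of v s "E - set es" t "\<lambda>_. 1::bit"] by blast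
    then obtain e where e: "e \<in> E - set es" "s e = v \<or> t e = v" by blast
    then obtain w where "link s t e v w" by (auto simp: link_iff)
    then have "trail s t u (es @ [e]) w" using tr(1) by (auto simp: trail_append)
    then have "P (Suc n)"
      unfolding P_def using tr e by (intro exI [of _ u] exI [of _ "es @ [e]"] exI [of _ w]) auto
    then show False using max by blast
  qed
  have "set es = E"
  proof (rule ccontr)
    assume "set es \<noteq> E"
    then obtain e where e: "e \<in> E" "e \<notin> set es" using tr(3) by blast
    \<comment> \<open>The vertices at which the closed trail can be cut open.\<close>
    define U where "U = {w. \<exists>xs ys. es = xs @ ys \<and> trail s t u xs w \<and> trail s t w ys u}"
    have in_es: "s e' \<in> U \<and> t e' \<in> U" if e': "e' \<in> set es" for e'
    proof -
      obtain xs ys where es: "es = xs @ e' # ys" using split_list [OF e'] by blast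
      then obtain w w' where w: "trail s t u xs w" "link s t e' w w'" "trail s t w' ys u"
        using tr(1) \<open>u = v\<close> by (auto simp: trail_append)
      have "w \<in> U" unfolding U_def using es w
        by (intro CollectI exI [of _ xs] exI [of _ "e' # ys"]) auto
      moreover have "trail s t u (xs @ [e']) w'" using w by (auto simp: trail_append)
      then have "w' \<in> U" unfolding U_def using es w(3)
        by (intro CollectI exI [of _ "xs @ [e']"] exI [of _ ys]) auto
      ultimately show ?thesis using w(2) by (auto simp: link_iff)
    qed
    have "\<exists>e'\<in>E - set es. s e' \<in> U \<or> t e' \<in> U"
    proof (rule ccontr)
      assume n: "\<not> (\<exists>e'\<in>E - set es. s e' \<in> U \<or> t e' \<in> U)"
      obtain e' where e': "e' \<in> set es" using \<open>es \<noteq> []\<close> by (cases es) auto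
      have "(s e', s e) \<in> conn E s t" using conn e' e tr(3) by blast
      then have "s e \<in> U"
        by (rule conn_closed) (use in_es e' n in blast)+
      then show False using n e by blast
    qed
    then obtain e' w where e': "e' \<in> E" "e' \<notin> set es" "w \<in> U" "s e' = w \<or> t e' = w" by blast
    then obtain w' where w': "link s t e' w' w" by (auto simp: link_iff)
    obtain xs ys where xy: "es = xs @ ys" "trail s t u xs w" "trail s t w ys u"
      using e'(3) unfolding U_def by blast
    have "trail s t w' (e' # ys @ xs) w" using w' xy by (auto simp: trail_append)
    then have "P (Suc n)"
      unfolding P_def using tr e' xy
      by (intro exI [of _ w'] exI [of _ "e' # ys @ xs"] exI [of _ w]) auto
    then show False using max by blast
  qed
  then show thesis using that tr \<open>u = v\<close> by blast
qed

text \<open>Walking along a trail, the label changes by \<open>b w\<close> at the first visit of each vertex \<open>w\<close>;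
  \<open>A\<close> is the set of vertices visited before.\<close>

lemma trail_labels:
  fixes b :: "'v \<Rightarrow> 'a::elem2"
  assumes "trail s t u es v" "distinct es" "finite A" "u \<in> A"
  shows "\<exists>l. \<forall>w. \<exists>g. \<forall>h. bd (set es) s t (\<lambda>e. of_bool (l e = h) :: bit) w =
    of_bool (u = w \<and> sum b A = h) + of_bool (v = w \<and> sum b (A \<union> s ` set es \<union> t ` set es) = h) +
    (if w \<in> (s ` set es \<union> t ` set es) - A then of_bool (g = h) + of_bool (g + b w = h) else 0)"
  using assms
proof (induction es arbitrary: u A)
  case Nil
  then show ?case by auto
next
  case (Cons e es)
  then obtain u' where u': "link s t e u u'" "trail s t u' es v" by auto
  have e: "e \<notin> set es" "distinct es" using Cons.prems(2) by auto
  let ?A' = "insert u' A"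
  let ?T = "s ` set es \<union> t ` set es" and ?T' = "s ` set (e # es) \<union> t ` set (e # es)"
  have T: "?A' \<union> s ` set es \<union> t ` set es = A \<union> s ` set (e # es) \<union> t ` set (e # es)"
    using u'(1) Cons.prems(4) by (auto simp: link_iff)
  obtain l where l: "\<forall>w. \<exists>g. \<forall>h. bd (set es) s t (\<lambda>e. of_bool (l e = h) :: bit) w =
    of_bool (u' = w \<and> sum b ?A' = h) + of_bool (v = w \<and> sum b (A \<union> s ` set (e # es) \<union> t ` set (e # es)) = h) +
    (if w \<in> ?T - ?A' then of_bool (g = h) + of_bool (g + b w = h) else 0)"
    using Cons.IH [OF u'(2) e(2), of ?A'] Cons.prems(3) unfolding T by auto
  \<comment> \<open>The label is the running total of \<open>b\<close> over the vertices visited so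
    far.\<close>
  let ?l = "l(e := sum b A)"
  have step: "bd (set (e # es)) s t (\<lambda>e. of_bool (?l e = h) :: bit) w =
      of_bool (u = w \<and> sum b A = h) + of_bool (u' = w \<and> sum b A = h) +
      bd (set es) s t (\<lambda>e. of_bool (l e = h)) w" for h w
  proof -
    have "bd (set es) s t (\<lambda>e. of_bool (?l e = h) :: bit) w = bd (set es) s t (\<lambda>e. of_bool (l e = h)) w"
      by (rule bd_cong) (use e(1) in auto)
    then show ?thesis
      using bd_insert_link [OF _ e(1) u'(1), of "\<lambda>e. of_bool (?l e = h) :: bit" w] by auto
  qed
  have "\<exists>g. \<forall>h. bd (set (e # es)) s t (\<lambda>e. of_bool (?l e = h) :: bit) w =
    of_bool (u = w \<and> sum b A = h) + of_bool (v = w \<and> sum b (A \<union> s ` set (e # es) \<union> t ` set (e # es)) = h) +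
    (if w \<in> ?T' - A then of_bool (g = h) + of_bool (g + b w = h) else 0)" (is "\<exists>g. \<forall>h. ?R g h") for w
  proof -
    obtain g where g: "\<forall>h. bd (set es) s t (\<lambda>e. of_bool (l e = h) :: bit) w =
      of_bool (u' = w \<and> sum b ?A' = h) + of_bool (v = w \<and> sum b (A \<union> s ` set (e # es) \<union> t ` set (e # es)) = h) +
      (if w \<in> ?T - ?A' then of_bool (g = h) + of_bool (g + b w = h) else 0)"
      using l by blast
    show ?thesis
    proof (cases "w = u' \<and> u' \<notin> A")
      \<comment> \<open>First visit of \<open>w\<close>: the trail enters with label
        \<open>sum b A\<close> and goes on with \<open>sum b A + b w\<close>.\<close>
      case True
      then have "sum b ?A' = sum b A + b w" using Cons.prems(3) by (simp add: add.commute)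
      moreover have "w \<in> ?T' - A" using True u'(1) by (auto simp: link_iff)
      ultimately have "?R (sum b A) h" for h
        unfolding step using g True by (auto simp: ac_simps)
      then show ?thesis by blast
    next
      \<comment> \<open>A later visit enters and leaves with the same label, so its two
        contributions cancel; at other vertices the new edge only matters at its start
        \<open>u\<close>.\<close>
      case False
      have mem: "w \<in> ?T' - A \<longleftrightarrow> w \<in> ?T - ?A'"
        using False u'(1) Cons.prems(4) by (auto simp: link_iff)
      have "u' = w \<Longrightarrow> sum b ?A' = sum b A" using False by (simp add: insert_absorb)
      then have "?R g h" for h
        unfolding step mem g [rule_format] by (cases "u' = w") (auto simp: ac_simps)
      then show ?thesis by blast
    qed
  qed
  then show ?case by (intro exI [of _ ?l]) blast
qed

text \<open>Modulo two, only the labels \<open>g\<close> and \<open>g + b w\<close> remain around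
  \<open>w\<close>. They differ by the prescribed boundary \<open>b w\<close>, which is how the
  labelling of \<open>C\<close> matches the flow on \<open>T\<close>.\<close>

lemma euler_labels:
  fixes b :: "'v \<Rightarrow> 'a::elem2"
  assumes fin: "finite E" and "E \<noteq> {}" and even: "\<And>v. bd E s t (\<lambda>_. 1::bit) v = 0"
    and conn: "\<And>a b. a \<in> s ` E \<union> t ` E \<Longrightarrow> b \<in> s ` E \<union> t ` E \<Longrightarrow> (a, b) \<in> conn E s t"
    and b: "sum b (s ` E \<union> t ` E) = 0"
  shows "\<exists>l. \<forall>w\<in>s ` E \<union> t ` E. \<exists>g. \<forall>h. bd E s t (\<lambda>e. of_bool (l e = h) :: bit) w =
    of_bool (g = h) + of_bool (g + b w = h)"
proof -
  obtain u es where es: "trail s t u es u" "distinct es" "set es = E"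
    by (rule euler_trail [OF fin \<open>E \<noteq> {}\<close> even conn])
  have "u \<in> s ` E \<union> t ` E"
    using es \<open>E \<noteq> {}\<close> by (cases es) (auto simp: link_iff)
  then have T: "{u} \<union> s ` set es \<union> t ` set es = s ` E \<union> t ` E" using es(3) by auto
  obtain l where l: "\<forall>w. \<exists>g. \<forall>h. bd E s t (\<lambda>e. of_bool (l e = h) :: bit) w =
    of_bool (u = w \<and> b u = h) + of_bool (u = w \<and> 0 = h) +
    (if w \<in> (s ` E \<union> t ` E) - {u} then of_bool (g = h) + of_bool (g + b w = h) else 0)"
    using trail_labels [OF es(1,2), of "{u}" b] b unfolding T unfolding es(3) by auto
  have "\<exists>g. \<forall>h. bd E s t (\<lambda>e. of_bool (l e = h) :: bit) w = of_bool (g = h) + of_bool (g + b w = h)"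
    if w: "w \<in> s ` E \<union> t ` E" for w
  proof -
    obtain g where g: "\<forall>h. bd E s t (\<lambda>e. of_bool (l e = h) :: bit) w =
      of_bool (u = w \<and> b u = h) + of_bool (u = w \<and> 0 = h) +
      (if w \<in> (s ` E \<union> t ` E) - {u} then of_bool (g = h) + of_bool (g + b w = h) else 0)"
      using l by blast
    show ?thesis
    proof (cases "w = u")
      case True
      \<comment> \<open>The tour leaves its start \<open>u\<close> with label \<open>b u\<close> and
        comes back with the total of \<open>b\<close>, which is zero; this is the same pattern with
        \<open>g = 0\<close>.\<close>
      then show ?thesis using g by (intro exI [of _ 0]) auto
    next
      case False
      then show ?thesis using g w by (intro exI [of _ g]) auto
    qed
  qed
  then show ?thesis by (intro exI [of _ l]) blast
qed

lemma conn_fibre: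
  assumes "(a, b) \<in> conn E s t" "\<And>e. e \<in> E \<Longrightarrow> \<kappa> (s e) = \<kappa> (t e)"
  shows "\<kappa> b = \<kappa> a \<and> (a, b) \<in> conn {e\<in>E. \<kappa> (s e) = \<kappa> a} s t"
  using assms(1)
proof (induction rule: conn_induct)
  case (step e u v)
  have uv: "link s t e u v" using step.hyps(2) by (simp add: link_def)
  then have k: "\<kappa> (s e) = \<kappa> a" "\<kappa> v = \<kappa> a"
    using assms(2) [OF step.hyps(1)] step.IH by (auto simp: link_iff)
  then have "(u, v) \<in> conn {e\<in>E. \<kappa> (s e) = \<kappa> a} s t"
    using step.hyps(1) by (intro conn_link [OF _ uv]) simp
  then show ?case using k(2) conn_trans [OF conjunct2 [OF step.IH]] by blast
qed simp

lemma component_labels: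
  fixes b :: "'v \<Rightarrow> 'a::elem2"
  assumes fin: "finite V" "finite E" and ends: "s ` E \<subseteq> V" "t ` E \<subseteq> V"
    and even: "\<And>v. bd E s t (\<lambda>_. 1::bit) v = 0"
    and \<kappa>: "\<And>e. e \<in> E \<Longrightarrow> \<kappa> (s e) = \<kappa> (t e)"
    and conn: "\<And>u v. u \<in> V \<Longrightarrow> v \<in> V \<Longrightarrow> \<kappa> u = \<kappa> v \<Longrightarrow> (u, v) \<in> conn E s t"
    and b: "\<And>k. sum b {v\<in>V. \<kappa> v = k} = 0"
  shows "\<exists>l. \<forall>w\<in>V. \<exists>g. \<forall>h. bd E s t (\<lambda>e. of_bool (l e = h) :: bit) w =
    of_bool (g = h) + of_bool (g + b w = h)"
proof -
  define K where "K k = {e\<in>E. \<kappa> (s e) = k}" for k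
  have K_sub: "K k \<subseteq> E" for k by (auto simp: K_def)
  have K_bd: "bd E s t x w = bd (K (\<kappa> w)) s t x w" for x :: "'b \<Rightarrow> bit" and w
    unfolding bd_def
    by (rule sum.mono_neutral_right) (use fin \<kappa> in \<open>auto simp: K_def\<close>)
  have T: "s ` K k \<union> t ` K k = {v\<in>V. \<kappa> v = k}" if k: "K k \<noteq> {}" for k
  proof
    show "s ` K k \<union> t ` K k \<subseteq> {v\<in>V. \<kappa> v = k}" using ends \<kappa> by (auto simp: K_def)
    show "{v\<in>V. \<kappa> v = k} \<subseteq> s ` K k \<union> t ` K k"
    proof
      fix v assume v: "v \<in> {v\<in>V. \<kappa> v = k}"
      obtain e where e: "e \<in> K k" using k by auto
      then have "(s e, v) \<in> conn E s t" using conn [of "s e" v] v ends by (auto simp: K_def)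
      then have "(s e, v) \<in> conn {e'\<in>E. \<kappa> (s e') = \<kappa> (s e)} s t"
        using conn_fibre [of "s e" v E s t \<kappa>] \<kappa> by blast
      moreover have "{e'\<in>E. \<kappa> (s e') = \<kappa> (s e)} = K k" using e by (simp add: K_def)
      ultimately have "(s e, v) \<in> conn (K k) s t" by simp
      then show "v \<in> s ` K k \<union> t ` K k" by (rule conn_closed) (use e in auto)
    qed
  qed
  have "\<exists>l. \<forall>w\<in>{v\<in>V. \<kappa> v = k}. \<exists>g. \<forall>h. bd (K k) s t (\<lambda>e. of_bool (l e = h) :: bit) w =
    of_bool (g = h) + of_bool (g + b w = h)" if k: "K k \<noteq> {}" for k
    unfolding T [OF k, symmetric]
  proof (rule euler_labels)
    show "finite (K k)" using fin K_sub finite_subset by blast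
    show "bd (K k) s t (\<lambda>_. 1::bit) v = 0" for v
    proof (cases "\<kappa> v = k")
      case True
      then show ?thesis using K_bd [of "\<lambda>_. 1" v] even [of v] by simp
    next
      case False
      then have "v \<notin> s ` K k \<union> t ` K k" unfolding T [OF k] by simp
      then show ?thesis by (intro bd_untouched) auto
    qed
    show "(u, v) \<in> conn (K k) s t" if "u \<in> s ` K k \<union> t ` K k" "v \<in> s ` K k \<union> t ` K k" for u v
    proof -
      have uv: "u \<in> V" "v \<in> V" "\<kappa> u = k" "\<kappa> v = k" using that unfolding T [OF k] by auto
      then have "(u, v) \<in> conn {e\<in>E. \<kappa> (s e) = \<kappa> u} s t"
        using conn_fibre [of u v E s t \<kappa>] \<kappa> conn by simp
      then show ?thesis using uv(3) by (simp add: K_def)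
    qed
    show "sum b (s ` K k \<union> t ` K k) = 0" unfolding T [OF k] by (rule b)
  qed (rule k)
  then have "\<forall>k. \<exists>l. K k \<noteq> {} \<longrightarrow> (\<forall>w\<in>{v\<in>V. \<kappa> v = k}. \<exists>g. \<forall>h.
      bd (K k) s t (\<lambda>e. of_bool (l e = h) :: bit) w = of_bool (g = h) + of_bool (g + b w = h))"
    by blast
  from choice [OF this] obtain L where L: "\<forall>k. K k \<noteq> {} \<longrightarrow> (\<forall>w\<in>{v\<in>V. \<kappa> v = k}. \<exists>g. \<forall>h.
      bd (K k) s t (\<lambda>e. of_bool (L k e = h) :: bit) w = of_bool (g = h) + of_bool (g + b w = h))"
    by blast
  let ?l = "\<lambda>e. L (\<kappa> (s e)) e"
  have "\<exists>g. \<forall>h. bd E s t (\<lambda>e. of_bool (?l e = h) :: bit) w = of_bool (g = h) + of_bool (g + b w = h)"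
    if w: "w \<in> V" for w
  proof (cases "K (\<kappa> w) = {}")
    \<comment> \<open>A component without edges is a single vertex, so its zero sum says
      \<open>b w = 0\<close> and both sides vanish.\<close>
    case True
    have "w \<notin> s ` E \<union> t ` E" using True \<kappa> by (auto simp: K_def)
    then have un: "w \<notin> s ` E" "w \<notin> t ` E" by auto
    have "v = w" if "v \<in> V" "\<kappa> v = \<kappa> w" for v
    proof -
      have "(w, v) \<in> conn E s t" using conn [of w v] that w by simp
      then have "v \<in> {w}" by (rule conn_closed) (use un in auto)
      then show ?thesis by simp
    qed
    then have "{v\<in>V. \<kappa> v = \<kappa> w} = {w}" using w by auto
    then have "b w = 0" using b [of "\<kappa> w"] by simp
    then show ?thesis by (simp add: bd_untouched [OF un])
  next
    case False
    then obtain g where g: "\<forall>h. bd (K (\<kappa> w)) s t (\<lambda>e. of_bool (L (\<kappa> w) e = h) :: bit) w =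
      of_bool (g = h) + of_bool (g + b w = h)" using L w by blast
    have "bd (K (\<kappa> w)) s t (\<lambda>e. of_bool (?l e = h) :: bit) w =
      bd (K (\<kappa> w)) s t (\<lambda>e. of_bool (L (\<kappa> w) e = h)) w" for h
      by (rule bd_cong) (auto simp: K_def)
    then show ?thesis using g unfolding K_bd by (intro exI [of _ g]) simp
  qed
  then show ?thesis by (intro exI [of _ ?l]) blast
qed

text \<open>A T-join: add up walks from a root \<open>r\<close> to all vertices with prescribed
  parity one. Their number is even, so the contributions at \<open>r\<close> cancel.\<close>

lemma even_join:
  fixes \<delta> :: "'v \<Rightarrow> bit"
  assumes fin: "finite V" "finite E"
    and conn: "\<And>a b. a \<in> s ` E \<union> t ` E \<Longrightarrow> b \<in> s ` E \<union> t ` E \<Longrightarrow> (a, b) \<in> conn E s t"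
    and supp: "\<And>v. v \<in> V \<Longrightarrow> \<delta> v \<noteq> 0 \<Longrightarrow> v \<in> s ` E \<union> t ` E"
    and even: "sum \<delta> V = 0"
  shows "\<exists>J::'e \<Rightarrow> bit. \<forall>v\<in>V. bd E s t J v = \<delta> v"
proof (cases "\<exists>r\<in>V. \<delta> r \<noteq> 0")
  case False
  then show ?thesis by (intro exI [of _ "\<lambda>_. 0"]) auto
next
  case True
  then obtain r where r: "r \<in> V" "\<delta> r \<noteq> 0" by blast
  define D where "D = {v\<in>V. \<delta> v \<noteq> 0}"
  have "\<exists>c::'e \<Rightarrow> bit. \<forall>w. bd E s t c w = of_bool (w = r) + of_bool (w = v)" if "v \<in> D" for v
    using conn_chain [OF conn fin(2), of r v] supp r that unfolding D_def by blast
  then obtain c :: "'v \<Rightarrow> 'e \<Rightarrow> bit"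
    where c: "\<And>v w. v \<in> D \<Longrightarrow> bd E s t (c v) w = of_bool (w = r) + of_bool (w = v)" by metis
  have finD: "finite D" using fin by (simp add: D_def)
  have \<delta>: "\<delta> v = of_bool (v \<in> D)" if "v \<in> V" for v
    using that by (cases "\<delta> v") (auto simp: D_def)
  have "sum \<delta> V = (\<Sum>v\<in>D. 1)"
    unfolding D_def by (rule sum.mono_neutral_cong_right) (use fin \<delta> in \<open>auto simp: D_def\<close>)
  then have D0: "(\<Sum>v\<in>D. 1::bit) = 0" using even by simp
  have "bd E s t (\<lambda>e. \<Sum>v\<in>D. c v e) w = \<delta> w" if "w \<in> V" for w
  proof -
    have "bd E s t (\<lambda>e. \<Sum>v\<in>D. c v e) w = (\<Sum>v\<in>D. of_bool (w = r) + of_bool (w = v))"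
      unfolding bd_sum_fun [OF finD] by (rule sum.cong) (use c in auto)
    also have "\<dots> = of_bool (w = r) * (\<Sum>v\<in>D. 1) + (\<Sum>v\<in>D. of_bool (w = v))"
      by (simp only: sum.distrib sum_distrib_left mult_1_right)
    also have "(\<Sum>v\<in>D. of_bool (w = v)) = (of_bool (w \<in> D) :: bit)"
      using finD by (simp add: of_bool_def)
    finally show ?thesis using D0 \<delta> [OF that] by simp
  qed
  then show ?thesis by blast
qed

lemma card_UNIV_klein: "card (UNIV :: (bit \<times> bit) set) = 4"
proof -
  have "x \<in> {(0, 0), (0, 1), (1, 0), (1, 1)}" for x :: "bit \<times> bit"
    by (cases x; cases "fst x"; cases "snd x") auto
  then have eq: "(UNIV :: (bit \<times> bit) set) = {(0, 0), (0, 1), (1, 0), (1, 1)}" by blast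
  show ?thesis unfolding eq by simp
qed

text \<open>Back in the graph itself the flow has a boundary \<open>b\<close> whose sum over every
  component of \<open>C\<close> is zero, so \<open>C\<close> can be labelled to match it. If each
  \<open>T\<close>-edge gets \<open>{0, \<phi> e}\<close>, the error \<open>D h w\<close> does not
  depend on \<open>h\<close>; complementing the labels along a T-join for \<open>D 0\<close> then
  corrects all four classes simultaneously.\<close>

lemma lift_flow:
  assumes fin: "finite V" "finite ET" "finite EC" and disj: "ET \<inter> EC = {}"
    and ends: "s ` (ET \<union> EC) \<subseteq> V" "t ` (ET \<union> EC) \<subseteq> V"
    and even: "\<And>v. bd EC s t (\<lambda>_. 1::bit) v = 0"
    and \<kappa>: "\<And>e. e \<in> EC \<Longrightarrow> \<kappa> (s e) = \<kappa> (t e)"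
    and conn: "\<And>u v. u \<in> V \<Longrightarrow> v \<in> V \<Longrightarrow> \<kappa> u = \<kappa> v \<Longrightarrow> (u, v) \<in> conn EC s t"
    and connT: "\<And>a b. a \<in> s ` ET \<union> t ` ET \<Longrightarrow> b \<in> s ` ET \<union> t ` ET \<Longrightarrow> (a, b) \<in> conn ET s t"
    and nz: "klein_flow ET (\<kappa> \<circ> s) (\<kappa> \<circ> t)"
  shows "\<exists>M :: 'e \<Rightarrow> (bit \<times> bit) set. (\<forall>e\<in>ET. card (M e) = 2) \<and> (\<forall>e\<in>EC. card (M e) = 1) \<and>
    (\<forall>h v. bd (ET \<union> EC) s t (\<lambda>e. of_bool (h \<in> M e) :: bit) v = 0)"
proof -
  obtain \<phi> :: "'e \<Rightarrow> bit \<times> bit" where \<phi>: "\<And>e. e \<in> ET \<Longrightarrow> \<phi> e \<noteq> 0"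
    "\<And>k. bd ET (\<kappa> \<circ> s) (\<kappa> \<circ> t) \<phi> k = 0" using nz unfolding klein_flow_def by blast
  define b where "b = bd ET s t \<phi>"
  have endsT: "s ` ET \<subseteq> V" "t ` ET \<subseteq> V" and endsC: "s ` EC \<subseteq> V" "t ` EC \<subseteq> V" using ends by auto
  have bk: "sum b {v\<in>V. \<kappa> v = k} = 0" for k
    using \<phi>(2) [of k] bd_map [OF fin(1) endsT, of \<kappa> \<phi> k] by (simp add: b_def)
  obtain l where l: "\<And>w. w \<in> V \<Longrightarrow> \<exists>g. \<forall>h. bd EC s t (\<lambda>e. of_bool (l e = h) :: bit) w =
      of_bool (g = h) + of_bool (g + b w = h)"
    using component_labels [OF fin(1,3) endsC even \<kappa> conn bk] by blast
  define D where "D h w = bd EC s t (\<lambda>e. of_bool (l e = h) :: bit) w +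
      bd ET s t (\<lambda>e. of_bool (h \<in> {0, \<phi> e}) :: bit) w" for h w
  define n where "n h w = bd ET s t (\<lambda>e. of_bool (\<phi> e = h) :: bit) w" for h w
  have \<phi>_cases: "\<phi> e = (1, 0) \<or> \<phi> e = (0, 1) \<or> \<phi> e = (1, 1)" if "e \<in> ET" for e
  proof -
    obtain x y where "\<phi> e = (x, y)" by fastforce
    then show ?thesis using \<phi>(1) [OF that] by (cases x; cases y) (auto simp: zero_prod_def)
  qed
  \<comment> \<open>Class \<open>0\<close> receives every \<open>T\<close>-edge at \<open>w\<close>,
    class \<open>h\<close> only those of value \<open>h\<close>. All terms are functions of the
    parities \<open>n\<close> of the three nonzero values and of the two bits of \<open>g\<close>,
    so a finite check settles each \<open>h\<close>.\<close>
  have D_const: "D h w = D 0 w" if w: "w \<in> V" for h w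
  proof -
    have "fst (b w) = bd ET s t (\<lambda>e. fst (\<phi> e)) w"
      unfolding b_def by (rule bd_hom) auto
    also have "\<dots> = bd ET s t (\<lambda>e. of_bool (\<phi> e = (1, 0)) + of_bool (\<phi> e = (1, 1))) w"
    proof (rule bd_cong)
      fix e assume "e \<in> ET"
      then show "fst (\<phi> e) = of_bool (\<phi> e = (1, 0)) + of_bool (\<phi> e = (1, 1))"
        using \<phi>_cases [of e] by auto
    qed
    finally have b1: "fst (b w) = n (1, 0) w + n (1, 1) w" unfolding bd_add by (simp add: n_def)
    have "snd (b w) = bd ET s t (\<lambda>e. snd (\<phi> e)) w"
      unfolding b_def by (rule bd_hom) auto
    also have "\<dots> = bd ET s t (\<lambda>e. of_bool (\<phi> e = (0, 1)) + of_bool (\<phi> e = (1, 1))) w"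
    proof (rule bd_cong)
      fix e assume "e \<in> ET"
      then show "snd (\<phi> e) = of_bool (\<phi> e = (0, 1)) + of_bool (\<phi> e = (1, 1))"
        using \<phi>_cases [of e] by auto
    qed
    finally have b2: "snd (b w) = n (0, 1) w + n (1, 1) w" unfolding bd_add by (simp add: n_def)
    have "bd ET s t (\<lambda>e. of_bool (0 \<in> {0, \<phi> e}) :: bit) w =
        bd ET s t (\<lambda>e. of_bool (\<phi> e = (1, 0)) + (of_bool (\<phi> e = (0, 1)) + of_bool (\<phi> e = (1, 1)))) w"
      by (rule bd_cong) (use \<phi>_cases in auto)
    then have N0: "bd ET s t (\<lambda>e. of_bool (0 \<in> {0, \<phi> e}) :: bit) w = n (1, 0) w + (n (0, 1) w + n (1, 1) w)"
      unfolding bd_add n_def .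
    have N: "bd ET s t (\<lambda>e. of_bool (h \<in> {0, \<phi> e}) :: bit) w = n h w" if "h \<noteq> 0" for h
      unfolding n_def by (rule bd_cong) (use that in auto)
    obtain g where g: "\<forall>h. bd EC s t (\<lambda>e. of_bool (l e = h) :: bit) w =
        of_bool (g = h) + of_bool (g + b w = h)" using l [OF w] by blast
    obtain g1 g2 where g12: "g = (g1, g2)" by fastforce
    have bw: "b w = (n (1, 0) w + n (1, 1) w, n (0, 1) w + n (1, 1) w)"
      using b1 b2 by (metis prod.collapse)
    have D0: "D 0 w = of_bool (g = 0) + of_bool (g + b w = 0) + (n (1, 0) w + (n (0, 1) w + n (1, 1) w))"
      unfolding D_def N0 g [rule_format] ..
    show ?thesis
    proof (cases "h = 0")
      case False
      have Dh: "D h w = of_bool (g = h) + of_bool (g + b w = h) + n h w"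
        unfolding D_def N [OF False] g [rule_format] ..
      have "h = (1, 0) \<or> h = (0, 1) \<or> h = (1, 1)"
        using False by (cases h; cases "fst h"; cases "snd h") (auto simp: zero_prod_def)
      then show ?thesis
        unfolding Dh D0 g12 bw
        by (elim disjE; cases "n (1, 0) w"; cases "n (0, 1) w"; cases "n (1, 1) w"; cases g1; cases g2)
          (simp_all add: zero_prod_def)
    qed simp
  qed
  have "\<exists>J::'e \<Rightarrow> bit. \<forall>v\<in>V. bd ET s t J v = D 0 v"
  proof (rule even_join [OF fin(1,2) connT])
    fix v assume v: "v \<in> V" "D 0 v \<noteq> 0"
    show "v \<in> s ` ET \<union> t ` ET"
    proof (rule ccontr)
      assume "v \<notin> s ` ET \<union> t ` ET"
      then have un: "bd ET s t x v = 0" for x :: "'e \<Rightarrow> 'z::comm_monoid_add" by (intro bd_untouched) auto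
      then have "b v = 0" by (simp add: b_def)
      obtain g where "\<forall>h. bd EC s t (\<lambda>e. of_bool (l e = h) :: bit) v =
          of_bool (g = h) + of_bool (g + b v = h)" using l [OF v(1)] by blast
      then have "bd EC s t (\<lambda>e. of_bool (l e = 0) :: bit) v = of_bool (g = 0) + of_bool (g + b v = 0)"
        by (rule spec)
      then have "bd EC s t (\<lambda>e. of_bool (l e = 0) :: bit) v = 0" using \<open>b v = 0\<close> by simp
      then show False using v(2) unfolding D_def un by simp
    qed
  next
    have "(\<Sum>v\<in>V. bd EC s t (\<lambda>e. of_bool (l e = 0) :: bit) v) = 0"
      by (rule sum_bd_all) (use fin endsC in auto)
    moreover have "(\<Sum>v\<in>V. bd ET s t (\<lambda>e. of_bool (0 \<in> {0, \<phi> e}) :: bit) v) = 0"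
      by (rule sum_bd_all) (use fin endsT in auto)
    ultimately show "sum (D 0) V = 0" unfolding D_def sum.distrib by simp
  qed
  then obtain J :: "'e \<Rightarrow> bit" where J: "\<And>v. v \<in> V \<Longrightarrow> bd ET s t J v = D 0 v" by blast
  \<comment> \<open>In a group with four elements the complement of a pair is again a pair, and
    complementing changes membership in every class.\<close>
  define M where "M e = (if e \<in> EC then {l e} else if J e = 0 then {0, \<phi> e} else - {0, \<phi> e})" for e
  have "card (M e) = 2" if "e \<in> ET" for e
  proof -
    have "card {0, \<phi> e} = 2" using \<phi>(1) [OF that] by auto
    moreover have "card (- {0, \<phi> e}) = card (UNIV :: (bit \<times> bit) set) - card {0, \<phi> e}"
      unfolding Compl_eq_Diff_UNIV by (rule card_Diff_subset) auto
    ultimately show ?thesis using that disj card_UNIV_klein by (auto simp: M_def)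
  qed
  moreover have "card (M e) = 1" if "e \<in> EC" for e using that by (simp add: M_def)
  moreover have "bd (ET \<union> EC) s t (\<lambda>e. of_bool (h \<in> M e) :: bit) v = 0" for h v
  proof (cases "v \<in> V")
    case True
    have "bd EC s t (\<lambda>e. of_bool (h \<in> M e) :: bit) v = bd EC s t (\<lambda>e. of_bool (l e = h)) v"
      by (rule bd_cong) (auto simp: M_def)
    moreover have "bd ET s t (\<lambda>e. of_bool (h \<in> M e) :: bit) v =
        bd ET s t (\<lambda>e. of_bool (h \<in> {0, \<phi> e}) + J e) v"
    proof (rule bd_cong)
      fix e assume "e \<in> ET"
      then show "of_bool (h \<in> M e) = (of_bool (h \<in> {0, \<phi> e}) + J e :: bit)"
        using disj by (cases "J e") (auto simp: M_def)
    qed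
    ultimately have "bd (ET \<union> EC) s t (\<lambda>e. of_bool (h \<in> M e) :: bit) v = D h v + D 0 v"
      unfolding bd_Un [OF fin(2,3) disj] bd_add J [OF True] D_def by (simp only: ac_simps)
    then show ?thesis unfolding D_const [OF True, of h] by simp
  next
    case False
    then show ?thesis using ends by (intro bd_untouched) auto
  qed
  ultimately show ?thesis by blast
qed

section \<open>A five-cycle double cover of the Petersen graph\<close>

text \<open>The two members of a 5-CDC of the Petersen graph that contain a given edge, found by
  search; arguments outside the table are never used.\<close>

definition pet_label :: "nat \<times> nat \<Rightarrow> nat set" where
  "pet_label p = the (map_of [
    ((0, 1), {0, 1}), ((0, 2), {0, 2}), ((0, 3), {1, 2}), ((1, 4), {0, 2}), ((2, 5), {0, 3}),
    ((3, 6), {1, 4}), ((1, 7), {1, 2}), ((2, 8), {2, 3}), ((3, 9), {2, 4}), ((4, 8), {2, 4}),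
    ((4, 9), {0, 4}), ((5, 7), {2, 3}), ((5, 9), {0, 2}), ((6, 7), {1, 3}), ((6, 8), {3, 4})] p)"

text \<open>The last conjunct is evenness of all classes of the table at \<open>u\<close>; the ten
  instances show that the table describes even subgraphs.\<close>

definition pet_vertex :: "nat \<Rightarrow> nat \<times> nat \<Rightarrow> nat \<times> nat \<Rightarrow> nat \<times> nat \<Rightarrow> bool" where
  "pet_vertex u p1 p2 p3 \<longleftrightarrow> {p\<in>petersen_edges. fst p = u \<or> snd p = u} = {p1, p2, p3} \<and> distinct [p1, p2, p3] \<and>
     (\<forall>k. of_bool (k \<in> pet_label p1) + of_bool (k \<in> pet_label p2) + of_bool (k \<in> pet_label p3) = (0::bit))"

lemma pet_label_simps:
  "pet_label (0, 1) = {0, 1}"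
  "pet_label (0, 2) = {0, 2}"
  "pet_label (0, 3) = {1, 2}"
  "pet_label (1, 4) = {0, 2}"
  "pet_label (2, 5) = {0, 3}"
  "pet_label (3, 6) = {1, 4}"
  "pet_label (1, 7) = {1, 2}"
  "pet_label (2, 8) = {2, 3}"
  "pet_label (3, 9) = {2, 4}"
  "pet_label (4, 8) = {2, 4}"
  "pet_label (4, 9) = {0, 4}"
  "pet_label (5, 7) = {2, 3}"
  "pet_label (5, 9) = {0, 2}"
  "pet_label (6, 7) = {1, 3}"
  "pet_label (6, 8) = {3, 4}"
  by (simp_all add: pet_label_def)

lemma of_bool_pairs:
  fixes k :: "'a"
  assumes "distinct [x, y, z]"
  shows "of_bool (k \<in> {x, y}) + of_bool (k \<in> {x, z}) + of_bool (k \<in> {y, z}) = (0::bit)"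
  using assms by (cases "k = x"; cases "k = y"; cases "k = z") simp_all

lemma pet_vertex:
  "pet_vertex 0 (0, 1) (0, 2) (0, 3)"
  "pet_vertex 1 (0, 1) (1, 4) (1, 7)"
  "pet_vertex 2 (0, 2) (2, 5) (2, 8)"
  "pet_vertex 3 (0, 3) (3, 6) (3, 9)"
  "pet_vertex 4 (1, 4) (4, 8) (4, 9)"
  "pet_vertex 5 (2, 5) (5, 7) (5, 9)"
  "pet_vertex 6 (3, 6) (6, 7) (6, 8)"
  "pet_vertex 7 (1, 7) (5, 7) (6, 7)"
  "pet_vertex 8 (2, 8) (4, 8) (6, 8)"
  "pet_vertex 9 (3, 9) (4, 9) (5, 9)"
proof -
  \<comment> \<open>At each vertex the three labels are the pairs from some triple
    \<open>x, y, z\<close>, so every class occurs there twice or not at all.\<close>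
  have I: "pet_vertex u p1 p2 p3"
    if "\<And>a b. (a, b) \<in> petersen_edges \<and> (a = u \<or> b = u) \<longleftrightarrow> (a, b) \<in> {p1, p2, p3}" "distinct [p1, p2, p3]"
      "pet_label p1 = {x, y}" "pet_label p2 = {x, z} \<and> pet_label p3 = {y, z} \<or>
        pet_label p2 = {y, z} \<and> pet_label p3 = {x, z}" "distinct [x, y, z]"
    for u p1 p2 p3 x y z
    unfolding pet_vertex_def
  proof (intro conjI allI)
    show "{p \<in> petersen_edges. fst p = u \<or> snd p = u} = {p1, p2, p3}"
      using that(1) by (intro set_eqI) (simp only: mem_Collect_eq split_paired_all fst_conv snd_conv)
    show "of_bool (k \<in> pet_label p1) + of_bool (k \<in> pet_label p2) + of_bool (k \<in> pet_label p3) = (0::bit)" for k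
      using that(3,4) of_bool_pairs [OF that(5), of k] by (elim disjE conjE) (simp_all only: ac_simps)
  qed (fact that(2))
  show "pet_vertex 0 (0, 1) (0, 2) (0, 3)"
    by (rule I [of _ _ _ _ 0 1 2]) (auto simp: petersen_edges_def pet_label_simps simp del: One_nat_def)
  show "pet_vertex 1 (0, 1) (1, 4) (1, 7)"
    by (rule I [of _ _ _ _ 0 1 2]) (auto simp: petersen_edges_def pet_label_simps simp del: One_nat_def)
  show "pet_vertex 2 (0, 2) (2, 5) (2, 8)"
    by (rule I [of _ _ _ _ 0 2 3]) (auto simp: petersen_edges_def pet_label_simps simp del: One_nat_def)
  show "pet_vertex 3 (0, 3) (3, 6) (3, 9)"
    by (rule I [of _ _ _ _ 1 2 4]) (auto simp: petersen_edges_def pet_label_simps simp del: One_nat_def)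
  show "pet_vertex 4 (1, 4) (4, 8) (4, 9)"
    by (rule I [of _ _ _ _ 0 2 4]) (auto simp: petersen_edges_def pet_label_simps simp del: One_nat_def)
  show "pet_vertex 5 (2, 5) (5, 7) (5, 9)"
    by (rule I [of _ _ _ _ 0 3 2]) (auto simp: petersen_edges_def pet_label_simps simp del: One_nat_def)
  show "pet_vertex 6 (3, 6) (6, 7) (6, 8)"
    by (rule I [of _ _ _ _ 1 4 3]) (auto simp: petersen_edges_def pet_label_simps simp del: One_nat_def)
  show "pet_vertex 7 (1, 7) (5, 7) (6, 7)"
    by (rule I [of _ _ _ _ 1 2 3]) (auto simp: petersen_edges_def pet_label_simps simp del: One_nat_def)
  show "pet_vertex 8 (2, 8) (4, 8) (6, 8)"
    by (rule I [of _ _ _ _ 2 3 4]) (auto simp: petersen_edges_def pet_label_simps simp del: One_nat_def)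
  show "pet_vertex 9 (3, 9) (4, 9) (5, 9)"
    by (rule I [of _ _ _ _ 2 4 0]) (auto simp: petersen_edges_def pet_label_simps simp del: One_nat_def)
qed

lemma pet_vertex_ex: "u < 10 \<Longrightarrow> \<exists>p1 p2 p3. pet_vertex u p1 p2 p3"
proof -
  assume "u < 10"
  then have "u \<in> {0, 1, 2, 3, 4, 5, 6, 7, 8, 9}" by auto
  then show ?thesis using pet_vertex by blast
qed

lemma pet_label: "p \<in> petersen_edges \<Longrightarrow> pet_label p \<subseteq> {..<5} \<and> card (pet_label p) = 2"
  unfolding petersen_edges_def by (elim insertE) (simp_all add: pet_label_simps del: One_nat_def)

text \<open>\<open>A3\<close> is the symmetric difference of \<open>A1\<close> and
  \<open>A2\<close>. As it has two elements, \<open>A1\<close> and \<open>A2\<close> share exactly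
  one, and the three pairs are the sides of a triangle.\<close>

lemma triangle_of_pairs:
  assumes card: "card A1 = 2" "card A2 = 2" "card A3 = 2"
    and even: "\<forall>k. of_bool (k \<in> A1) + of_bool (k \<in> A2) + of_bool (k \<in> A3) = (0::bit)"
  shows "\<exists>i j k. distinct [i, j, k] \<and> A1 = {i, j} \<and> A2 = {j, k} \<and> A3 = {i, k}"
proof -
  have A3: "x \<in> A3 \<longleftrightarrow> (x \<in> A1) \<noteq> (x \<in> A2)" for x
    using spec [OF even, of x] by (cases "x \<in> A1"; cases "x \<in> A2"; cases "x \<in> A3") simp_all
  obtain a b where A1: "A1 = {a, b}" "a \<noteq> b" using card(1) by (auto simp: card_2_iff)
  obtain c d where A2: "A2 = {c, d}" "c \<noteq> d" using card(2) by (auto simp: card_2_iff)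
  have "A3 = (A1 - A2) \<union> (A2 - A1)" using A3 by blast
  moreover have "card ((A1 - A2) \<union> (A2 - A1)) = card (A1 - A2) + card (A2 - A1)"
    by (rule card_Un_disjoint) (simp_all add: A1(1) A2(1), blast)
  ultimately have c2: "card (A1 - A2) + card (A2 - A1) = 2" using card(3) by simp
  have "a \<in> A2 \<longleftrightarrow> b \<notin> A2"
  proof -
    have "card (A1 - A2) = card A1 - card (A1 \<inter> A2)" "card (A2 - A1) = card A2 - card (A2 \<inter> A1)"
      by (rule card_Diff_subset_Int; simp add: A1(1) A2(1))+
    then have "card (A1 - A2) = 1" using c2 card by (simp add: Int_commute)
    then show ?thesis unfolding A1(1) using A1(2) 
      by (cases "a \<in> A2"; cases "b \<in> A2") (simp_all add: insert_Diff_if)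
  qed
  then consider "a \<notin> A2" "b \<in> A2" | "b \<notin> A2" "a \<in> A2" by blast
  then show ?thesis
  proof cases
    case 1
    define k where "k = (if b = c then d else c)"
    have k: "A2 = {b, k}" "k \<noteq> b" using 1 A2 by (auto simp: k_def)
    have "k \<noteq> a" using 1(1) k(1) by auto
    then have "A3 = {a, k}" using k(2) A1(2) unfolding set_eq_iff A3 unfolding A1(1) k(1) by auto
    then show ?thesis
      using A1 k \<open>k \<noteq> a\<close> by (intro exI [of _ a] exI [of _ b] exI [of _ k]) simp
  next
    case 2
    define k where "k = (if a = c then d else c)"
    have k: "A2 = {a, k}" "k \<noteq> a" using 2 A2 by (auto simp: k_def)
    have "k \<noteq> b" using 2(1) k(1) by auto
    then have "A3 = {b, k}" using k(2) A1(2) unfolding set_eq_iff A3 unfolding A1(1) k(1) by auto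
    then show ?thesis
      using A1 k \<open>k \<noteq> b\<close> by (intro exI [of _ b] exI [of _ a] exI [of _ k]) (simp add: insert_commute)
  qed
qed

lemma rename_triangle:
  fixes i j k :: "bit \<times> bit" and i' j' k' :: nat
  assumes "distinct [i, j, k]" "distinct [i', j', k']" "{i', j', k'} \<subseteq> {..<5}"
  shows "\<exists>\<sigma>. inj \<sigma> \<and> range \<sigma> \<subseteq> {..<5} \<and> \<sigma> i = i' \<and> \<sigma> j = j' \<and> \<sigma> k = k'"
proof -
  have "card ({..<5} - {i', j', k'}) = 2"
    using assms(2,3) by (subst card_Diff_subset) auto
  then have "{..<5} - {i', j', k'} \<noteq> {}" by force
  then obtain l' where l': "l' < 5" "l' \<notin> {i', j', k'}" by blast
  let ?\<sigma> = "\<lambda>x. if x = i then i' else if x = j then j' else if x = k then k' else l'"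
  have fin: "finite (UNIV :: (bit \<times> bit) set)"
    by (rule card_ge_0_finite) (simp add: card_UNIV_klein)
  have c3: "card {i, j, k} = 3" using assms(1) by simp
  then have "{i, j, k} \<noteq> UNIV" using card_UNIV_klein by (intro notI) simp
  then obtain l where l: "l \<notin> {i, j, k}" by blast
  have "card {l, i, j, k} = 4" using l assms(1) by simp
  then have U: "{l, i, j, k} = UNIV"
    by (intro card_subset_eq [OF fin]) (simp_all add: card_UNIV_klein)
  have "inj_on ?\<sigma> {l, i, j, k}"
    using assms(1,2) l l'(2) by (intro inj_onI) auto
  then have "inj ?\<sigma>" unfolding U .
  moreover have "range ?\<sigma> \<subseteq> {..<5}" using assms(3) l'(1) by auto
  ultimately show ?thesis using assms(1) by (intro exI [of _ ?\<sigma>]) auto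
qed

text \<open>Two even labellings of a three-edge cut by pairs are both triangles, so an injective
  renaming takes one to the other. This lets every local cover be adjusted to the fixed
  table.\<close>

lemma match_labels:
  fixes A1 A2 A3 :: "(bit \<times> bit) set" and B1 B2 B3 :: "nat set"
  assumes "card A1 = 2" "card A2 = 2" "card A3 = 2"
    "\<forall>k. of_bool (k \<in> A1) + of_bool (k \<in> A2) + of_bool (k \<in> A3) = (0::bit)"
    and "card B1 = 2" "card B2 = 2" "card B3 = 2"
    "\<forall>k. of_bool (k \<in> B1) + of_bool (k \<in> B2) + of_bool (k \<in> B3) = (0::bit)"
    and B: "B1 \<subseteq> {..<5}" "B2 \<subseteq> {..<5}"
  shows "\<exists>\<sigma>. inj \<sigma> \<and> range \<sigma> \<subseteq> {..<5} \<and> \<sigma> ` A1 = B1 \<and> \<sigma> ` A2 = B2 \<and> \<sigma> ` A3 = B3"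
proof -
  obtain i j k where A: "distinct [i, j, k]" "A1 = {i, j}" "A2 = {j, k}" "A3 = {i, k}"
    using triangle_of_pairs [OF assms(1-4)] by blast
  obtain i' j' k' where B': "distinct [i', j', k']" "B1 = {i', j'}" "B2 = {j', k'}" "B3 = {i', k'}"
    using triangle_of_pairs [OF assms(5-8)] by blast
  have "{i', j', k'} \<subseteq> {..<5}" using B B'(2,3) by auto
  then obtain \<sigma> where "inj \<sigma>" "range \<sigma> \<subseteq> {..<5}" "\<sigma> i = i'" "\<sigma> j = j'" "\<sigma> k = k'"
    using rename_triangle [OF A(1) B'(1)] by blast
  then show ?thesis unfolding A B' by (intro exI [of _ \<sigma>]) simp
qed

section \<open>Gluing local covers along the Petersen graph\<close>

lemma bd_cong_at:
  "(\<And>e. e \<in> E \<Longrightarrow> s e = v \<or> t e = v \<Longrightarrow> x e = y e) \<Longrightarrow> bd E s t x v = bd E s t y v"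
  unfolding bd_def by (rule sum.cong) auto

text \<open>The part of the cover inside a preimage \<open>Q\<close> of a vertex of the Petersen graph: collapsing the
  complement of \<open>Q\<close> leaves at most two special vertices, hence no contraction to the Petersen graph.\<close>

lemma local_cover:
  fixes V W Q :: "'v set" and ET EC :: "'e set"
  assumes fin: "finite V" "finite ET" "finite EC" and disj: "ET \<inter> EC = {}"
    and ends: "s ` (ET \<union> EC) \<subseteq> V" "t ` (ET \<union> EC) \<subseteq> V"
    and even: "\<And>v. bd EC s t (\<lambda>_. 1::bit) v = 0"
    and \<kappa>: "\<And>e. e \<in> EC \<Longrightarrow> \<kappa> (s e) = \<kappa> (t e)" and idem: "\<And>v. \<kappa> (\<kappa> v) = \<kappa> v"
    and conn: "\<And>u v. u \<in> V \<Longrightarrow> v \<in> V \<Longrightarrow> \<kappa> u = \<kappa> v \<Longrightarrow> (u, v) \<in> conn EC s t"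
    and connT: "\<And>a b. a \<in> s ` ET \<union> t ` ET \<Longrightarrow> b \<in> s ` ET \<union> t ` ET \<Longrightarrow> (a, b) \<in> conn ET s t"
    and forest: "forest ET (\<kappa> \<circ> s) (\<kappa> \<circ> t) W" and br: "bridgeless ET (\<kappa> \<circ> s) (\<kappa> \<circ> t)"
    and Q: "\<And>v. v \<in> Q \<longleftrightarrow> \<kappa> v \<in> Q" and w: "w \<notin> Q" and WQ: "finite (W \<inter> Q)" "card (W \<inter> Q) \<le> 1"
  shows "\<exists>M :: 'e \<Rightarrow> (bit \<times> bit) set. (\<forall>e\<in>ET. card (M e) = 2) \<and> (\<forall>e\<in>EC. card (M e) = 1) \<and>
    (\<forall>h. \<forall>v\<in>Q. bd (ET \<union> EC) s t (\<lambda>e. of_bool (h \<in> M e) :: bit) v = 0)"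
proof -
  define F where "F = collapse (- Q) w"
  have F_in: "F v = v" if "v \<in> Q" for v using that by (simp add: F_def collapse_def)
  have F_out: "F v = w" if "v \<notin> Q" for v using that by (simp add: F_def collapse_def)
  \<comment> \<open>\<open>Q\<close> is a union of fibres of \<open>\<kappa>\<close>, so collapsing
    its complement first does not affect the result. Hence \<open>F \<circ> \<kappa>\<close> can
    serve as the component map of the collapsed graph.\<close>
  have comm: "(F \<circ> \<kappa>) (F v) = F (\<kappa> v)" for v
  proof (cases "v \<in> Q")
    case False
    then show ?thesis using Q w by (metis F_out comp_apply)
  qed (simp add: F_in)
  then have comm': "(F \<circ> \<kappa>) \<circ> (F \<circ> g) = F \<circ> (\<kappa> \<circ> g)" for g :: "'e \<Rightarrow> 'v"
    by (simp add: fun_eq_iff)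
  let ?W = "insert w (W \<inter> Q)"
  have W: "finite ?W" "card ?W \<le> 2" using WQ card_insert_le_m1 [of 2 "W \<inter> Q" w] by auto
  have nz: "klein_flow ET ((F \<circ> \<kappa>) \<circ> (F \<circ> s)) ((F \<circ> \<kappa>) \<circ> (F \<circ> t))"
  proof -
    have "forest (ET - {}) (F \<circ> (\<kappa> \<circ> s)) (F \<circ> (\<kappa> \<circ> t)) ?W"
      unfolding F_def
      by (rule forest_collapse [OF forest fin(2)]) (use w in \<open>auto simp: collapse_def\<close>)
    moreover have "bridgeless (ET - {}) (F \<circ> (\<kappa> \<circ> s)) (F \<circ> (\<kappa> \<circ> t))"
      by (rule bridgeless_contract [OF br fin(2)]) auto
    ultimately have "klein_flow ET (F \<circ> (\<kappa> \<circ> s)) (F \<circ> (\<kappa> \<circ> t)) \<or>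
        petersen_contraction ET (F \<circ> (\<kappa> \<circ> s)) (F \<circ> (\<kappa> \<circ> t)) ?W"
      using flow_or_petersen [OF fin(2) W(1)] W(2) by simp
    \<comment> \<open>At most two special vertices, \<open>w\<close> and the one in
      \<open>Q\<close>, cannot have three images.\<close>
    moreover have "\<not> petersen_contraction ET (F \<circ> (\<kappa> \<circ> s)) (F \<circ> (\<kappa> \<circ> t)) ?W"
    proof
      assume "petersen_contraction ET (F \<circ> (\<kappa> \<circ> s)) (F \<circ> (\<kappa> \<circ> t)) ?W"
      then obtain f :: "'v \<Rightarrow> 'v" where "card (f ` ?W) = 3" unfolding petersen_contraction_def by blast
      then show False using card_image_le [OF W(1), of f] W(2) by linarith
    qed
    ultimately show ?thesis unfolding comm' by blast
  qed
  have "\<exists>M :: 'e \<Rightarrow> (bit \<times> bit) set. (\<forall>e\<in>ET. card (M e) = 2) \<and> (\<forall>e\<in>EC. card (M e) = 1) \<and>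
    (\<forall>h v. bd (ET \<union> EC) (F \<circ> s) (F \<circ> t) (\<lambda>e. of_bool (h \<in> M e) :: bit) v = 0)"
  proof (rule lift_flow [OF _ fin(2,3) disj _ _ _ _ _ _ nz])
    show "finite (F ` V)" using fin by simp
    show "(F \<circ> s) ` (ET \<union> EC) \<subseteq> F ` V" "(F \<circ> t) ` (ET \<union> EC) \<subseteq> F ` V"
      using ends by (auto simp: image_subset_iff)
    show "bd EC (F \<circ> s) (F \<circ> t) (\<lambda>_. 1::bit) v = 0" for v by (rule bd_map_zero [OF fin(3) even])
    show "(F \<circ> \<kappa>) ((F \<circ> s) e) = (F \<circ> \<kappa>) ((F \<circ> t) e)" if "e \<in> EC" for e
      using \<kappa> [OF that] comm [of "s e"] comm [of "t e"] by simp
    show "(u, v) \<in> conn EC (F \<circ> s) (F \<circ> t)" if uv: "u \<in> F ` V" "v \<in> F ` V" "(F \<circ> \<kappa>) u = (F \<circ> \<kappa>) v" for u v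
    proof -
      obtain u' v' where u': "u = F u'" "u' \<in> V" and v': "v = F v'" "v' \<in> V" using uv(1,2) by blast
      have eq: "F (\<kappa> u') = F (\<kappa> v')" using uv(3) comm [of u'] comm [of v'] u' v' by simp
      show ?thesis
      proof (cases "u' \<in> Q")
        case True
        then have "F (\<kappa> u') \<in> Q" using Q F_in by metis
        then have "\<kappa> v' \<in> Q" using eq F_out w by metis
        then have "\<kappa> u' = \<kappa> v'" using eq F_in True Q by metis
        then have "(u', v') \<in> conn EC s t" using conn u' v' by blast
        then show ?thesis unfolding u'(1) v'(1) by (rule conn_map)
      next
        case False
        then have "F (\<kappa> v') \<notin> Q" using Q F_out w eq by metis
        then have "v' \<notin> Q" using F_in Q by metis
        then show ?thesis using False u' v' F_out by simp
      qed
    qed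
    show "(a, b) \<in> conn ET (F \<circ> s) (F \<circ> t)"
      if ab: "a \<in> (F \<circ> s) ` ET \<union> (F \<circ> t) ` ET" "b \<in> (F \<circ> s) ` ET \<union> (F \<circ> t) ` ET" for a b
    proof -
      obtain a' b' where a': "a = F a'" "a' \<in> s ` ET \<union> t ` ET" and b': "b = F b'" "b' \<in> s ` ET \<union> t ` ET"
        using ab by auto
      show ?thesis unfolding a'(1) b'(1) by (rule conn_map [OF connT [OF a'(2) b'(2)]])
    qed
  qed
  then obtain M :: "'e \<Rightarrow> (bit \<times> bit) set" where M: "\<forall>e\<in>ET. card (M e) = 2" "\<forall>e\<in>EC. card (M e) = 1"
    "\<And>h v. bd (ET \<union> EC) (F \<circ> s) (F \<circ> t) (\<lambda>e. of_bool (h \<in> M e) :: bit) v = 0" by blast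
  \<comment> \<open>The collapse does not touch the edges' ends in \<open>Q\<close>, so evenness
    there holds for the original graph too; outside \<open>Q\<close> nothing is claimed.\<close>
  have "bd (ET \<union> EC) s t (\<lambda>e. of_bool (h \<in> M e) :: bit) v = 0" if "v \<in> Q" for h v
    using M(3) [of h v] bd_collapse [of w "- Q" v "ET \<union> EC" s t "\<lambda>e. of_bool (h \<in> M e) :: bit"] that w unfolding F_def by simp
  then show ?thesis using M by blast
qed

lemma sum_three: "distinct [a, b, c] \<Longrightarrow> sum x {a, b, c} = x a + x b + x c"
  by (simp add: add.assoc)

text \<open>Each vertex of the Petersen graph provides a labelling that is even on its preimage.
  Three edges leave the preimage, so after renaming their labels are those of
  \<open>pet_label\<close>. The local labellings then agree on the Petersen edges, and every edge
  can take its labels from either end.\<close>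

lemma petersen_cover:
  fixes V W :: "'v set" and ET EC :: "'e set"
  assumes fin: "finite V" "finite ET" "finite EC" and disj: "ET \<inter> EC = {}"
    and ends: "s ` (ET \<union> EC) \<subseteq> V" "t ` (ET \<union> EC) \<subseteq> V"
    and even: "\<And>v. bd EC s t (\<lambda>_. 1::bit) v = 0"
    and \<kappa>: "\<And>e. e \<in> EC \<Longrightarrow> \<kappa> (s e) = \<kappa> (t e)" and idem: "\<And>v. \<kappa> (\<kappa> v) = \<kappa> v"
    and conn: "\<And>u v. u \<in> V \<Longrightarrow> v \<in> V \<Longrightarrow> \<kappa> u = \<kappa> v \<Longrightarrow> (u, v) \<in> conn EC s t"
    and connT: "\<And>a b. a \<in> s ` ET \<union> t ` ET \<Longrightarrow> b \<in> s ` ET \<union> t ` ET \<Longrightarrow> (a, b) \<in> conn ET s t"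
    and forest: "forest ET (\<kappa> \<circ> s) (\<kappa> \<circ> t) W" and br: "bridgeless ET (\<kappa> \<circ> s) (\<kappa> \<circ> t)"
    and W: "finite W" "card W \<le> 3" "\<And>w. w \<in> W \<Longrightarrow> \<kappa> w = w"
    and E': "E' \<subseteq> ET" "\<And>e. e \<in> ET - E' \<Longrightarrow> f (\<kappa> (s e)) = f (\<kappa> (t e))" and fW: "card (f ` W) = 3"
    and g: "inj_on g {..<10}" and h: "bij_betw h petersen_edges E'"
    and link: "\<And>i j. (i, j) \<in> petersen_edges \<Longrightarrow> link (f \<circ> (\<kappa> \<circ> s)) (f \<circ> (\<kappa> \<circ> t)) (h (i, j)) (g i) (g j)"
    and onto: "\<And>v. v \<in> V \<Longrightarrow> f (\<kappa> v) \<in> g ` {..<10}"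
  shows "\<exists>M :: 'e \<Rightarrow> nat set. (\<forall>e\<in>ET. M e \<subseteq> {..<5} \<and> card (M e) = 2) \<and>
    (\<forall>e\<in>EC. M e \<subseteq> {..<5} \<and> card (M e) = 1) \<and>
    (\<forall>i v. bd (ET \<union> EC) s t (\<lambda>e. of_bool (i \<in> M e) :: bit) v = 0)"
proof -
  let ?E = "ET \<union> EC"
  define \<pi> where "\<pi> v = f (\<kappa> v)" for v
  \<comment> \<open>At most three special vertices with three images: hence no preimage contains two
    of them.\<close>
  have inj_W: "inj_on f W" using card_image_le [OF W(1), of f] W(2) fW
    by (intro eq_card_imp_inj_on [OF W(1)]) simp
  have hE: "h p \<in> E'" if "p \<in> petersen_edges" for p using h that by (auto simp: bij_betw_def)
  have lt: "fst p < 10 \<and> snd p < 10 \<and> fst p \<noteq> snd p" if "p \<in> petersen_edges" for p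
    using that unfolding petersen_edges_def by auto
  have \<pi>_h: "{\<pi> (s (h p)), \<pi> (t (h p))} = {g (fst p), g (snd p)}" if "p \<in> petersen_edges" for p
    using link [of "fst p" "snd p"] that by (simp add: link_def \<pi>_def)
  have \<pi>_other: "\<pi> (s e) = \<pi> (t e)" if "e \<in> ?E - E'" for e
    using that E'(2) \<kappa> disj unfolding \<pi>_def by auto
  define P where "P u M \<longleftrightarrow> (\<forall>e\<in>ET. M e \<subseteq> {..<5} \<and> card (M e) = 2) \<and>
    (\<forall>e\<in>EC. M e \<subseteq> {..<5} \<and> card (M e) = 1) \<and>
    (\<forall>i v. \<pi> v = g u \<longrightarrow> bd ?E s t (\<lambda>e. of_bool (i \<in> M e) :: bit) v = 0) \<and>
    (\<forall>p\<in>petersen_edges. fst p = u \<or> snd p = u \<longrightarrow> M (h p) = pet_label p)" for u and M :: "'e \<Rightarrow> nat set"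
  have local: "\<exists>M. P u M" if u: "u < 10" for u
  proof -
    define Q where "Q = {v. \<pi> v = g u}"
    obtain w where w: "w \<notin> Q"
    proof -
      have "\<exists>p\<in>petersen_edges. fst p \<noteq> u"
      proof (cases "u = 0")
        case True
        then show ?thesis by (intro bexI [of _ "(1, 4)"]) (simp_all add: petersen_edges_def)
      next
        case False
        then show ?thesis by (intro bexI [of _ "(0, 1)"]) (simp_all add: petersen_edges_def)
      qed
      then obtain p where p: "p \<in> petersen_edges" "fst p \<noteq> u" by blast
      then have "g (fst p) \<noteq> g u" using g lt [OF p(1)] u by (auto simp: inj_on_def)
      then have "s (h p) \<notin> Q \<or> t (h p) \<notin> Q" using \<pi>_h [OF p(1)] unfolding Q_def by auto
      then show thesis using that by blast
    qed
    have WQ: "card (W \<inter> Q) \<le> 1"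
    proof -
      have "x = y" if "x \<in> W \<inter> Q" "y \<in> W \<inter> Q" for x y
        using that inj_W W(3) unfolding Q_def \<pi>_def inj_on_def by auto
      then show ?thesis using W(1) by (simp add: card_le_Suc0_iff_eq)
    qed
    have "\<exists>M :: 'e \<Rightarrow> (bit \<times> bit) set. (\<forall>e\<in>ET. card (M e) = 2) \<and> (\<forall>e\<in>EC. card (M e) = 1) \<and>
      (\<forall>h. \<forall>v\<in>Q. bd ?E s t (\<lambda>e. of_bool (h \<in> M e) :: bit) v = 0)"
      by (rule local_cover [OF fin disj ends even \<kappa> idem conn connT forest br _ w])
        (use W(1) WQ in \<open>auto simp: Q_def \<pi>_def idem\<close>)
    then obtain M :: "'e \<Rightarrow> (bit \<times> bit) set" where M: "\<And>e. e \<in> ET \<Longrightarrow> card (M e) = 2"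
      "\<And>e. e \<in> EC \<Longrightarrow> card (M e) = 1"
      "\<And>k v. v \<in> Q \<Longrightarrow> bd ?E s t (\<lambda>e. of_bool (k \<in> M e) :: bit) v = 0" by blast
    obtain p1 p2 p3 where "pet_vertex u p1 p2 p3" using pet_vertex_ex [OF u] by blast
    then have inc: "{p\<in>petersen_edges. fst p = u \<or> snd p = u} = {p1, p2, p3}" and dp: "distinct [p1, p2, p3]"
      and lab: "\<forall>k. of_bool (k \<in> pet_label p1) + of_bool (k \<in> pet_label p2) + of_bool (k \<in> pet_label p3) = (0::bit)"
      unfolding pet_vertex_def by auto
    have pE: "p1 \<in> petersen_edges" "p2 \<in> petersen_edges" "p3 \<in> petersen_edges" using inc by blast+
    \<comment> \<open>The cut of the preimage consists of the three Petersen edges at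
      \<open>u\<close>; summing the evenness over \<open>V \<inter> Q\<close> shows that their
      labels are even.\<close>
    have cross: "{e\<in>?E. (s e \<in> V \<inter> Q) \<noteq> (t e \<in> V \<inter> Q)} = h ` {p1, p2, p3}"
    proof -
      have V: "s e \<in> V" "t e \<in> V" if "e \<in> ?E" for e using ends that by blast+
      have mem: "e \<in> h ` {p1, p2, p3} \<longleftrightarrow> (\<pi> (s e) = g u) \<noteq> (\<pi> (t e) = g u)" if e: "e \<in> ?E" for e
      proof (cases "e \<in> E'")
        case True
        then obtain p where p: "p \<in> petersen_edges" "e = h p" using h by (auto simp: bij_betw_def)
        have "h p \<in> h ` {p1, p2, p3} \<longleftrightarrow> p \<in> {p1, p2, p3}"
          by (rule inj_on_image_mem_iff [of h petersen_edges]) (use h p pE in \<open>auto simp: bij_betw_def\<close>)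
        also have "\<dots> \<longleftrightarrow> fst p = u \<or> snd p = u" unfolding inc [symmetric] using p by simp
        also have "\<dots> \<longleftrightarrow> (g (fst p) = g u) \<noteq> (g (snd p) = g u)"
          using g lt [OF p(1)] u by (auto simp: inj_on_def)
        also have "\<dots> \<longleftrightarrow> (\<pi> (s (h p)) = g u) \<noteq> (\<pi> (t (h p)) = g u)"
          using \<pi>_h [OF p(1)] by (auto simp: doubleton_eq_iff)
        finally show ?thesis unfolding p(2) .
      next
        case False
        have "e \<notin> h ` {p1, p2, p3}" using hE pE False by blast
        then show ?thesis using \<pi>_other [of e] e False by auto
      qed
      have sub: "h ` {p1, p2, p3} \<subseteq> ?E" using hE pE E'(1) by blast
      show ?thesis
      proof (rule set_eqI)
        fix e
        show "e \<in> {e\<in>?E. (s e \<in> V \<inter> Q) \<noteq> (t e \<in> V \<inter> Q)} \<longleftrightarrow> e \<in> h ` {p1, p2, p3}"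
        proof (cases "e \<in> ?E")
          case True
          then show ?thesis unfolding mem [OF True] Q_def using V [OF True] by simp
        next
          case False
          then show ?thesis using sub by blast
        qed
      qed
    qed
    have dh: "distinct [h p1, h p2, h p3]"
      using h dp pE by (auto simp: bij_betw_def inj_on_def)
    have sum0: "of_bool (k \<in> M (h p1)) + of_bool (k \<in> M (h p2)) + of_bool (k \<in> M (h p3)) = (0::bit)" for k
    proof -
      have "(\<Sum>e\<in>h ` {p1, p2, p3}. of_bool (k \<in> M e) :: bit) =
          (\<Sum>v\<in>V \<inter> Q. bd ?E s t (\<lambda>e. of_bool (k \<in> M e) :: bit) v)"
        unfolding cross [symmetric] by (rule sum_bd_cut [symmetric]) (use fin in auto)
      also have "\<dots> = 0" by (rule sum.neutral) (use M(3) in auto)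
      finally show ?thesis using sum_three [OF dh, of "\<lambda>e. of_bool (k \<in> M e) :: bit"] by simp
    qed
    have hT: "h p1 \<in> ET" "h p2 \<in> ET" "h p3 \<in> ET" using hE pE E'(1) by blast+
    have sum0': "\<forall>k. of_bool (k \<in> M (h p1)) + of_bool (k \<in> M (h p2)) + of_bool (k \<in> M (h p3)) = (0::bit)"
      using sum0 by (rule allI)
    note pl = pet_label [OF pE(1)] pet_label [OF pE(2)] pet_label [OF pE(3)]
    obtain \<sigma> where \<sigma>: "inj \<sigma>" "range \<sigma> \<subseteq> {..<5}" "\<sigma> ` M (h p1) = pet_label p1"
        "\<sigma> ` M (h p2) = pet_label p2" "\<sigma> ` M (h p3) = pet_label p3"
      using match_labels [OF M(1) [OF hT(1)] M(1) [OF hT(2)] M(1) [OF hT(3)] sum0'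
          conjunct2 [OF pl(1)] conjunct2 [OF pl(2)] conjunct2 [OF pl(3)] lab
          conjunct1 [OF pl(1)] conjunct1 [OF pl(2)]] by (elim exE conjE)
    have sub: "\<sigma> ` M e \<subseteq> {..<5}" for e using \<sigma>(2) by blast
    have card: "card (\<sigma> ` M e) = card (M e)" for e
      by (rule card_image, rule inj_on_subset [OF \<sigma>(1)]) simp
    have flow: "bd ?E s t (\<lambda>e. of_bool (i \<in> \<sigma> ` M e) :: bit) v = 0" if "\<pi> v = g u" for i v
    proof (cases "i \<in> range \<sigma>")
      case True
      then obtain k where k: "i = \<sigma> k" by blast
      show ?thesis
        unfolding k inj_image_mem_iff [OF \<sigma>(1)] using M(3) that by (simp add: Q_def)
    next
      case False
      then have "i \<notin> \<sigma> ` M e" for e by blast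
      then show ?thesis by simp
    qed
    have "\<sigma> ` M (h p) = pet_label p" if "p \<in> petersen_edges" "fst p = u \<or> snd p = u" for p
    proof -
      have "p \<in> {p1, p2, p3}" unfolding inc [symmetric] using that by simp
      then show ?thesis using \<sigma>(3-5) by auto
    qed
    then have "P u (\<lambda>e. \<sigma> ` M e)" unfolding P_def using sub card flow M(1,2) by simp
    then show ?thesis by (rule exI [of "P u"])
  qed
  then have "\<forall>u. \<exists>M. u < 10 \<longrightarrow> P u M" by blast
  from choice [OF this] obtain N where N: "\<And>u. u < 10 \<Longrightarrow> P u (N u)" by blast
  have N2: "N u e \<subseteq> {..<5} \<and> card (N u e) = 2" if "u < 10" "e \<in> ET" for u e
    using N [OF that(1)] that(2) unfolding P_def by blast
  have N1: "N u e \<subseteq> {..<5} \<and> card (N u e) = 1" if "u < 10" "e \<in> EC" for u e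
    using N [OF that(1)] that(2) unfolding P_def by blast
  have N0: "bd ?E s t (\<lambda>e. of_bool (i \<in> N u e) :: bit) v = 0" if "u < 10" "\<pi> v = g u" for u i v
    using N [OF that(1)] that(2) unfolding P_def by blast
  have Np: "N u (h p) = pet_label p" if "u < 10" "p \<in> petersen_edges" "fst p = u \<or> snd p = u" for u p
    using N [OF that(1)] that(2,3) unfolding P_def by blast
  define idx where "idx v = inv_into {..<10} g (\<pi> v)" for v
  have idx: "idx v < 10 \<and> g (idx v) = \<pi> v" if "v \<in> V" for v
    using inv_into_into [of "\<pi> v" g "{..<10}"] f_inv_into_f [of "\<pi> v" g "{..<10}"] onto [OF that]
    unfolding idx_def \<pi>_def by simp
  \<comment> \<open>Choosing the end \<open>s e\<close> is harmless: \<open>at\<close> shows that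
    the other end gives the same labels, by the table for Petersen edges and because both ends lie
    in one preimage otherwise.\<close>
  define M where "M e = N (idx (s e)) e" for e
  have sV: "s e \<in> V" "t e \<in> V" if "e \<in> ?E" for e using ends that by blast+
  have at: "M e = N (idx v) e" if e: "e \<in> ?E" "s e = v \<or> t e = v" for e v
  proof (cases "e \<in> E'")
    case True
    then obtain p where p: "p \<in> petersen_edges" "e = h p" using h by (auto simp: bij_betw_def)
    have *: "fst p = idx x \<or> snd p = idx x" if x: "x = s e \<or> x = t e" for x
    proof -
      have "x \<in> V" using x sV [OF e(1)] by blast
      then have i: "idx x < 10" "g (idx x) = \<pi> x" using idx by blast+
      have "\<pi> x \<in> {g (fst p), g (snd p)}" using x \<pi>_h [OF p(1)] p(2) by blast
      then have "g (idx x) = g (fst p) \<or> g (idx x) = g (snd p)" using i(2) by simp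
      then show ?thesis using g i(1) lt [OF p(1)] unfolding inj_on_def by (metis lessThan_iff)
    qed
    have "N (idx x) e = pet_label p" if x: "x = s e \<or> x = t e" for x
      unfolding p(2) using Np [of "idx x" p] idx [of x] sV [OF e(1)] x * [OF x] p(1) by blast
    then show ?thesis unfolding M_def using e(2) by blast
  next
    case False
    then have "\<pi> (s e) = \<pi> (t e)" using \<pi>_other e(1) by blast
    then have "idx (s e) = idx v" using e(2) unfolding idx_def by auto
    then show ?thesis by (simp add: M_def)
  qed
  have "bd ?E s t (\<lambda>e. of_bool (i \<in> M e) :: bit) v = 0" for i v
  proof (cases "v \<in> V")
    case True
    have "bd ?E s t (\<lambda>e. of_bool (i \<in> M e) :: bit) v = bd ?E s t (\<lambda>e. of_bool (i \<in> N (idx v) e)) v"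
      by (rule bd_cong_at) (use at in simp)
    also have "\<dots> = 0" using N0 idx [OF True] by simp
    finally show ?thesis .
  next
    case False
    then show ?thesis using ends by (intro bd_untouched) auto
  qed
  moreover have "M e \<subseteq> {..<5} \<and> card (M e) = 2" if "e \<in> ET" for e
    using N2 [of "idx (s e)" e] idx [of "s e"] sV [of e] that unfolding M_def by blast
  moreover have "M e \<subseteq> {..<5} \<and> card (M e) = 1" if "e \<in> EC" for e
    using N1 [of "idx (s e)" e] idx [of "s e"] sV [of e] that unfolding M_def by blast
  ultimately show ?thesis by blast
qed

section \<open>Multigraphs, trees and even edge sets\<close>

lemma of_nat_bit_eq_0_iff: "of_nat n = (0::bit) \<longleftrightarrow> even n"
  by (induction n) auto

text \<open>An arbitrary choice of first and second end, linking the set-valued \<open>ends\<close>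
  with the incidence functions used so far. One choice for \<open>G\<close> serves all its
  subgraphs.\<close>

definition oriented :: "('v, 'e) mgraph \<Rightarrow> ('e \<Rightarrow> 'v) \<Rightarrow> ('e \<Rightarrow> 'v) \<Rightarrow> bool" where
  "oriented G s t \<longleftrightarrow> finite (edges G) \<and> (\<forall>e\<in>edges G. ends G e = {s e, t e} \<and> s e \<noteq> t e)"

lemma oriented_ex:
  assumes "multigraph G"
  shows "\<exists>s t. oriented G s t"
proof -
  have "\<forall>e. \<exists>a b. e \<in> edges G \<longrightarrow> ends G e = {a, b} \<and> a \<noteq> b"
    using assms unfolding multigraph_def card_2_iff by blast
  from choice [OF this] obtain s
    where "\<forall>e. \<exists>b. e \<in> edges G \<longrightarrow> ends G e = {s e, b} \<and> s e \<noteq> b" by (rule exE)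
  from choice [OF this] obtain t
    where "\<forall>e. e \<in> edges G \<longrightarrow> ends G e = {s e, t e} \<and> s e \<noteq> t e" by (rule exE)
  then have "oriented G s t" using assms unfolding oriented_def multigraph_def by simp
  then show ?thesis by blast
qed

lemma oriented_subgraph: "oriented G s t \<Longrightarrow> subgraph H G \<Longrightarrow> oriented H s t"
  unfolding oriented_def subgraph_def by (metis (full_types) finite_subset subsetD)

lemma oriented_edges: "oriented G s t \<Longrightarrow> X \<subseteq> edges G \<Longrightarrow> oriented (G\<lparr>edges := X\<rparr>) s t"
  unfolding oriented_def by (auto intro: finite_subset)

lemma rtrancl_adj:
  assumes "oriented G s t"
  shows "(adj G)\<^sup>* = conn (edges G) s t"
proof -
  have "adj G = (\<Union>e\<in>edges G. {(s e, t e), (t e, s e)})"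
    using assms unfolding oriented_def adj_def by (force simp: doubleton_eq_iff)
  then show ?thesis by (simp add: conn_def)
qed

lemma joined_iff:
  "oriented G s t \<Longrightarrow> (u, v) \<in> joined G \<longleftrightarrow> u \<in> verts G \<and> v \<in> verts G \<and> (u, v) \<in> conn (edges G) s t"
  by (simp add: joined_def rtrancl_adj)

lemma equiv_joined: "oriented G s t \<Longrightarrow> equiv (verts G) (joined G)"
  unfolding equiv_def refl_on_def sym_def trans_def
  by (auto simp: joined_iff intro: conn_sym) (erule (1) conn_trans)

lemma even_degree_iff:
  assumes "oriented G s t"
  shows "even (degree G v) \<longleftrightarrow> bd (edges G) s t (\<lambda>_. 1::bit) v = 0"
proof -
  have "bd (edges G) s t (\<lambda>_. 1::bit) v = (\<Sum>e\<in>edges G. if v \<in> ends G e then 1 else 0)"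
    unfolding bd_def by (rule sum.cong) (use assms in \<open>auto simp: oriented_def\<close>)
  also have "\<dots> = (\<Sum>e\<in>{e\<in>edges G. v \<in> ends G e}. 1)"
    using assms by (subst sum.inter_filter) (auto simp: oriented_def)
  also have "\<dots> = of_nat (degree G v)" by (simp add: degree_def)
  finally show ?thesis by (simp add: of_nat_bit_eq_0_iff)
qed

lemma cycle_iff:
  assumes "oriented G s t" "\<And>e. e \<in> edges G \<Longrightarrow> ends G e \<subseteq> verts G"
  shows "cycle G \<longleftrightarrow> (\<forall>v. bd (edges G) s t (\<lambda>_. 1::bit) v = 0)"
proof -
  have "bd (edges G) s t (\<lambda>_. 1::bit) v = 0" if "v \<notin> verts G" for v
    using assms that unfolding oriented_def by (intro bd_untouched) auto
  then show ?thesis unfolding cycle_def using even_degree_iff [OF assms(1)] by blast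
qed

section \<open>Even edge sets in trees\<close>

lemma bd_indicator:
  assumes "finite E" "D \<subseteq> E"
  shows "bd E s t (\<lambda>e. of_bool (e \<in> D)) v = bd D s t (\<lambda>_. 1) v"
proof -
  have "bd E s t (\<lambda>e. of_bool (e \<in> D)) v = bd D s t (\<lambda>e. of_bool (e \<in> D)) v"
    by (rule bd_restrict) (use assms in auto)
  also have "\<dots> = bd D s t (\<lambda>_. 1) v" by (rule bd_cong) simp
  finally show ?thesis .
qed

text \<open>A nonempty even edge set that is minimal is a circuit: at a vertex \<open>v\<close>, two edges leading to
  the same component of the rest already close up to an even set.\<close>

lemma minimal_even_degree:
  assumes fin: "finite D" and loopless: "\<And>e. e \<in> D \<Longrightarrow> s e \<noteq> t e"
    and even: "\<And>v. bd D s t (\<lambda>_. 1::bit) v = 0"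
    and min: "\<And>D'. D' \<subseteq> D \<Longrightarrow> D' \<noteq> {} \<Longrightarrow> (\<And>v. bd D' s t (\<lambda>_. 1::bit) v = 0) \<Longrightarrow> D' = D"
    and v: "v \<in> s ` D \<union> t ` D"
  shows "card {e\<in>D. v \<in> {s e, t e}} = 2"
proof -
  let ?Dv = "{e\<in>D. v \<in> {s e, t e}}"
  let ?R = "D - ?Dv"
  obtain e1 u1 where e1: "e1 \<in> D" "link s t e1 v u1" using v unfolding link_iff by blast
  \<comment> \<open>The component of \<open>u1\<close> once the edges at \<open>v\<close> are
    removed. Only edges at \<open>v\<close> can leave it, and an even set crosses its cut evenly, so
    \<open>e1\<close> has a companion \<open>e2\<close> from \<open>v\<close> into
    \<open>U\<close>.\<close>
  define U where "U = {x. (u1, x) \<in> conn ?R s t}"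
  have finU: "finite U" unfolding U_def by (rule conn_finite) (use fin in simp)
  have "u1 \<noteq> v" using loopless [OF e1(1)] e1(2) by (auto simp: link_iff)
  have vU: "v \<notin> U"
  proof
    assume "v \<in> U"
    then have "(u1, v) \<in> conn ?R s t" by (simp add: U_def)
    then have "v \<in> - {v}" by (rule conn_closed) (use \<open>u1 \<noteq> v\<close> in auto)
    then show False by simp
  qed
  have U_step: "s e \<in> U \<longleftrightarrow> t e \<in> U" if "e \<in> ?R" for e
    using conn_step_iff [OF that] unfolding U_def by simp
  let ?X = "{e\<in>D. (s e \<in> U) \<noteq> (t e \<in> U)}"
  have "(\<Sum>e\<in>?X. 1::bit) = 0"
    using sum_bd_cut [OF finU fin, of s t "\<lambda>_. 1::bit"] even by simp
  then have "even (card ?X)" by (simp add: of_nat_bit_eq_0_iff)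
  moreover have "e1 \<in> ?X"
    using e1 vU by (auto simp: U_def link_iff)
  ultimately have "\<not> ?X \<subseteq> {e1}"
  proof (intro notI)
    assume "even (card ?X)" "e1 \<in> ?X" "?X \<subseteq> {e1}"
    then have "?X = {e1}" by blast
    then have "card ?X = 1" by simp
    then show False using \<open>even (card ?X)\<close> by simp
  qed
  then obtain e2 where e2: "e2 \<in> ?X" "e2 \<noteq> e1" by blast
  have "e2 \<in> ?Dv" using U_step [of e2] e2(1) by blast
  then obtain u2 where u2: "link s t e2 v u2" unfolding link_iff by blast
  then have "u2 \<in> U" using e2(1) vU by (auto simp: link_iff)
  then obtain c :: "'a \<Rightarrow> bit" where c: "\<And>e. c e \<noteq> 0 \<Longrightarrow> e \<in> ?R"
    "\<And>w. bd ?R s t c w = of_bool (w = u1) + of_bool (w = u2)"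
    using conn_chain [of u1 u2 ?R s t] fin unfolding U_def by auto
  define D' where "D' = {e. c e \<noteq> 0} \<union> {e1, e2}"
  have D'D: "D' \<subseteq> D" using c(1) e1 e2 by (auto simp: D'_def)
  have R: "e1 \<notin> ?R" "e2 \<notin> ?R" using e1 e2(1) u2 by (auto simp: link_iff)
  have c0: "c e1 = 0" "c e2 = 0" using c(1) R by blast+
  have "bd D' s t (\<lambda>_. 1::bit) w = 0" for w
  proof -
    have "bd D' s t (\<lambda>_. 1::bit) w = bd D s t (\<lambda>e. of_bool (e \<in> D')) w"
      by (rule bd_indicator [symmetric]) (use fin D'D in auto)
    also have "\<dots> = bd D s t (\<lambda>e. c e + of_bool (e \<in> {e1, e2})) w"
    proof (rule bd_cong)
      fix e
      show "of_bool (e \<in> D') = c e + of_bool (e \<in> {e1, e2})"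
        using c0 by (cases "c e") (auto simp: D'_def)
    qed
    also have "\<dots> = bd D s t c w + bd D s t (\<lambda>e. of_bool (e \<in> {e1, e2})) w" by (rule bd_add)
    also have "bd D s t (\<lambda>e. of_bool (e \<in> {e1, e2}) :: bit) w = bd {e1, e2} s t (\<lambda>_. 1) w"
      by (rule bd_indicator [OF fin]) (use e1 e2 in simp)
    also have "bd D s t c w = bd ?R s t c w"
    proof (rule bd_restrict [OF fin])
      show "c e = 0" if "e \<in> D - ?R" for e using c(1) [of e] that by blast
    qed auto
    also have "bd {e1, e2} s t (\<lambda>_. 1::bit) w = of_bool (w = u1) + of_bool (w = u2)"
      using e2(2) by (auto simp: bd_insert_link [OF _ _ e1(2)] bd_insert_link [OF _ _ u2])
    finally show ?thesis unfolding c(2) by simp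
  qed
  then have "D' = D" using min [OF D'D] by (auto simp: D'_def)
  moreover have "e \<notin> ?Dv" if "c e \<noteq> 0" for e using c(1) [OF that] by blast
  ultimately have "?Dv = {e1, e2}"
    using e1 e2(1) u2 \<open>e2 \<in> ?Dv\<close> by (auto simp: D'_def link_iff)
  then show ?thesis using e2(2) by simp
qed

text \<open>The edges of one component form an even set themselves, so by minimality there is only
  one component.\<close>

lemma minimal_even_connected:
  assumes fin: "finite D" and even: "\<And>v. bd D s t (\<lambda>_. 1::bit) v = 0"
    and min: "\<And>D'. D' \<subseteq> D \<Longrightarrow> D' \<noteq> {} \<Longrightarrow> (\<And>v. bd D' s t (\<lambda>_. 1::bit) v = 0) \<Longrightarrow> D' = D"
    and a: "a \<in> s ` D \<union> t ` D" and b: "b \<in> s ` D \<union> t ` D"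
  shows "(a, b) \<in> conn D s t"
proof -
  define U where "U = {x. (a, x) \<in> conn D s t}"
  have U_step: "s e \<in> U \<longleftrightarrow> t e \<in> U" if "e \<in> D" for e
    using conn_step_iff [OF that] unfolding U_def by simp
  have "a \<in> U" by (simp add: U_def)
  let ?D = "{e\<in>D. s e \<in> U}"
  have "?D = D"
  proof (rule min)
    show "?D \<noteq> {}" using a \<open>a \<in> U\<close> U_step by blast
    show "bd ?D s t (\<lambda>_. 1::bit) v = 0" for v
    proof (cases "v \<in> U")
      case True
      have "bd D s t (\<lambda>_. 1::bit) v = bd ?D s t (\<lambda>_. 1) v"
        unfolding bd_def by (rule sum.mono_neutral_right) (use fin True U_step in auto)
      then show ?thesis using even by simp
    next
      case False
      then show ?thesis using U_step by (intro bd_untouched) auto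
    qed
  qed auto
  then have "b \<in> U" using b U_step by blast
  then show ?thesis by (simp add: U_def)
qed

text \<open>A nonempty even set of least size, taken with the ends of its edges, would be a circuit
  in the tree.\<close>

lemma tree_no_even_set:
  assumes "tree T" and o: "oriented T s t" and sub: "\<And>e. e \<in> edges T \<Longrightarrow> ends T e \<subseteq> verts T"
    and D: "D \<subseteq> edges T" "\<And>v. bd D s t (\<lambda>_. 1::bit) v = 0"
  shows "D = {}"
proof (rule ccontr)
  assume "D \<noteq> {}"
  define P where "P D \<longleftrightarrow> D \<subseteq> edges T \<and> D \<noteq> {} \<and> (\<forall>v. bd D s t (\<lambda>_. 1::bit) v = 0)" for D
  have fT: "finite (edges T)" using o by (simp add: oriented_def)
  have "P D" using D \<open>D \<noteq> {}\<close> by (simp add: P_def)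
  then obtain Z where Z: "P Z" "\<And>D'. P D' \<Longrightarrow> card Z \<le> card D'"
    using ex_has_least_nat [of P D card] by blast
  have ZT: "Z \<subseteq> edges T" "Z \<noteq> {}" and even: "\<And>v. bd Z s t (\<lambda>_. 1::bit) v = 0"
    using Z(1) by (auto simp: P_def)
  have fZ: "finite Z" using ZT(1) fT finite_subset by blast
  have min: "D' = Z" if "D' \<subseteq> Z" "D' \<noteq> {}" "\<And>v. bd D' s t (\<lambda>_. 1::bit) v = 0" for D'
  proof (rule card_seteq [OF fZ that(1)])
    show "card Z \<le> card D'" by (rule Z(2)) (use that ZT(1) in \<open>auto simp: P_def\<close>)
  qed
  have ends: "ends T e = {s e, t e}" "s e \<noteq> t e" if "e \<in> Z" for e
    using o ZT(1) that by (auto simp: oriented_def)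
  define H where "H = T\<lparr>verts := s ` Z \<union> t ` Z, edges := Z\<rparr>"
  have oH: "oriented H s t" using o ZT(1) fZ by (auto simp: oriented_def H_def)
  have "subgraph H T"
    unfolding subgraph_def H_def using ZT(1) sub ends by fastforce
  moreover have "circuit H"
    unfolding circuit_def connected_def
  proof (intro conjI ballI)
    show "verts H \<noteq> {}" using ZT(2) by (simp add: H_def)
    fix u assume u: "u \<in> verts H"
    show "degree H u = 2"
    proof -
      have "{e \<in> edges H. u \<in> ends H e} = {e\<in>Z. u \<in> {s e, t e}}" using ends by (auto simp: H_def)
      moreover have "card {e\<in>Z. u \<in> {s e, t e}} = 2"
      proof (rule minimal_even_degree [OF fZ _ even])
        show "s e \<noteq> t e" if "e \<in> Z" for e using ends(2) that .
        show "D' = Z" if "D' \<subseteq> Z" "D' \<noteq> {}" "\<And>v. bd D' s t (\<lambda>_. 1::bit) v = 0" for D'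
          using that by (rule min)
        show "u \<in> s ` Z \<union> t ` Z" using u by (simp add: H_def)
      qed
      ultimately show ?thesis unfolding degree_def by simp
    qed
    fix v assume v: "v \<in> verts H"
    show "(u, v) \<in> joined H"
    proof -
      have "(u, v) \<in> conn Z s t"
      proof (rule minimal_even_connected [OF fZ even])
        show "D' = Z" if "D' \<subseteq> Z" "D' \<noteq> {}" "\<And>v. bd D' s t (\<lambda>_. 1::bit) v = 0" for D'
          using that by (rule min)
        show "u \<in> s ` Z \<union> t ` Z" "v \<in> s ` Z \<union> t ` Z" using u v by (simp_all add: H_def)
      qed
      then show ?thesis unfolding joined_iff [OF oH] using u v by (simp add: H_def)
    qed
  qed
  ultimately show False using \<open>tree T\<close> unfolding tree_def by blast
qed

section \<open>Contraction to the Petersen graph\<close>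

text \<open>The pairs are listed so that two of them are disjoint exactly when their positions are
  adjacent in \<open>petersen_edges\<close>.\<close>

definition kneser :: "nat \<Rightarrow> nat set" where
  "kneser i = [{0, 1}, {2, 3}, {2, 4}, {3, 4}, {1, 4}, {1, 3}, {1, 2}, {0, 4}, {0, 3}, {0, 2}] ! i"

lemma kneser_simps:
  "kneser 0 = {0, 1}" "kneser 1 = {2, 3}" "kneser 2 = {2, 4}" "kneser 3 = {3, 4}" "kneser 4 = {1, 4}"
  "kneser 5 = {1, 3}" "kneser 6 = {1, 2}" "kneser 7 = {0, 4}" "kneser 8 = {0, 3}" "kneser 9 = {0, 2}"
  by (simp_all add: kneser_def)

lemma lessThan_10: "{..<10} = {0, 1, 2, 3, 4, 5, 6, 7, 8, 9::nat}"
  by auto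

lemma kneser_range: "kneser ` {..<10} = {A. A \<subseteq> {..<5} \<and> card A = 2}"
proof
  show "kneser ` {..<10} \<subseteq> {A. A \<subseteq> {..<5} \<and> card A = 2}"
    unfolding lessThan_10 by (simp add: kneser_simps del: One_nat_def)
  show "{A. A \<subseteq> {..<5} \<and> card A = 2} \<subseteq> kneser ` {..<10}"
  proof
    fix A :: "nat set" assume A: "A \<in> {A. A \<subseteq> {..<5} \<and> card A = 2}"
    have "\<exists>x y. A = {x, y} \<and> x < y \<and> y < 5"
    proof -
      obtain x y where xy: "A = {x, y}" "x \<noteq> y" using A by (auto simp: card_2_iff)
      then have "x < 5" "y < 5" using A by auto
      moreover have "A = {y, x}" "x < y \<or> y < x" using xy by auto
      ultimately show ?thesis using xy(1) by blast
    qed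
    then obtain x y where xy: "A = {x, y}" "x < y" "y < 5" by blast
    have "(x, y) \<in> {(0, 1), (2, 3), (2, 4), (3, 4), (1, 4), (1, 3), (1, 2), (0, 4), (0, 3), (0, 2)}"
    proof -
      have "x \<in> {0, 1, 2, 3, 4}" "y \<in> {0, 1, 2, 3, 4}" using xy(2,3) by auto
      then show ?thesis using xy(2) by (elim insertE emptyE) simp_all
    qed
    then show "A \<in> kneser ` {..<10}"
      unfolding lessThan_10 xy(1) by (elim insertE emptyE) (simp_all add: kneser_simps del: One_nat_def)
  qed
qed

lemma kneser_inj: "inj_on kneser {..<10}"
proof (rule eq_card_imp_inj_on)
  have "card {A. A \<subseteq> {..<5::nat} \<and> card A = 2} = 5 choose 2"
    using n_subsets [of "{..<5::nat}" 2] by simp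
  then show "card (kneser ` {..<10}) = card {..<10::nat}"
    unfolding kneser_range by (simp add: choose_two)
qed simp

lemma kneser_disjoint:
  assumes "i < 10" "j < 10"
  shows "kneser i \<inter> kneser j = {} \<longleftrightarrow> (i, j) \<in> petersen_edges \<or> (j, i) \<in> petersen_edges"
proof -
  have "i \<in> {0, 1, 2, 3, 4, 5, 6, 7, 8, 9}" "j \<in> {0, 1, 2, 3, 4, 5, 6, 7, 8, 9}"
    using assms by auto
  then show ?thesis
    by (elim insertE emptyE) (simp_all add: kneser_simps petersen_edges_def del: One_nat_def)
qed

lemma petersen_edges_lt: "(i, j) \<in> petersen_edges \<Longrightarrow> i < 10 \<and> j < 10 \<and> i < j"
  by (auto simp: petersen_edges_def)

lemma verts_petersen: "verts petersen = kneser ` {..<10}"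
  unfolding kneser_range by (simp add: petersen_def Let_def)

lemma edges_petersen: "edges petersen = (\<lambda>(i, j). {kneser i, kneser j}) ` petersen_edges"
proof -
  have "edges petersen = {{A, B} | A B. A \<in> kneser ` {..<10} \<and> B \<in> kneser ` {..<10} \<and> A \<inter> B = {}}"
    unfolding kneser_range by (simp add: petersen_def Let_def)
  also have "\<dots> = (\<lambda>(i, j). {kneser i, kneser j}) ` petersen_edges"
  proof
    show "{{A, B} | A B. A \<in> kneser ` {..<10} \<and> B \<in> kneser ` {..<10} \<and> A \<inter> B = {}}
      \<subseteq> (\<lambda>(i, j). {kneser i, kneser j}) ` petersen_edges"
    proof
      fix X assume "X \<in> {{A, B} | A B. A \<in> kneser ` {..<10} \<and> B \<in> kneser ` {..<10} \<and> A \<inter> B = {}}"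
      then obtain i j where ij: "X = {kneser i, kneser j}" "i < 10" "j < 10" "kneser i \<inter> kneser j = {}"
        by blast
      then consider "(i, j) \<in> petersen_edges" | "(j, i) \<in> petersen_edges" using kneser_disjoint by blast
      then show "X \<in> (\<lambda>(i, j). {kneser i, kneser j}) ` petersen_edges"
      proof cases
        case 1
        then show ?thesis unfolding ij(1) by (intro image_eqI [of _ _ "(i, j)"]) auto
      next
        case 2
        then show ?thesis unfolding ij(1) by (intro image_eqI [of _ _ "(j, i)"]) auto
      qed
    qed
    show "(\<lambda>(i, j). {kneser i, kneser j}) ` petersen_edges
      \<subseteq> {{A, B} | A B. A \<in> kneser ` {..<10} \<and> B \<in> kneser ` {..<10} \<and> A \<inter> B = {}}"
    proof clarify
      fix i j assume ij: "(i, j) \<in> petersen_edges"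
      then have "i < 10" "j < 10" "kneser i \<inter> kneser j = {}"
        using petersen_edges_lt [OF ij] kneser_disjoint [of i j] by auto
      then show "\<exists>A B. {kneser i, kneser j} = {A, B} \<and> A \<in> kneser ` {..<10} \<and>
          B \<in> kneser ` {..<10} \<and> A \<inter> B = {}"
        by (intro exI [of _ "kneser i"] exI [of _ "kneser j"]) simp
    qed
  qed
  finally show ?thesis .
qed

lemma ends_petersen: "ends petersen e = e"
  by (simp add: petersen_def Let_def)

lemma inj_petersen_edges: "inj_on (\<lambda>(i, j). {kneser i, kneser j}) petersen_edges"
proof (rule inj_onI, clarify)
  fix i j i' j'
  assume p: "(i, j) \<in> petersen_edges" "(i', j') \<in> petersen_edges" "{kneser i, kneser j} = {kneser i', kneser j'}"
  have "kneser ` {i, j} = kneser ` {i', j'}" using p(3) by simp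
  then have "{i, j} = {i', j'}"
    using inj_on_image_eq_iff [OF kneser_inj, of "{i, j}" "{i', j'}"] petersen_edges_lt [OF p(1)] petersen_edges_lt [OF p(2)]
    by simp
  then show "i = i' \<and> j = j'" using petersen_edges_lt [OF p(1)] petersen_edges_lt [OF p(2)] by (auto simp: doubleton_eq_iff)
qed

text \<open>The fibres of \<open>\<pi>\<close> in \<open>verts G\<close> are the components of the
  contracted edge set, so a contracted vertex is known by its value under \<open>\<pi>\<close>, and
  the position of that value in \<open>g\<close> selects a vertex of the Kneser graph.\<close>

lemma contractibleI:
  fixes G :: "('v, 'e) mgraph" and g :: "nat \<Rightarrow> 'w"
  assumes G: "oriented G s t" "\<And>e. e \<in> edges G \<Longrightarrow> s e \<in> verts G \<and> t e \<in> verts G"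
    and E': "E' \<subseteq> edges G"
    and cls: "\<And>u v. u \<in> verts G \<Longrightarrow> v \<in> verts G \<Longrightarrow> \<pi> u = \<pi> v \<longleftrightarrow> (u, v) \<in> conn (edges G - E') s t"
    and onto: "\<pi> ` verts G \<subseteq> g ` {..<10}" and g: "inj_on g {..<10}" and h: "bij_betw h petersen_edges E'"
    and link: "\<And>i j. (i, j) \<in> petersen_edges \<Longrightarrow> {\<pi> (s (h (i, j))), \<pi> (t (h (i, j)))} = {g i, g j}"
  shows "contractible_to_petersen G"
proof -
  let ?X = "edges G - E'"
  let ?H = "G\<lparr>edges := ?X\<rparr>"
  have oH: "oriented ?H s t" using oriented_edges [OF G(1), of ?X] by blast
  have cl: "joined ?H `` {v} = {u\<in>verts G. \<pi> u = \<pi> v}" if "v \<in> verts G" for v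
    using that cls [OF that] by (auto simp: joined_iff [OF oH] eq_commute)
  define idx where "idx v = inv_into {..<10} g (\<pi> v)" for v
  have idx: "idx v < 10" "g (idx v) = \<pi> v" if "v \<in> verts G" for v
    using inv_into_into [of "\<pi> v" g "{..<10}"] f_inv_into_f [of "\<pi> v" g "{..<10}"] onto that
    unfolding idx_def by auto
  define F where "F K = kneser (inv_into {..<10} g (the_elem (\<pi> ` K)))" for K
  have F: "F (joined ?H `` {v}) = kneser (idx v)" if "v \<in> verts G" for v
  proof -
    have "\<pi> ` (joined ?H `` {v}) = {\<pi> v}" unfolding cl [OF that] using that by auto
    then show ?thesis by (simp add: F_def idx_def)
  qed
  have comps: "components ?H = (\<lambda>v. joined ?H `` {v}) ` verts G"
    by (auto simp: components_def quotient_def)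
  have F_bij: "bij_betw F (components ?H) (verts petersen)"
    unfolding bij_betw_def
  proof
    show "inj_on F (components ?H)"
      unfolding comps
    proof (rule inj_onI, clarify)
      fix u v assume uv: "u \<in> verts G" "v \<in> verts G" "F (joined ?H `` {u}) = F (joined ?H `` {v})"
      then have "kneser (idx u) = kneser (idx v)" using F by simp
      then have "idx u = idx v" using kneser_inj idx uv by (auto simp: inj_on_def)
      then have "\<pi> u = \<pi> v" using idx uv by metis
      then show "joined ?H `` {u} = joined ?H `` {v}" unfolding cl [OF uv(1)] cl [OF uv(2)] by simp
    qed
    have "F ` components ?H = kneser ` idx ` verts G"
      unfolding comps image_image by (rule image_cong) (auto simp: F)
    also have "idx ` verts G = {..<10}"
    proof
      show "idx ` verts G \<subseteq> {..<10}" using idx by auto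
      \<comment> \<open>No vertex of the Petersen graph is missed, since each is an end of some edge
        and that edge comes from \<open>G\<close>.\<close>
      show "{..<10} \<subseteq> idx ` verts G"
      proof
        fix i :: nat assume i: "i \<in> {..<10}"
        then obtain p1 p2 p3 where "pet_vertex i p1 p2 p3" using pet_vertex_ex by blast
        then have "p1 \<in> petersen_edges \<and> (fst p1 = i \<or> snd p1 = i)" unfolding pet_vertex_def by blast
        then obtain a b where ab: "(a, b) \<in> petersen_edges" "a = i \<or> b = i" by (cases p1) auto
        let ?e = "h (a, b)"
        have "?e \<in> edges G" using h ab(1) E' by (auto simp: bij_betw_def)
        then have V: "s ?e \<in> verts G" "t ?e \<in> verts G" using G(2) by blast+
        have "g i \<in> {\<pi> (s ?e), \<pi> (t ?e)}" unfolding link [OF ab(1)] using ab(2) by blast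
        then have "g i \<in> \<pi> ` verts G" using V by (elim insertE) simp_all
        then obtain v where v: "v \<in> verts G" "\<pi> v = g i" by (metis imageE)
        have "g (idx v) = g i" using idx(2) [OF v(1)] v(2) by (rule trans)
        then have "idx v = i" by (rule inj_onD [OF g]) (use idx(1) [OF v(1)] i in simp_all)
        then show "i \<in> idx ` verts G" using v(1) by blast
      qed
    qed
    finally show "F ` components ?H = verts petersen" by (simp add: verts_petersen)
  qed
  let ?k = "\<lambda>(i, j). {kneser i, kneser j}"
  let ?ge = "?k \<circ> inv_into petersen_edges h"
  have "bij_betw (inv_into petersen_edges h) E' petersen_edges" by (rule bij_betw_inv_into [OF h])
  moreover have "bij_betw ?k petersen_edges (edges petersen)"
    using inj_petersen_edges by (simp add: bij_betw_def edges_petersen)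
  ultimately have ge_bij: "bij_betw ?ge E' (edges petersen)" by (rule bij_betw_trans)
  have "?ge e = F ` (\<lambda>v. joined ?H `` {v}) ` ends G e" if e: "e \<in> E'" for e
  proof -
    obtain i j where ij: "(i, j) \<in> petersen_edges" "e = h (i, j)" using h e by (auto simp: bij_betw_def)
    have inv: "inv_into petersen_edges h e = (i, j)"
      unfolding ij(2) by (rule inv_into_f_f) (use h ij(1) in \<open>auto simp: bij_betw_def\<close>)
    have eG: "e \<in> edges G" using e E' by blast
    have V: "s e \<in> verts G" "t e \<in> verts G" using G(2) [OF eG] by blast+
    have "ends G e = {s e, t e}" using G(1) eG by (simp add: oriented_def)
    then have "F ` (\<lambda>v. joined ?H `` {v}) ` ends G e = kneser ` {idx (s e), idx (t e)}"
      by (simp add: F V)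
    also have "{idx (s e), idx (t e)} = inv_into {..<10} g ` {\<pi> (s e), \<pi> (t e)}" by (simp add: idx_def)
    also have "{\<pi> (s e), \<pi> (t e)} = g ` {i, j}" using link [OF ij(1)] ij(2) by simp
    also have "inv_into {..<10} g ` g ` {i, j} = {i, j}"
      using petersen_edges_lt [OF ij(1)] g by simp
    finally show ?thesis by (simp add: inv)
  qed
  then have "isomorphic (contract G ?X) petersen"
    unfolding isomorphic_def
    using F_bij ge_bij E'
    by (intro exI [of _ F] exI [of _ ?ge])
      (simp add: contract_def Let_def ends_petersen double_diff)
  then show ?thesis unfolding contractible_to_petersen_def by blast
qed

section \<open>Cycle double covers\<close>

text \<open>Each element of \<open>L\<close> contributes the subgraph of the edges whose label
  contains it. An edge of \<open>C\<close> lies in one of these and in \<open>C\<close>, any other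
  edge in two of them.\<close>

lemma cdc_of_labelling:
  fixes L :: "'l set"
  assumes G: "oriented G s t" "\<And>e. e \<in> edges G \<Longrightarrow> ends G e \<subseteq> verts G"
    and C: "subgraph C G" "cycle C" and "finite L"
    and M2: "\<And>e. e \<in> edges G - edges C \<Longrightarrow> M e \<subseteq> L \<and> card (M e) = 2"
    and M1: "\<And>e. e \<in> edges C \<Longrightarrow> M e \<subseteq> L \<and> card (M e) = 1"
    and flow: "\<And>i v. bd (edges G) s t (\<lambda>e. of_bool (i \<in> M e) :: bit) v = 0"
  shows "\<exists>S. k_cdc (Suc (card L)) G S \<and> C \<in># S"
proof -
  define D where "D i = G\<lparr>edges := {e\<in>edges G. i \<in> M e}\<rparr>" for i
  define S where "S = add_mset C (image_mset D (mset_set L))"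
  have CG: "edges C \<subseteq> edges G" using C(1) by (simp add: subgraph_def)
  have oD: "oriented (D i) s t" for i unfolding D_def by (rule oriented_edges [OF G(1)]) auto
  have D: "subgraph (D i) G \<and> cycle (D i)" for i
  proof
    show "subgraph (D i) G" using G(2) by (auto simp: subgraph_def D_def)
    have "bd (edges (D i)) s t (\<lambda>_. 1::bit) v = 0" for v
    proof -
      have "bd {e\<in>edges G. i \<in> M e} s t (\<lambda>_. 1::bit) v =
          bd (edges G) s t (\<lambda>e. of_bool (e \<in> {e\<in>edges G. i \<in> M e})) v"
        by (rule bd_indicator [symmetric]) (use G(1) in \<open>auto simp: oriented_def\<close>)
      also have "\<dots> = bd (edges G) s t (\<lambda>e. of_bool (i \<in> M e)) v" by (rule bd_cong) auto
      finally show ?thesis using flow by (simp add: D_def)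
    qed
    then show "cycle (D i)" using cycle_iff [OF oD, of i] G(2) by (simp add: D_def)
  qed
  have "size {#C' \<in># S. e \<in> edges C'#} = 2" if e: "e \<in> edges G" for e
  proof -
    have "size {#C' \<in># image_mset D (mset_set L). e \<in> edges C'#} = card {i\<in>L. i \<in> M e}"
      using \<open>finite L\<close> e by (simp add: filter_mset_image_mset filter_mset_mset_set D_def)
    also have "{i\<in>L. i \<in> M e} = M e" using M1 M2 e by blast
    finally show ?thesis using M1 [of e] M2 [of e] e by (cases "e \<in> edges C") (auto simp: S_def)
  qed
  moreover have "subgraph C' G \<and> cycle C'" if "C' \<in># S" for C'
    using that C D \<open>finite L\<close> by (auto simp: S_def)
  moreover have "size S = Suc (card L)" using \<open>finite L\<close> by (simp add: S_def)
  moreover have "C \<in># S" by (simp add: S_def)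
  ultimately show ?thesis unfolding k_cdc_def cdc_def by blast
qed

text \<open>A graph contractible to the Petersen graph may still obtain a cover by five cycles; an
  edgeless cycle pads it to six.\<close>

lemma k_cdc_add_empty:
  assumes "k_cdc k G S" "C \<in># S"
  shows "\<exists>S'. k_cdc (Suc k) G S' \<and> C \<in># S'"
proof -
  let ?D = "G\<lparr>edges := {}\<rparr>"
  have "subgraph ?D G \<and> cycle ?D" by (simp add: subgraph_def cycle_def degree_def)
  then have "k_cdc (Suc k) G (add_mset ?D S)" using assms(1) by (auto simp: k_cdc_def cdc_def)
  then show ?thesis using assms(2) by (intro exI [of _ "add_mset ?D S"]) simp
qed

text \<open>The ends of \<open>e\<close> stay connected without \<open>e\<close>; a chain between
  them together with \<open>e\<close> is even.\<close>

lemma two_edge_connected_bridgeless: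
  assumes o: "oriented G s t" and G: "\<And>e. e \<in> edges G \<Longrightarrow> ends G e \<subseteq> verts G" and "edge_connected 2 G"
  shows "bridgeless (edges G) s t"
  unfolding bridgeless_def
proof
  fix e assume e: "e \<in> edges G"
  let ?R = "edges G - {e}"
  have fin: "finite (edges G)" using o by (simp add: oriented_def)
  have "connected (delete_edges G {e})"
    using assms(3) e unfolding edge_connected_def by auto
  moreover have "ends G e = {s e, t e}" using o e by (simp add: oriented_def)
  then have "s e \<in> verts G" "t e \<in> verts G" using G [OF e] by auto
  moreover have oR: "oriented (G\<lparr>edges := ?R\<rparr>) s t" by (rule oriented_edges [OF o]) auto
  ultimately have "(s e, t e) \<in> conn ?R s t"
    using joined_iff [OF oR, of "s e" "t e"] by (simp add: connected_def delete_edges_def)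
  then obtain c :: "'b \<Rightarrow> bit" where c: "\<And>e'. c e' \<noteq> 0 \<Longrightarrow> e' \<in> ?R"
    "\<And>v. bd ?R s t c v = of_bool (v = s e) + of_bool (v = t e)"
    using conn_chain [of "s e" "t e" ?R s t] fin by auto
  have c0: "c e = 0" using c(1) by blast
  let ?x = "\<lambda>e'. c e' + of_bool (e' \<in> {e})"
  have "bd (edges G) s t ?x v = 0" for v
  proof -
    have "bd (edges G) s t c v = bd ?R s t c v"
    proof (rule bd_restrict [OF fin])
      show "c e' = 0" if "e' \<in> edges G - ?R" for e' using c(1) [of e'] that by blast
    qed auto
    moreover have "bd (edges G) s t (\<lambda>e'. of_bool (e' \<in> {e}) :: bit) v = bd {e} s t (\<lambda>_. 1) v"
      by (rule bd_indicator [OF fin]) (use e in simp)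
    moreover have "bd {e} s t (\<lambda>_. 1::bit) v = of_bool (v = s e) + of_bool (v = t e)"
      by (auto simp: bd_insert)
    ultimately show ?thesis unfolding bd_add c(2) by simp
  qed
  then show "\<exists>x::'b \<Rightarrow> bit. x e = 1 \<and> (\<forall>v. bd (edges G) s t x v = 0)"
    using c0 by (intro exI [of _ ?x]) simp
qed

lemma edge_connected_conn:
  assumes o: "oriented G s t" and "edge_connected k G" "0 < k" "u \<in> verts G" "v \<in> verts G"
  shows "(u, v) \<in> conn (edges G) s t"
proof -
  have "connected (delete_edges G {})" using assms(2,3) unfolding edge_connected_def by auto
  then show ?thesis
    using joined_iff [OF o, of u v] assms(4,5) by (simp add: connected_def delete_edges_def)
qed

text \<open>A component of \<open>C\<close> collapses to one of its own vertices. The collapsed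
  graph thus keeps the vertex type, and the map is idempotent.\<close>

definition rep :: "('v, 'e) mgraph \<Rightarrow> 'v \<Rightarrow> 'v" where
  "rep C v = (if v \<in> verts C then SOME u. u \<in> joined C `` {v} else v)"

context
  fixes C :: "('v, 'e) mgraph" and s t
  assumes o: "oriented C s t"
begin

lemma rep_joined: "v \<in> verts C \<Longrightarrow> (v, rep C v) \<in> joined C"
proof -
  assume v: "v \<in> verts C"
  then have "v \<in> joined C `` {v}" by (rule equiv_class_self [OF equiv_joined [OF o]])
  then have "rep C v \<in> joined C `` {v}" unfolding rep_def using v by (auto intro: someI)
  then show ?thesis by simp
qed

lemma rep_in: "rep C v \<in> verts C \<longleftrightarrow> v \<in> verts C"
  using rep_joined [of v] by (cases "v \<in> verts C") (auto simp: joined_iff [OF o] rep_def)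

lemma rep_eq: "(u, v) \<in> joined C \<Longrightarrow> rep C u = rep C v"
proof -
  assume uv: "(u, v) \<in> joined C"
  then have "u \<in> verts C" "v \<in> verts C" by (auto simp: joined_iff [OF o])
  moreover have "joined C `` {u} = joined C `` {v}"
    using equiv_class_eq [OF equiv_joined [OF o] uv] .
  ultimately show ?thesis by (simp add: rep_def)
qed

lemma rep_idem: "rep C (rep C v) = rep C v"
proof (cases "v \<in> verts C")
  case True
  show ?thesis using rep_eq [OF rep_joined [OF True]] by simp
qed (simp add: rep_def)

lemma rep_conn:
  assumes "rep C u = rep C v"
  shows "(u, v) \<in> conn (edges C) s t"
proof (cases "u \<in> verts C")
  case True
  then have "v \<in> verts C" using assms rep_in by metis
  have "(u, rep C u) \<in> conn (edges C) s t" "(v, rep C v) \<in> conn (edges C) s t"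
    using rep_joined [OF True] rep_joined [OF \<open>v \<in> verts C\<close>] by (simp_all add: joined_iff [OF o])
  then show ?thesis using assms conn_sym conn_trans by metis
next
  case False
  then have "v \<notin> verts C" using assms rep_in by metis
  then show ?thesis using assms False by (simp add: rep_def)
qed

lemma card_rep:
  assumes "finite (verts C)"
  shows "card (rep C ` verts C) \<le> card (components C)"
proof -
  have "rep C ` verts C = (\<lambda>K. SOME u. u \<in> K) ` components C"
    unfolding components_def quotient_def by (auto simp: rep_def image_iff)
  moreover have "finite (components C)"
    unfolding components_def using assms by (simp add: quotient_def)
  ultimately show ?thesis using card_image_le by metis
qed

end

text \<open>An even set avoiding the representatives has no edge at \<open>C\<close>, so the
  collapse does not affect it; it is an even edge set of the tree and therefore empty.\<close>

lemma forest_rep: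
  assumes tree: "tree T" and oT: "oriented T s t" and oC: "oriented C s t"
    and sub: "\<And>e. e \<in> edges T \<Longrightarrow> ends T e \<subseteq> verts T"
  shows "forest (edges T) (rep C \<circ> s) (rep C \<circ> t) (rep C ` verts C)"
  unfolding forest_def
proof (intro allI impI, elim conjE)
  fix x :: "'b \<Rightarrow> bit"
  assume supp: "\<forall>e\<in>edges T. x e \<noteq> 0 \<longrightarrow>
      (rep C \<circ> s) e \<notin> rep C ` verts C \<and> (rep C \<circ> t) e \<notin> rep C ` verts C"
    and flow: "\<forall>v. bd (edges T) (rep C \<circ> s) (rep C \<circ> t) x v = 0"
  have fin: "finite (edges T)" using oT by (simp add: oriented_def)
  have supp': "s e \<notin> verts C \<and> t e \<notin> verts C" if "e \<in> edges T" "x e \<noteq> 0" for e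
    using supp that by auto
  have rep_out: "rep C u = v \<longleftrightarrow> u = v" if "v \<notin> verts C" for u v
    using rep_in [OF oC, of u] that by (cases "u \<in> verts C") (auto simp: rep_def)
  have bd0: "bd (edges T) s t x v = 0" for v
  proof (cases "v \<in> verts C")
    case True
    have "x e = 0" if "e \<in> edges T" "s e = v \<or> t e = v" for e
      using supp' [OF that(1)] that(2) True by blast
    then show ?thesis unfolding bd_def by (intro sum.neutral) auto
  next
    case False
    have "bd (edges T) (rep C \<circ> s) (rep C \<circ> t) x v = bd (edges T) s t x v"
      unfolding bd_def by (simp add: rep_out [OF False])
    then show ?thesis using flow by simp
  qed
  define D where "D = {e\<in>edges T. x e \<noteq> 0}"
  have "D = {}"
  proof (rule tree_no_even_set [OF tree oT sub])
    show "D \<subseteq> edges T" by (auto simp: D_def)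
    show "bd D s t (\<lambda>_. 1::bit) v = 0" for v
    proof -
      have "bd D s t (\<lambda>_. 1::bit) v = bd (edges T) s t (\<lambda>e. of_bool (e \<in> D)) v"
        by (rule bd_indicator [OF fin, symmetric]) (auto simp: D_def)
      also have "\<dots> = bd (edges T) s t x v"
      proof (rule bd_cong)
        fix e assume "e \<in> edges T"
        then show "of_bool (e \<in> D) = x e" by (cases "x e") (auto simp: D_def)
      qed
      finally show ?thesis using bd0 by simp
    qed
  qed
  then show "\<forall>e\<in>edges T. x e = 0" by (auto simp: D_def)
qed

lemma cdc_or_petersen:
  fixes G T C :: "('v, 'e) mgraph"
  assumes G: "multigraph G" "edge_connected 2 G" and T: "tree T" and C: "cycle C"
    and dec: "decomposition G {T, C}" and k: "card (components C) \<le> 3"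
  shows "(\<exists>S. k_cdc 5 G S \<and> C \<in># S) \<or>
    card (components C) = 3 \<and> contractible_to_petersen G \<and> (\<exists>S. k_cdc 6 G S \<and> C \<in># S)"
proof -
  obtain s t where oG: "oriented G s t" using oriented_ex [OF G(1)] by blast
  have sub: "subgraph T G" "subgraph C G" using dec by (auto simp: decomposition_def)
  have oT: "oriented T s t" and oC: "oriented C s t"
    using oriented_subgraph [OF oG] sub by auto
  have Gv: "ends G e \<subseteq> verts G" if "e \<in> edges G" for e using G(1) that by (simp add: multigraph_def)
  have Tv: "ends T e \<subseteq> verts T" if "e \<in> edges T" for e using sub(1) that unfolding subgraph_def by blast
  have Cv: "ends C e \<subseteq> verts C" if "e \<in> edges C" for e using sub(2) that unfolding subgraph_def by blast
  have st: "s e \<in> verts H \<and> t e \<in> verts H" if "oriented H s t" "e \<in> edges H" "ends H e \<subseteq> verts H"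
    for H :: "('v, 'e) mgraph" and e
    using that by (auto simp: oriented_def)
  let ?V = "verts G" and ?T = "edges T" and ?C = "edges C" and ?\<kappa> = "rep C" and ?W = "rep C ` verts C"
  have fin: "finite ?V" "finite ?T" "finite ?C"
    using G(1) oT oC by (auto simp: multigraph_def oriented_def)
  have even: "bd ?C s t (\<lambda>_. 1::bit) v = 0" for v using cycle_iff [OF oC Cv] C by blast
  have E: "edges G = ?T \<union> ?C" using dec by (auto simp: decomposition_def)
  have disj: "?T \<inter> ?C = {}"
  \<comment> \<open>For \<open>T = C\<close> the set \<open>{T, C}\<close> has one member and says
    nothing about disjointness; then the edges of the tree form an even set, so there are
    none.\<close>
  proof (cases "T = C")
    case True
    then have "?T = {}" using tree_no_even_set [OF T oT Tv subset_refl] even by blast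
    then show ?thesis by simp
  next
    case False
    then show ?thesis using dec unfolding decomposition_def by blast
  qed
  have ends: "s ` (?T \<union> ?C) \<subseteq> ?V" "t ` (?T \<union> ?C) \<subseteq> ?V"
    using st [OF oG _ Gv] unfolding E by blast+
  have \<kappa>: "?\<kappa> (s e) = ?\<kappa> (t e)" if "e \<in> ?C" for e
  proof (rule rep_eq [OF oC])
    show "(s e, t e) \<in> joined C"
      using st [OF oC that Cv [OF that]] conn_edge(1) [OF that, of s t] by (simp add: joined_iff [OF oC])
  qed
  have connT: "(a, b) \<in> conn ?T s t" if "a \<in> s ` ?T \<union> t ` ?T" "b \<in> s ` ?T \<union> t ` ?T" for a b
  proof -
    have "a \<in> verts T" "b \<in> verts T" using that st [OF oT _ Tv] by blast+
    then show ?thesis using T by (simp add: tree_def connected_def joined_iff [OF oT])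
  qed
  have forest: "forest ?T (?\<kappa> \<circ> s) (?\<kappa> \<circ> t) ?W" by (rule forest_rep [OF T oT oC Tv])
  have br: "bridgeless ?T (?\<kappa> \<circ> s) (?\<kappa> \<circ> t)"
  proof -
    have "bridgeless (edges G - ?C) (?\<kappa> \<circ> s) (?\<kappa> \<circ> t)"
      by (rule bridgeless_contract [OF two_edge_connected_bridgeless [OF oG Gv G(2)]])
        (use fin \<kappa> in \<open>auto simp: E\<close>)
    moreover have "edges G - ?C = ?T" using E disj by blast
    ultimately show ?thesis by simp
  qed
  have finC: "finite (verts C)" using sub(2) fin(1) by (auto simp: subgraph_def intro: finite_subset)
  have W: "finite ?W" "card ?W \<le> card (components C)"
    using finC card_rep [OF oC finC] by auto
  consider "klein_flow ?T (?\<kappa> \<circ> s) (?\<kappa> \<circ> t)" | "petersen_contraction ?T (?\<kappa> \<circ> s) (?\<kappa> \<circ> t) ?W"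
    using flow_or_petersen [OF fin(2) W(1) _ forest br] W(2) k by linarith
  then show ?thesis
  proof cases
    case 1
    obtain M :: "'e \<Rightarrow> (bit \<times> bit) set" where M: "\<forall>e\<in>?T. card (M e) = 2" "\<forall>e\<in>?C. card (M e) = 1"
      "\<forall>h v. bd (?T \<union> ?C) s t (\<lambda>e. of_bool (h \<in> M e) :: bit) v = 0"
      using lift_flow [OF fin disj ends even \<kappa> rep_conn [OF oC] connT 1] by blast
    have "\<exists>S. k_cdc (Suc (card (UNIV :: (bit \<times> bit) set))) G S \<and> C \<in># S"
    proof (rule cdc_of_labelling [OF oG Gv sub(2) C])
      show "finite (UNIV :: (bit \<times> bit) set)" by (rule card_ge_0_finite) (simp add: card_UNIV_klein)
      show "M e \<subseteq> UNIV \<and> card (M e) = 2" if "e \<in> edges G - ?C" for e using M(1) that E by blast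
      show "M e \<subseteq> UNIV \<and> card (M e) = 1" if "e \<in> ?C" for e using M(2) that by blast
      show "bd (edges G) s t (\<lambda>e. of_bool (i \<in> M e) :: bit) v = 0" for i v
        unfolding E using M(3) by blast
    qed
    then show ?thesis by (simp add: card_UNIV_klein)
  next
    case 2
    obtain f :: "'v \<Rightarrow> 'v" and E' where E': "E' \<subseteq> ?T" "\<forall>e\<in>?T - E'. f ((?\<kappa> \<circ> s) e) = f ((?\<kappa> \<circ> t) e)"
      and fconn: "\<forall>a b. f a = f b \<longrightarrow> (a, b) \<in> conn (?T - E') (?\<kappa> \<circ> s) (?\<kappa> \<circ> t)"
      and fW: "card (f ` ?W) = 3" and pet: "is_petersen E' (f \<circ> (?\<kappa> \<circ> s)) (f \<circ> (?\<kappa> \<circ> t))"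
      using 2 unfolding petersen_contraction_def by blast
    obtain g h where g: "inj_on g {..<10}" and h: "bij_betw h petersen_edges E'"
      and link: "\<forall>(i, j)\<in>petersen_edges. link (f \<circ> (?\<kappa> \<circ> s)) (f \<circ> (?\<kappa> \<circ> t)) (h (i, j)) (g i) (g j)"
      using pet unfolding is_petersen_def by blast
    have link': "link (f \<circ> (?\<kappa> \<circ> s)) (f \<circ> (?\<kappa> \<circ> t)) (h (i, j)) (g i) (g j)" if "(i, j) \<in> petersen_edges" for i j
      using link that by blast
    define \<pi> where "\<pi> v = f (?\<kappa> v)" for v
    have loops: "\<pi> (s e) = \<pi> (t e)" if "e \<in> edges G - E'" for e
      using that E'(2) \<kappa> unfolding E \<pi>_def by auto
    have cls: "\<pi> u = \<pi> v \<longleftrightarrow> (u, v) \<in> conn (edges G - E') s t" for u v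
    proof
      assume "\<pi> u = \<pi> v"
      then have "(?\<kappa> u, ?\<kappa> v) \<in> conn (?T - E') (?\<kappa> \<circ> s) (?\<kappa> \<circ> t)" using fconn by (simp add: \<pi>_def)
      then have "(u, v) \<in> conn ((?T - E') \<union> ?C) s t" by (rule conn_lift) (rule rep_conn [OF oC])
      moreover have "(?T - E') \<union> ?C = edges G - E'" using E E'(1) disj by blast
      ultimately show "(u, v) \<in> conn (edges G - E') s t" by simp
    next
      assume "(u, v) \<in> conn (edges G - E') s t"
      then have "v \<in> {w. \<pi> w = \<pi> u}" by (rule conn_closed) (use loops in auto)
      then show "\<pi> u = \<pi> v" by simp
    qed
    have \<pi>_h: "{\<pi> (s (h (i, j))), \<pi> (t (h (i, j)))} = {g i, g j}" if "(i, j) \<in> petersen_edges" for i j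
      using link' [OF that] by (simp add: link_def \<pi>_def)
    \<comment> \<open>\<open>G\<close> is connected and \<open>\<pi>\<close> changes only along
      Petersen edges, so starting from an end of such an edge no other value is ever
      reached.\<close>
    have onto: "\<pi> v \<in> g ` {..<10}" if v: "v \<in> ?V" for v
    proof -
      have hp: "\<pi> (s e) \<in> g ` {..<10} \<and> \<pi> (t e) \<in> g ` {..<10}" if e: "e \<in> E'" for e
      proof -
        obtain i j where ij: "(i, j) \<in> petersen_edges" "e = h (i, j)" using h e by (auto simp: bij_betw_def)
        have "{\<pi> (s e), \<pi> (t e)} \<subseteq> g ` {..<10}"
          unfolding ij(2) \<pi>_h [OF ij(1)] using petersen_edges_lt [OF ij(1)] by auto
        then show ?thesis by blast
      qed
      have "(0, 1) \<in> petersen_edges" by (simp add: petersen_edges_def)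
      then obtain e where e: "e \<in> E'" using h by (auto simp: bij_betw_def)
      then have "e \<in> edges G" using E E'(1) by blast
      then have "s e \<in> ?V" using ends unfolding E by blast
      then have "(s e, v) \<in> conn (edges G) s t" using edge_connected_conn [OF oG G(2)] v by simp
      then have "v \<in> {w. \<pi> w \<in> g ` {..<10}}"
      proof (rule conn_closed)
        show "s e \<in> {w. \<pi> w \<in> g ` {..<10}}" using hp [OF e] by simp
        show "s e' \<in> {w. \<pi> w \<in> g ` {..<10}} \<longleftrightarrow> t e' \<in> {w. \<pi> w \<in> g ` {..<10}}" if "e' \<in> edges G" for e'
          using hp [of e'] loops [of e'] that by (cases "e' \<in> E'") auto
      qed
      then show ?thesis by simp
    qed
    have W3: "card ?W \<le> 3" using W(2) k by simp
    obtain M :: "'e \<Rightarrow> nat set" where M: "\<forall>e\<in>?T. M e \<subseteq> {..<5} \<and> card (M e) = 2"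
      "\<forall>e\<in>?C. M e \<subseteq> {..<5} \<and> card (M e) = 1"
      "\<forall>i v. bd (?T \<union> ?C) s t (\<lambda>e. of_bool (i \<in> M e) :: bit) v = 0"
    proof -
      have "\<exists>M :: 'e \<Rightarrow> nat set. (\<forall>e\<in>?T. M e \<subseteq> {..<5} \<and> card (M e) = 2) \<and>
        (\<forall>e\<in>?C. M e \<subseteq> {..<5} \<and> card (M e) = 1) \<and>
        (\<forall>i v. bd (?T \<union> ?C) s t (\<lambda>e. of_bool (i \<in> M e) :: bit) v = 0)"
      proof (rule petersen_cover [OF fin disj ends even \<kappa> rep_idem [OF oC] rep_conn [OF oC] connT
            forest br W(1) W3 _ E'(1) _ fW g h link'])
        show "?\<kappa> w = w" if "w \<in> ?W" for w using that rep_idem [OF oC] by auto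
        show "f (?\<kappa> (s e)) = f (?\<kappa> (t e))" if "e \<in> ?T - E'" for e using E'(2) that by simp
        show "f (?\<kappa> v) \<in> g ` {..<10}" if "v \<in> ?V" for v using onto [OF that] by (simp add: \<pi>_def)
      qed
      then show thesis using that by blast
    qed
    have "\<exists>S. k_cdc (Suc (card {..<5::nat})) G S \<and> C \<in># S"
    proof (rule cdc_of_labelling [OF oG Gv sub(2) C, where L = "{..<5::nat}" and M = M])
      show "finite {..<5::nat}" by simp
      show "M e \<subseteq> {..<5} \<and> card (M e) = 2" if "e \<in> edges G - ?C" for e using M(1) that E by blast
      show "M e \<subseteq> {..<5} \<and> card (M e) = 1" if "e \<in> ?C" for e using M(2) that by blast
      show "bd (edges G) s t (\<lambda>e. of_bool (i \<in> M e) :: bit) v = 0" for i v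
        unfolding E using M(3) by blast
    qed
    moreover have "contractible_to_petersen G"
    proof (rule contractibleI [OF oG _ _ _ _ g h \<pi>_h])
      show "s e \<in> ?V \<and> t e \<in> ?V" if "e \<in> edges G" for e using st [OF oG that Gv [OF that]] .
      show "E' \<subseteq> edges G" using E E'(1) by blast
      show "\<pi> u = \<pi> v \<longleftrightarrow> (u, v) \<in> conn (edges G - E') s t" for u v by (rule cls)
      show "\<pi> ` ?V \<subseteq> g ` {..<10}" using onto by blast
    qed
    \<comment> \<open>Three distinct images need three representatives, hence at least three
      components.\<close>
    moreover have "card (components C) = 3"
      using fW card_image_le [OF W(1), of f] W(2) k by simp
    ultimately show ?thesis by simp
  qed
qed

theorem theorem3p5:
  fixes G T C :: "('v, 'e) mgraph"
  assumes "multigraph G"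
    and "edge_connected 2 G"
    and "tree T"
    and "cycle C"
    and "decomposition G {T, C}"
    and "card (components C) \<le> 3"
  shows "(\<exists>S. cdc G S \<and> C \<in># S) \<and>
    (card (components C) \<le> 2 \<longrightarrow> (\<exists>S\<^sub>2. k_cdc 5 G S\<^sub>2 \<and> C \<in># S\<^sub>2)) \<and>
    (card (components C) = 3 \<longrightarrow>
      (\<not> contractible_to_petersen G \<longrightarrow> (\<exists>S\<^sub>3. k_cdc 5 G S\<^sub>3 \<and> C \<in># S\<^sub>3)) \<and>
      (contractible_to_petersen G \<longrightarrow> (\<exists>S\<^sub>3'. k_cdc 6 G S\<^sub>3' \<and> C \<in># S\<^sub>3')))"
proof -
  have "(\<exists>S. k_cdc 5 G S \<and> C \<in># S) \<or>
    card (components C) = 3 \<and> contractible_to_petersen G \<and> (\<exists>S. k_cdc 6 G S \<and> C \<in># S)"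
    by (rule cdc_or_petersen [OF assms])
  then show ?thesis
  proof
    assume "\<exists>S. k_cdc 5 G S \<and> C \<in># S"
    then obtain S where S: "k_cdc 5 G S" "C \<in># S" by blast
    then have "\<exists>S'. k_cdc 6 G S' \<and> C \<in># S'" using k_cdc_add_empty [OF S] by simp
    moreover have "cdc G S" using S(1) by (simp add: k_cdc_def)
    ultimately show ?thesis using S by blast
  next
    assume r: "card (components C) = 3 \<and> contractible_to_petersen G \<and> (\<exists>S. k_cdc 6 G S \<and> C \<in># S)"
    then obtain S where S: "k_cdc 6 G S" "C \<in># S" by blast
    moreover have "cdc G S" using S(1) by (simp add: k_cdc_def)
    ultimately show ?thesis using r by auto
  qed
qed

end
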